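(* Let $T$ be a homeomorphism of a topological space $X$, let $d\in\mathbb{N}$, and let $A\colon X\times\mathbb{N}\to L(\mathbb{R}^d)$ be a continuous cocycle over $T$ of invertible linear operators for which $$\kappa:=\sup_{x\in X}\|A_x\|\cdot\sup_{x\in X}\|A_x^{-1}\|<\infty .$$ Suppose that for some integer $1\le k<d$ and constants $K>0$, $\tau\in(0,1)$, $$\sigma_{k+1}(A_x^n)\le K\tau^n\sigma_k(A_x^n)\qquad\text{for every }x\in X,\ n\ge0 .$$ Then there exist a constant $R_{\mathcal{E}}>0$ and a continuous, $A$-equivariant splitting $\mathbb{R}^d=\mathcal{E}(x)\oplus\mathcal{F}(x)$ $(x\in X)$, with $\dim\mathcal{E}(x)=k$, such that for all $x\in X$ and $n\ge1$ $$\|(A_x^n|_{\mathcal{E}(x)})^{-1}\|\le R_{\mathcal{E}}^{-1}\big(\sigma_k(A_x^n)\big)^{-1},\qquad \|A_x^n|_{\mathcal{F}(x)}\|\le R_{\mathcal{E}}^{-2}\,\sigma_{k+1}(A_x^n),\qquad \|\pi_x\|\le R_{\mathcal{E}}^{-1},$$ where $\pi_x\colon\mathbb{R}^d\to\mathcal{E}(x)$ is the projection onto $\mathcal{E}(x)$ parallel to $\mathcal{F}(x)$. The constant $R_{\mathcal{E}}\in(0,1]$ is given by $$R_{\mathcal{E}}=\inf_{x\in X,\ n\ge 1}\frac{|\det(A_x^n|_{\mathcal{E}(x)})|}{\prod_{i=1}^k\sigma_i(A_x^n)}$$ and satisfies $$\log R_{\mathcal{E}}\ge-\left(2k\log\k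appa\cdot\left\lceil\frac{\log(3\kappa^3K)-\log(1-\tau)}{-\log\tau}\right\rceil+\frac{36k}{1-\tau}\right).$$
   Context: $\mathbb{R}^d$ carries the standard Euclidean inner product and norm $\|\cdot\|$ (also used for the operator norm). A cocycle over $T$ is a map $A\colon X\times\mathbb{N}\to L(\mathbb{R}^d)$, $(x,n)\mapsto A_x^n$ ($\mathbb{N}$ includes $0$), with $A_x^0=\mathrm{Id}$ and $A_x^{n+m}=A_{T^mx}^nA_x^m$; $A_x:=A_x^1$; continuous means $x\mapsto A_x^n$ is continuous for each $n$. $\sigma_1\ge\sigma_2\ge\cdots\ge\sigma_d$ denote singular values. For a $k$-dimensional subspace $E$ and an injective linear map $A$ on $E$, $|\det(A|_E)|$ is the factor by which $A$ scales $k$-dimensional Euclidean volume from $E$ to $AE$. Continuous $A$-equivariant splitting: $x\mapsto\mathcal{E}(x),\mathcal{F}(x)$ are continuous into the Grassmannian of subspaces of $\mathbb{R}^d$ and $A_x^n\mathcal{E}(x)=\mathcal{E}(T^nx)$, $A_x^n\mathcal{F}(x)\subseteq\mathcal{F}(T^nx)$ for all $x\in X$, $n\ge1$. *)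

theory Defs
  imports "HOL-Analysis.Analysis" "HOL-Library.Multiset"
begin

definition cocycle :: "('x \<Rightarrow> 'x) \<Rightarrow> ('x \<Rightarrow> nat \<Rightarrow> ('a::real_normed_vector \<Rightarrow>\<^sub>L 'a)) \<Rightarrow> bool" where
  "cocycle T A \<longleftrightarrow>
     (\<forall>x. A x 0 = id_blinfun) \<and>
     (\<forall>x m n. A x (n + m) = A ((T ^^ m) x) n o\<^sub>L A x m)"

definition continuous_cocycle ::
    "('x::topological_space \<Rightarrow> 'x) \<Rightarrow> ('x \<Rightarrow> nat \<Rightarrow> ('a::real_normed_vector \<Rightarrow>\<^sub>L 'a)) \<Rightarrow> bool" where
  "continuous_cocycle T A \<longleftrightarrow> cocycle T A \<and> (\<forall>n. continuous_on UNIV (\<lambda>x. A x n))"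


(* The adjoint of A composed with A is self-adjoint, so the algebraic multiplicity of an
   eigenvalue is the dimension of its eigenspace. *)
definition gram_eigenspace :: "('a::euclidean_space \<Rightarrow>\<^sub>L 'a) \<Rightarrow> real \<Rightarrow> 'a set" where
  "gram_eigenspace A c = {v. adjoint (blinfun_apply A) (A v) = c *\<^sub>R v}"

definition singular_value_mset :: "('a::euclidean_space \<Rightarrow>\<^sub>L 'a) \<Rightarrow> real multiset" where
  "singular_value_mset A =
     (\<Sum>c \<in> {c. gram_eigenspace A c \<noteq> {0}}. replicate_mset (dim (gram_eigenspace A c)) (sqrt c))"

(* Singular values in decreasing order, numbered from 1; meaningful only for indices between
   1 and DIM('a). *)
definition singular_value :: "('a::euclidean_space \<Rightarrow>\<^sub>L 'a) \<Rightarrow> nat \<Rightarrow> real" where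
  "singular_value A i = rev (sorted_list_of_multiset (singular_value_mset A)) ! (i - 1)"


(* The usual topology on the Grassmannian (of subspaces of all dimensions), induced by
   identifying a subspace with the orthogonal projection onto it; equivalently, that of the
   gap metric, the norm distance between orthogonal projections. *)
definition grassmannian :: "'a::euclidean_space set topology" where
  "grassmannian = pullback_topology {S. subspace S} (\<lambda>S. Blinfun (closest_point S)) euclidean"

definition direct_sum_decomposition :: "'a::real_vector set \<Rightarrow> 'a set \<Rightarrow> bool" where
  "direct_sum_decomposition E F \<longleftrightarrow>
     subspace E \<and> subspace F \<and> E \<inter> F = {0} \<and> {u + w |u w. u \<in> E \<and> w \<in> F} = UNIV"

definition proj_along :: "'a::real_vector set \<Rightarrow> 'a set \<Rightarrow> 'a \<Rightarrow> 'a" where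
  "proj_along E F v = (THE u. u \<in> E \<and> v - u \<in> F)"

definition continuous_equivariant_splitting ::
    "('x::topological_space \<Rightarrow> 'x) \<Rightarrow> ('x \<Rightarrow> nat \<Rightarrow> ('a::euclidean_space \<Rightarrow>\<^sub>L 'a)) \<Rightarrow>
     ('x \<Rightarrow> 'a set) \<Rightarrow> ('x \<Rightarrow> 'a set) \<Rightarrow> bool" where
  "continuous_equivariant_splitting T A E F \<longleftrightarrow>
     (\<forall>x. direct_sum_decomposition (E x) (F x)) \<and>
     continuous_map euclidean grassmannian E \<and>
     continuous_map euclidean grassmannian F \<and>
     (\<forall>x. \<forall>n\<ge>1. A x n ` E x = E ((T ^^ n) x) \<and> A x n ` F x \<subseteq> F ((T ^^ n) x))"


(* Operator norm of a linear map defined on the subspace S only; onorm_on UNIV = onorm. *)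
definition onorm_on :: "'a::real_normed_vector set \<Rightarrow> ('a \<Rightarrow> 'b::real_normed_vector) \<Rightarrow> real" where
  "onorm_on S f = (SUP v\<in>S. norm (f v) / norm v)"


(* Lebesgue measure of dimension (dim S) on a subspace S, as a measure on the ambient space,
   obtained from Cartesian coordinates in an orthonormal basis of S. It does not depend on the
   basis. *)
definition orthonormal_basis_of :: "'a::euclidean_space set \<Rightarrow> 'a set" where
  "orthonormal_basis_of S =
     (SOME B. B \<subseteq> S \<and> pairwise orthogonal B \<and> (\<forall>b\<in>B. norm b = 1) \<and> span B = S)"

definition lborel_subspace :: "'a::euclidean_space set \<Rightarrow> 'a measure" where
  "lborel_subspace S =
     distr (\<Pi>\<^sub>M b\<in>orthonormal_basis_of S. lborel) borel
       (\<lambda>f. \<Sum>b\<in>orthonormal_basis_of S. f b *\<^sub>R b)"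

(* |det (A|_S)|: the factor by which A, assumed injective on S, scales (dim S)-dimensional
   volume from S to A S. *)
definition abs_det_on :: "'a::euclidean_space set \<Rightarrow> ('a \<Rightarrow> 'b::euclidean_space) \<Rightarrow> real" where
  "abs_det_on S A =
     (THE c. c \<ge> 0 \<and>
        (\<forall>B\<in>sets borel. B \<subseteq> S \<longrightarrow>
           emeasure (lborel_subspace (A ` S)) (A ` B) = ennreal c * emeasure (lborel_subspace S) B))"

end

(*
  Pull back to the past: the leading k-dimensional singular subspaces U_n(x) = A^n W of
  A^n at T^(-n) x (W spanned by the first k right singular vectors) satisfy
  gap(U_n, U_(n+1)) <= kappa K tau^n by domination, so they converge uniformly; the limit E is
  continuous and equivariant.  The same construction for the adjoint cocycle over T^(-1)
  gives the limit of the spaces spanned by the first k right singular vectors of A_x^n, and F is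
  its orthogonal complement.

  Transversality of E and F is not shown directly.  Since A_x^n W(A_x^(n+1)) is close to
  U_n(T^n x), hence to E(T^n x), the product of the first k singular values grows from time n
  to n+1 by at most (1 + O(tau^n))^k times the determinant on E(T^n x).  As determinants on E are
  multiplicative, this bounds R below, with a loss of kappa^k per step before alignment and a
  geometric series afterwards.  Then R controls all the rest: for a unit vector e in E,
  det(A_x^n|E) <= sigma_1 ... sigma_k |D e|, where D is the identity on the leading right singular
  space and contracts its complement by sigma_(k+1)/sigma_k.  Letting n tend to infinity gives
  |P e| >= R for the orthogonal projection P with kernel F, which bounds the angle of E and F; comparing
  determinants on E + span f for f in F with sigma_1 ... sigma_(k+1) bounds A_x^n on F.
*)
theory Submission
  imports Defs
begin

subsection \<open>Orthogonal projections and the gap between subspaces\<close>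

text \<open>The determinant of the statement is a scaling factor between measures carried by
  subspaces, so it is first made algebraic: a map on a subspace is extended to an ambient bijection
  that is isometric on the orthogonal complement, and its determinant becomes the factor of ambient
  Lebesgue measure. Afterwards two rules carry the work: multiplicativity under composition, and
  base times height for one more dimension.

  The second obstacle is that the leading singular spaces are mere choices, and nothing makes them
  continuous in the base point. No continuity of the choice is ever tracked: once the maps at two
  points are close, domination alone makes the images of the chosen spaces close for large times.

  The ceiling in the final bound is the least integer n with 3 \<kappa>^3 K \<tau>^n \<le> 1 -
  \<tau>. One power of \<kappa> enters when consecutive times are compared and one when determinants
  on nearby spaces are compared; the third is spare room. From that time N on, the loss at step n is
  at most exp(2k \<tau>^(n-N)), and the product of these losses is at most
  exp(2k/(1-\<tau>)).\<close>

lemma closest_point_in_subspace: "subspace S \<Longrightarrow> closest_point S v \<in> S"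
  for S :: "'a::euclidean_space set"
  by (metis closest_point_in_set closed_subspace empty_iff subspace_0)

text \<open>The variational inequality for closest points of a convex set, tested at both
  \<open>?p + s\<close> and \<open>?p - s\<close>, becomes an equality.\<close>

lemma closest_point_subspace_orth:
  fixes S :: "'a::euclidean_space set"
  assumes S: "subspace S" and s: "s \<in> S"
  shows "(v - closest_point S v) \<bullet> s = 0"
proof -
  let ?p = "closest_point S v"
  have p: "?p \<in> S" by (rule closest_point_in_subspace[OF S])
  have dot: "(v - ?p) \<bullet> (x - ?p) \<le> 0" if "x \<in> S" for x
    using closest_point_dot[of S x v] S that subspace_imp_convex closed_subspace by blast
  from dot[of "?p + s"] dot[of "?p - s"] S p s show ?thesis
    by (simp add: subspace_add subspace_diff inner_diff_right)
qed

lemma closest_point_subspace_eqI: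
  fixes S :: "'a::euclidean_space set"
  assumes S: "subspace S" and p: "p \<in> S" and o: "\<And>s. s \<in> S \<Longrightarrow> (v - p) \<bullet> s = 0"
  shows "closest_point S v = p"
proof -
  let ?q = "closest_point S v"
  have d: "?q - p \<in> S" using S p by (simp add: closest_point_in_subspace subspace_diff)
  have "(?q - p) \<bullet> (?q - p) = (v - p) \<bullet> (?q - p) - (v - ?q) \<bullet> (?q - p)"
    by (simp add: inner_diff_left)
  also have "\<dots> = 0" using o[OF d] closest_point_subspace_orth[OF S d] by simp
  finally show ?thesis by simp
qed

lemma linear_closest_point:
  fixes S :: "'a::euclidean_space set"
  assumes S: "subspace S" shows "linear (closest_point S)"
proof
  fix u v :: 'a and c :: real
  note i = closest_point_in_subspace[OF S] and o = closest_point_subspace_orth[OF S]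
  show "closest_point S (u + v) = closest_point S u + closest_point S v"
  proof (rule closest_point_subspace_eqI[OF S])
    fix s assume s: "s \<in> S"
    show "(u + v - (closest_point S u + closest_point S v)) \<bullet> s = 0"
      using o[OF s, of u] o[OF s, of v] by (simp add: inner_diff_left inner_add_left)
  qed (simp add: S i subspace_add)
  show "closest_point S (c *\<^sub>R v) = c *\<^sub>R closest_point S v"
  proof (rule closest_point_subspace_eqI[OF S])
    fix s assume s: "s \<in> S"
    show "(c *\<^sub>R v - c *\<^sub>R closest_point S v) \<bullet> s = 0"
      using o[OF s, of v] by (simp add: inner_diff_left)
  qed (simp add: S i subspace_scale)
qed

lemma mem_orthogonal_comp: "v \<in> S\<^sup>\<bottom> \<longleftrightarrow> (\<forall>s\<in>S. v \<bullet> s = 0)"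
  by (auto simp: orthogonal_comp_def orthogonal_def inner_commute)

lemma orthogonal_compD:
  assumes "v \<in> S\<^sup>\<bottom>" "s \<in> S" shows "v \<bullet> s = 0" "s \<bullet> v = 0"
  using assms by (auto simp: orthogonal_comp_def orthogonal_def inner_commute)

lemma diff_closest_point_orth:
  "subspace S \<Longrightarrow> v - closest_point S v \<in> S\<^sup>\<bottom>" for S :: "'a::euclidean_space set"
  by (simp add: mem_orthogonal_comp closest_point_subspace_orth)

lemma closest_point_subspace_self: "subspace S \<Longrightarrow> v \<in> S \<Longrightarrow> closest_point S v = v"
  for S :: "'a::euclidean_space set"
  by (simp add: closest_point_self)

lemma closest_point_orthogonal_comp_0: "subspace S \<Longrightarrow> v \<in> S\<^sup>\<bottom> \<Longrightarrow> closest_point S v = 0"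
  for S :: "'a::euclidean_space set"
  by (rule closest_point_subspace_eqI) (auto simp: subspace_0 mem_orthogonal_comp)

lemma closest_point_orthogonal_comp:
  fixes S :: "'a::euclidean_space set"
  assumes "subspace S" shows "closest_point (S\<^sup>\<bottom>) v = v - closest_point S v"
proof (rule closest_point_subspace_eqI)
  fix s assume "s \<in> S\<^sup>\<bottom>"
  then show "(v - (v - closest_point S v)) \<bullet> s = 0"
    using closest_point_in_subspace[OF assms, of v] by (simp add: mem_orthogonal_comp inner_commute[of _ s])
qed (simp_all add: assms subspace_orthogonal_comp diff_closest_point_orth)

lemma closest_point_selfadjoint:
  fixes S :: "'a::euclidean_space set"
  assumes S: "subspace S"
  shows "closest_point S u \<bullet> v = u \<bullet> closest_point S v"
  using closest_point_subspace_orth[OF S closest_point_in_subspace[OF S, of u], of v]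
    closest_point_subspace_orth[OF S closest_point_in_subspace[OF S, of v], of u]
  by (simp add: inner_diff_left inner_diff_right inner_commute)

lemma norm_add_orth_sq: "u \<bullet> v = 0 \<Longrightarrow> (norm (u + v))\<^sup>2 = (norm u)\<^sup>2 + (norm v)\<^sup>2"
  for u :: "'a::real_inner"
  by (simp add: power2_norm_eq_inner inner_add_left inner_add_right inner_commute)

lemma norm_le_norm_add_orth: "u \<bullet> v = 0 \<Longrightarrow> norm u \<le> norm (u + v)"
  for u :: "'a::real_inner"
  by (rule power2_le_imp_le) (simp_all add: norm_add_orth_sq)

lemma norm_closest_point_pythagoras:
  fixes S :: "'a::euclidean_space set"
  assumes S: "subspace S"
  shows "(norm v)\<^sup>2 = (norm (closest_point S v))\<^sup>2 + (norm (v - closest_point S v))\<^sup>2"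
  using norm_add_orth_sq[of "closest_point S v" "v - closest_point S v"]
    closest_point_subspace_orth[OF S closest_point_in_subspace[OF S], of v]
  by (simp add: inner_commute)

lemma norm_closest_point_le: "subspace S \<Longrightarrow> norm (closest_point S v) \<le> norm v"
  for S :: "'a::euclidean_space set"
  by (rule power2_le_imp_le) (simp_all add: norm_closest_point_pythagoras[of S v])

lemma norm_diff_closest_point_le: "subspace S \<Longrightarrow> norm (v - closest_point S v) \<le> norm v"
  for S :: "'a::euclidean_space set"
  by (rule power2_le_imp_le) (simp_all add: norm_closest_point_pythagoras[of S v])

lemma norm_diff_closest_point_min:
  fixes S :: "'a::euclidean_space set"
  assumes S: "subspace S" and s: "s \<in> S"
  shows "norm (v - closest_point S v) \<le> norm (v - s)"
  using closest_point_le[OF closed_subspace[OF S] s, of v] by (simp add: dist_norm)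

lemma dim_orthogonal_comp:
  fixes S :: "'a::euclidean_space set"
  assumes "subspace S" shows "dim (S\<^sup>\<bottom>) + dim S = DIM('a)"
  using dim_subspace_orthogonal_to_vectors[of S UNIV] assms by (simp add: orthogonal_comp_def)

lemma subspaces_meet:
  fixes S S' :: "'a::euclidean_space set"
  assumes S: "subspace S" "subspace S'" and d: "dim S + dim S' > DIM('a)"
  obtains v where "v \<in> S" "v \<in> S'" "v \<noteq> 0"
proof -
  have "dim {x + y |x y. x \<in> S \<and> y \<in> S'} \<le> DIM('a)" by (rule dim_subset_UNIV)
  then have "dim (S \<inter> S') > 0" using dim_sums_Int[OF S] d by linarith
  then show ?thesis using that by (metis IntE dim_eq_0 less_not_refl subsetI singletonI)
qed

text \<open>For unit vectors of \<open>S\<close>, the distance to \<open>S'\<close> is the sine of the angle with \<open>S'\<close>.\<close>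
definition near :: "real \<Rightarrow> 'a::euclidean_space set \<Rightarrow> 'a set \<Rightarrow> bool" where
  "near \<delta> S S' \<longleftrightarrow> (\<forall>v\<in>S. norm (v - closest_point S' v) \<le> \<delta> * norm v)"

lemma near_mono: "near a S S' \<Longrightarrow> a \<le> b \<Longrightarrow> near b S S'"
  unfolding near_def by (meson mult_right_mono norm_ge_zero order_trans)

text \<open>The errors simply add, because the second one is measured on the projected vector, which
  is no longer than \<open>v\<close>.\<close>

lemma near_trans:
  assumes S: "subspace S'" "subspace S''" and n: "near a S S'" "near b S' S''" and b: "0 \<le> b"
  shows "near (a + b) S S''"
  unfolding near_def
proof
  fix v assume v: "v \<in> S"
  let ?p = "closest_point S' v"
  have p: "?p \<in> S'" by (rule closest_point_in_subspace[OF S(1)])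
  have "norm (v - closest_point S'' v) \<le> norm (v - closest_point S'' ?p)"
    by (rule norm_diff_closest_point_min[OF S(2) closest_point_in_subspace[OF S(2)]])
  also have "\<dots> \<le> norm (v - ?p) + norm (?p - closest_point S'' ?p)"
    by norm
  also have "\<dots> \<le> a * norm v + b * norm ?p"
    using n v p by (intro add_mono) (auto simp: near_def)
  also have "\<dots> \<le> a * norm v + b * norm v"
    by (intro add_left_mono mult_left_mono norm_closest_point_le S b)
  finally show "norm (v - closest_point S'' v) \<le> (a + b) * norm v" by (simp add: distrib_right)
qed

lemma near_inj:
  assumes S: "subspace S" "subspace S'" and n: "near \<delta> S S'" and \<delta>: "\<delta> < 1"
  shows "inj_on (closest_point S') S"
proof -
  have "v = 0" if "v \<in> S" "closest_point S' v = 0" for v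
  proof (rule ccontr)
    assume "v \<noteq> 0"
    then have "\<delta> * norm v < 1 * norm v" using \<delta> by (intro mult_strict_right_mono) auto
    then show False using n that unfolding near_def by (metis diff_zero less_le_not_le mult_1)
  qed
  then show ?thesis
    by (subst linear_injective_on_subspace_0[OF linear_closest_point[OF S(2)] S(1)]) auto
qed

lemma near_dim_le:
  assumes S: "subspace S" "subspace S'" and n: "near \<delta> S S'" and \<delta>: "\<delta> < 1"
  shows "dim S \<le> dim S'"
proof -
  have "inj_on (closest_point S') (span S)"
    using near_inj[OF S n \<delta>] S(1) by (metis span_eq_iff)
  then have "dim S = dim (closest_point S' ` S)"
    using dim_image_eq[OF linear_closest_point[OF S(2)]] by metis
  also have "\<dots> \<le> dim S'"
    by (intro dim_subset) (auto simp: closest_point_in_subspace[OF S(2)])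
  finally show ?thesis .
qed

text \<open>With equal dimensions the projection maps \<open>S\<close> onto \<open>S'\<close>, so
  each \<open>v\<close> in \<open>S'\<close> is the projection of some \<open>u\<close> in
  \<open>S\<close>. The cosine of the angle of \<open>u\<close> and \<open>v\<close> is at least
  sqrt(1 - \<delta>^2), and this same \<open>u\<close> shows that \<open>v\<close> is close to
  \<open>S\<close>.\<close>

lemma near_sym:
  assumes S: "subspace S" "subspace S'" and n: "near \<delta> S S'" and \<delta>: "\<delta> < 1" "0 \<le> \<delta>"
    and d: "dim S = dim S'"
  shows "near \<delta> S' S"
  unfolding near_def
proof
  fix v assume v: "v \<in> S'"
  have "inj_on (closest_point S') (span S)"
    using near_inj[OF S n \<delta>(1)] S(1) by (metis span_eq_iff)
  then have "dim (closest_point S' ` S) = dim S'"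
    using dim_image_eq[OF linear_closest_point[OF S(2)]] d by metis
  moreover have "closest_point S' ` S \<subseteq> S'"
    by (auto simp: closest_point_in_subspace[OF S(2)])
  ultimately have "closest_point S' ` S = S'"
    by (intro subspace_dim_equal linear_subspace_image linear_closest_point S) auto
  then obtain u where u: "u \<in> S" "closest_point S' u = v" using v by (metis imageE)
  show "norm (v - closest_point S v) \<le> \<delta> * norm v"
  proof (cases "v = 0")
    case True
    then show ?thesis using closest_point_subspace_self[OF S(1)] S(1) by (simp add: subspace_0)
  next
    case False
    then have u0: "u \<noteq> 0" using u closest_point_subspace_self[OF S(2)] S(2) subspace_0 by fastforce
    have "(norm (u - v))\<^sup>2 \<le> (\<delta> * norm u)\<^sup>2"
      using n u unfolding near_def by (intro power_mono) auto
    then have vu: "(norm v)\<^sup>2 \<ge> (1 - \<delta>\<^sup>2) * (norm u)\<^sup>2"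
      using norm_closest_point_pythagoras[OF S(2), of u] u
      by (simp add: algebra_simps power_mult_distrib)
    have "(norm v)\<^sup>2 = v \<bullet> u"
      using closest_point_subspace_orth[OF S(2) v, of u] u
      by (simp add: inner_diff_left inner_diff_right inner_commute power2_norm_eq_inner)
    also have "\<dots> = closest_point S v \<bullet> u"
      using closest_point_subspace_orth[OF S(1) u(1), of v] by (simp add: inner_diff_left)
    also have "\<dots> \<le> norm (closest_point S v) * norm u" by (rule norm_cauchy_schwarz)
    finally have "(norm v)\<^sup>2 \<le> norm (closest_point S v) * norm u" .
    then have "((norm v)\<^sup>2)\<^sup>2 \<le> (norm (closest_point S v))\<^sup>2 * (norm u)\<^sup>2"
      by (metis power_mono power_mult_distrib zero_le_power2)
    moreover have "(1 - \<delta>\<^sup>2) * (norm v)\<^sup>2 * (norm u)\<^sup>2 \<le> ((norm v)\<^sup>2)\<^sup>2"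
      using mult_right_mono[OF vu, of "(norm v)\<^sup>2"] by (simp add: algebra_simps power2_eq_square)
    ultimately have "(1 - \<delta>\<^sup>2) * (norm v)\<^sup>2 * (norm u)\<^sup>2 \<le> (norm (closest_point S v))\<^sup>2 * (norm u)\<^sup>2"
      by linarith
    then have "(1 - \<delta>\<^sup>2) * (norm v)\<^sup>2 \<le> (norm (closest_point S v))\<^sup>2"
      using u0 by simp
    then have "(norm (v - closest_point S v))\<^sup>2 \<le> (\<delta> * norm v)\<^sup>2"
      using norm_closest_point_pythagoras[OF S(1), of v] by (simp add: algebra_simps power_mult_distrib)
    then show ?thesis by (rule power2_le_imp_le) (simp add: \<delta>)
  qed
qed

text \<open>P - Q = (1 - Q)P - Q(1 - P), and the two terms have orthogonal values. Pythagoras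
  therefore gives \<delta> rather than 2 \<delta>. The first term is bounded by nearness of
  \<open>S\<close> to \<open>S'\<close>, the second by duality from nearness of \<open>S'\<close> to
  \<open>S\<close>.\<close>

lemma norm_diff_closest_points_le:
  assumes S: "subspace S" "subspace S'" and n: "near \<delta> S S'" "near \<delta> S' S" and \<delta>: "0 \<le> \<delta>"
  shows "norm (closest_point S v - closest_point S' v) \<le> \<delta> * norm v"
proof -
  let ?P = "closest_point S" and ?Q = "closest_point S'"
  interpret P: linear ?P by (rule linear_closest_point[OF S(1)])
  interpret Q: linear ?Q by (rule linear_closest_point[OF S(2)])
  define a where "a = ?P v - ?Q (?P v)"
  define b where "b = ?Q (v - ?P v)"
  have "a \<bullet> b = 0" unfolding a_def b_def
    by (rule closest_point_subspace_orth[OF S(2) closest_point_in_subspace[OF S(2)]])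
  then have "(norm (a + - b))\<^sup>2 = (norm a)\<^sup>2 + (norm b)\<^sup>2"
    using norm_add_orth_sq[of a "- b"] by simp
  moreover have "a + - b = ?P v - ?Q v" by (simp add: a_def b_def Q.diff)
  moreover have "norm a \<le> \<delta> * norm (?P v)"
    using n(1) closest_point_in_subspace[OF S(1), of v] by (simp add: near_def a_def)
  moreover have "norm b \<le> \<delta> * norm (v - ?P v)"
  proof (cases "b = 0")
    case False
    have b: "b \<in> S'" by (simp add: b_def closest_point_in_subspace[OF S(2)])
    have "(norm b)\<^sup>2 = (v - ?P v) \<bullet> b"
      using closest_point_subspace_orth[OF S(2) b, of "v - ?P v"]
      by (simp add: b_def inner_diff_left power2_norm_eq_inner)
    also have "\<dots> = (v - ?P v) \<bullet> (b - ?P b)"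
      using closest_point_subspace_orth[OF S(1) closest_point_in_subspace[OF S(1), of b], of v]
      by (simp add: inner_diff_right)
    also have "\<dots> \<le> norm (v - ?P v) * norm (b - ?P b)" by (rule norm_cauchy_schwarz)
    also have "\<dots> \<le> norm (v - ?P v) * (\<delta> * norm b)"
      using n(2) b by (intro mult_left_mono) (auto simp: near_def)
    finally show ?thesis using False by (simp add: power2_eq_square mult.commute)
  qed (simp add: \<delta>)
  ultimately have "(norm (?P v - ?Q v))\<^sup>2 \<le> (\<delta> * norm (?P v))\<^sup>2 + (\<delta> * norm (v - ?P v))\<^sup>2"
    by (metis add_mono norm_ge_zero power_mono)
  also have "\<dots> = (\<delta> * norm v)\<^sup>2"
    using norm_closest_point_pythagoras[OF S(1), of v] by (simp add: power_mult_distrib distrib_left)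
  finally show ?thesis by (rule power2_le_imp_le) (simp add: \<delta>)
qed

lemma nearI:
  assumes "subspace S" "\<And>v. norm (closest_point S v - closest_point S' v) \<le> \<delta> * norm v"
  shows "near \<delta> S S'"
  unfolding near_def using assms closest_point_subspace_self by metis

lemma subspace_eq_if_near:
  assumes S: "subspace S" "subspace S'" and d: "dim S = dim S'"
    and n: "\<And>e. e > 0 \<Longrightarrow> near e S S'"
  shows "S = S'"
proof -
  have "v \<in> S'" if "v \<in> S" for v
  proof -
    have "norm (v - closest_point S' v) \<le> 0"
    proof (rule field_le_epsilon)
      fix e :: real assume e: "e > 0"
      \<comment> \<open>Adding 1 keeps the quotient meaningful when \<open>v\<close> is 0.\<close>
      have "norm (v - closest_point S' v) \<le> e / (norm v + 1) * norm v"
        using n[of "e / (norm v + 1)"] e that by (simp add: near_def add_nonneg_pos)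
      also have "\<dots> \<le> e" using e by (simp add: divide_le_eq add_nonneg_pos distrib_left)
      finally show "norm (v - closest_point S' v) \<le> 0 + e" by simp
    qed
    then show ?thesis using closest_point_in_subspace[OF S(2), of v] by simp
  qed
  then show ?thesis using subspace_dim_equal[OF S] d by auto
qed

subsection \<open>Linear images of Lebesgue measure\<close>

lemma distr_lborel_uminus: "distr lborel borel uminus = (lborel :: 'a::euclidean_space measure)"
proof -
  have "(\<lambda>x::'a. 0 + (\<Sum>j\<in>Basis. (- 1 * (x \<bullet> j)) *\<^sub>R j)) = uminus"
    by (auto simp: sum_negf euclidean_representation)
  then show ?thesis
    using lborel_affine_euclidean[of "\<lambda>_. - 1" "0::'a"] by (simp add: density_1 del: add_0_left)
qed

text \<open>Both sides are the double integral of \<open>(x, y) \<mapsto> indicator X x * indicator Y (x + y)\<close>,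
  evaluated in the two orders.\<close>
lemma translation_invariant_proportional:
  fixes \<mu> :: "'a::euclidean_space measure"
  assumes sf: "sigma_finite_measure \<mu>" and [measurable_cong, simp]: "sets \<mu> = sets borel"
    and inv: "\<And>a. distr \<mu> borel ((+) a) = \<mu>"
    and [measurable]: "X \<in> sets borel" "Y \<in> sets borel"
  shows "emeasure \<mu> X * emeasure lborel Y = emeasure \<mu> Y * emeasure lborel X"
proof -
  interpret M: sigma_finite_measure \<mu> by fact
  interpret P: pair_sigma_finite \<mu> "lborel :: 'a measure" ..
  have [simp]: "space \<mu> = UNIV" using sets_eq_imp_space_eq[of \<mu> borel] by simp
  have [measurable]: "X \<in> sets \<mu>" "Y \<in> sets \<mu>" by simp_all
  have trl: "(\<integral>\<^sup>+y. f (a + y) \<partial>lborel) = (\<integral>\<^sup>+y. f y \<partial>lborel)"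
    if [measurable]: "f \<in> borel_measurable borel" for f :: "'a \<Rightarrow> ennreal" and a
    by (subst (2) lborel_distr_plus[symmetric, of a]) (simp add: nn_integral_distr)
  have trm: "(\<integral>\<^sup>+y. f (a + y) \<partial>\<mu>) = (\<integral>\<^sup>+y. f y \<partial>\<mu>)"
    if [measurable]: "f \<in> borel_measurable borel" for f :: "'a \<Rightarrow> ennreal" and a
    by (subst (2) inv[symmetric, of a]) (simp add: nn_integral_distr)
  have refl: "(\<integral>\<^sup>+y. f (- y) \<partial>lborel) = (\<integral>\<^sup>+y. f y \<partial>lborel)"
    if [measurable]: "f \<in> borel_measurable borel" for f :: "'a \<Rightarrow> ennreal"
    using nn_integral_distr[of uminus lborel borel f] by (simp add: distr_lborel_uminus)
  have "emeasure \<mu> X * emeasure lborel Y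
      = (\<integral>\<^sup>+x. indicator X x * (\<integral>\<^sup>+y. indicator Y (x + y) \<partial>lborel) \<partial>\<mu>)"
    by (subst trl) (simp_all add: nn_integral_multc)
  also have "\<dots> = (\<integral>\<^sup>+x. (\<integral>\<^sup>+y. indicator X x * indicator Y (x + y) \<partial>lborel) \<partial>\<mu>)"
    by (simp add: nn_integral_cmult)
  also have "\<dots> = (\<integral>\<^sup>+y. (\<integral>\<^sup>+x. indicator X x * indicator Y (x + y) \<partial>\<mu>) \<partial>lborel)"
    by (rule P.Fubini'[symmetric]) measurable
  also have "\<dots> = (\<integral>\<^sup>+y. (\<integral>\<^sup>+x. indicator X (x - y) * indicator Y x \<partial>\<mu>) \<partial>lborel)"
  proof (rule nn_integral_cong)
    fix y :: 'a
    show "(\<integral>\<^sup>+x. indicator X x * indicator Y (x + y) \<partial>\<mu>)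
        = (\<integral>\<^sup>+x. indicator X (x - y) * indicator Y x \<partial>\<mu>)"
      using trm[of "\<lambda>z. indicator X (z - y) * indicator Y z" y] by (simp add: add.commute)
  qed
  also have "\<dots> = (\<integral>\<^sup>+x. (\<integral>\<^sup>+y. indicator X (x - y) * indicator Y x \<partial>lborel) \<partial>\<mu>)"
    by (rule P.Fubini') measurable
  also have "\<dots> = (\<integral>\<^sup>+x. (\<integral>\<^sup>+y. indicator X (x - y) \<partial>lborel) * indicator Y x \<partial>\<mu>)"
    by (simp add: nn_integral_multc)
  also have "\<dots> = (\<integral>\<^sup>+x. emeasure lborel X * indicator Y x \<partial>\<mu>)"
  proof (rule nn_integral_cong)
    fix x :: 'a
    have "(\<integral>\<^sup>+y. indicator X (x - y) \<partial>lborel) = (\<integral>\<^sup>+y. indicator X (x + y) \<partial>lborel)"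
      using refl[of "\<lambda>y. indicator X (x + y)"] by simp
    also have "\<dots> = emeasure lborel X" by (subst trl) simp_all
    finally show "(\<integral>\<^sup>+y. indicator X (x - y) \<partial>lborel) * indicator Y x
        = emeasure lborel X * indicator Y x" by simp
  qed
  also have "\<dots> = emeasure \<mu> Y * emeasure lborel X"
    by (subst nn_integral_cmult) (simp_all add: mult.commute)
  finally show ?thesis .
qed

text \<open>The absolute determinant of \<open>L\<close>, read off from a single test body. The ball
  is a convenient one because isometries preserve it.\<close>

definition volume_factor :: "('a::euclidean_space \<Rightarrow> 'a) \<Rightarrow> real" where
  "volume_factor L = measure lborel (L ` cball 0 1) / measure lborel (cball (0::'a) 1)"

lemma borel_measurable_linear:
  fixes f :: "'a::euclidean_space \<Rightarrow> 'b::real_normed_vector"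
  shows "linear f \<Longrightarrow> f \<in> borel_measurable borel"
  by (intro borel_measurable_continuous_onI linear_continuous_on) (simp add: linear_conv_bounded_linear)

lemma linear_bij_inv:
  fixes L :: "'a::euclidean_space \<Rightarrow> 'a"
  assumes "linear L" "bij L" shows "linear (inv L)"
  using assms by (meson bij_is_inj bij_is_surj inj_linear_imp_inv_linear)

lemma sets_borel_linear_image:
  fixes L :: "'a::euclidean_space \<Rightarrow> 'a"
  assumes L: "linear L" "bij L" and X: "X \<in> sets borel"
  shows "L ` X \<in> sets borel"
proof -
  have "inv L \<in> borel_measurable borel"
    by (rule borel_measurable_linear[OF linear_bij_inv[OF L]])
  from measurable_sets_borel[OF this X] show ?thesis using L by (simp add: bij_vimage_eq_inv_image bij_imp_bij_inv inv_inv_eq)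
qed

text \<open>The measure that assigns to X the volume of its image under \<open>L\<close> is
  translation invariant, hence proportional to Lebesgue measure; the ball fixes the
  constant.\<close>

lemma emeasure_lborel_linear_image:
  fixes L :: "'a::euclidean_space \<Rightarrow> 'a"
  assumes L: "linear L" "bij L"
  shows volume_factor_pos: "volume_factor L > 0"
    and "\<And>X. X \<in> sets borel \<Longrightarrow> emeasure lborel (L ` X) = ennreal (volume_factor L) * emeasure lborel X"
proof -
  let ?B = "cball (0::'a) 1"
  have c: "L \<in> borel_measurable borel" "inv L \<in> borel_measurable borel"
    by (rule borel_measurable_linear, rule L linear_bij_inv[OF L])+
  define \<mu> where "\<mu> = distr lborel borel (inv L)"
  have [simp]: "sets \<mu> = sets borel" by (simp add: \<mu>_def)
  have e: "emeasure \<mu> X = emeasure lborel (L ` X)" if "X \<in> sets borel" for X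
    using that c L unfolding \<mu>_def
    by (simp add: emeasure_distr bij_vimage_eq_inv_image bij_imp_bij_inv inv_inv_eq)
  have Linv: "L (inv L x) = x" "inv L (L x) = x" for x
    using L by (simp_all add: bij_is_inj bij_is_surj surj_f_inv_f)
  \<comment> \<open>Sigma-finiteness passes from an image measure back to the measure itself, and
    the image of \<open>\<mu>\<close> under \<open>L\<close> is Lebesgue measure.\<close>
  have "distr \<mu> borel L = lborel"
    unfolding \<mu>_def by (subst distr_distr) (use c in \<open>simp_all add: comp_def Linv distr_id2\<close>)
  then have sf: "sigma_finite_measure \<mu>"
    using c by (intro sigma_finite_measure_distr[of \<mu> borel L])
      (simp_all add: \<mu>_def sigma_finite_lborel)
  have inv: "distr \<mu> borel ((+) a) = \<mu>" for a
  proof -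
    have "distr \<mu> borel ((+) a) = distr (distr lborel borel ((+) (L a))) borel (inv L)"
      unfolding \<mu>_def using c
      by (subst distr_distr; (subst distr_distr)?)
         (auto intro!: distr_cong simp: comp_def linear_add[OF linear_bij_inv[OF L]] Linv)
    then show ?thesis by (simp add: lborel_distr_plus \<mu>_def)
  qed
  have prp: "emeasure lborel (L ` X) * emeasure lborel ?B = emeasure lborel (L ` ?B) * emeasure lborel X"
    if "X \<in> sets borel" for X
    using translation_invariant_proportional[OF sf _ inv that, of ?B] that
    by (simp add: e)
  define b where "b = measure lborel ?B"
  have b: "b > 0" "emeasure lborel ?B = ennreal b"
    using content_cball_pos[of 1 "0::'a"] emeasure_lborel_cball_finite[of "0::'a" 1]
    by (simp_all add: b_def emeasure_eq_ennreal_measure)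
  define a where "a = measure lborel (L ` ?B)"
  have "compact (L ` ?B)"
    by (intro compact_continuous_image linear_continuous_on) (use L in \<open>auto simp: linear_conv_bounded_linear\<close>)
  then have a: "a \<ge> 0" "emeasure lborel (L ` ?B) = ennreal a"
    using emeasure_bounded_finite[OF compact_imp_bounded, of "L ` ?B"] by (simp_all add: a_def emeasure_eq_ennreal_measure)
  show main: "emeasure lborel (L ` X) = ennreal (volume_factor L) * emeasure lborel X"
    if X: "X \<in> sets borel" for X
  proof -
    have "emeasure lborel (L ` X) = emeasure lborel (L ` X) * ennreal b / ennreal b"
      using b by (simp add: ennreal_mult_divide_eq)
    also have "\<dots> = ennreal a * emeasure lborel X / ennreal b"
      using prp[OF X] a b by simp
    also have "\<dots> = ennreal (a / b) * emeasure lborel X"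
      using a b by (simp add: divide_ennreal[symmetric] ennreal_times_divide mult.commute)
    finally show ?thesis by (simp add: volume_factor_def a_def b_def)
  qed
  \<comment> \<open>A zero factor would make the ball null, since the ball is the image under
    \<open>L\<close> of its preimage.\<close>
  have ne: "volume_factor L \<noteq> 0"
  proof
    assume "volume_factor L = 0"
    moreover have "L ` (inv L ` ?B) = ?B" using L by (simp add: bij_is_surj surj_f_inv_f image_image)
    moreover have "inv L ` ?B \<in> sets borel"
      using linear_bij_inv[OF L] L by (intro sets_borel_linear_image bij_imp_bij_inv) auto
    ultimately show False using main[of "inv L ` ?B"] b by simp
  qed
  then show "volume_factor L > 0"
    using a b by (simp add: volume_factor_def a_def[symmetric] b_def[symmetric] order_less_le)
qed

section \<open>Determinants of compositions, isometries, shears and stretches\<close>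

lemma volume_factor_eqI:
  fixes L :: "'a::euclidean_space \<Rightarrow> 'a"
  assumes "linear L" "bij L" "c \<ge> 0"
    and "emeasure lborel (L ` cball 0 1) = ennreal c * emeasure lborel (cball (0::'a) 1)"
  shows "volume_factor L = c"
  using assms(3,4) content_cball_pos[of 1 "0::'a"]
  unfolding volume_factor_def measure_def by (simp add: enn2real_mult)

lemma volume_factor_compose:
  fixes L M :: "'a::euclidean_space \<Rightarrow> 'a"
  assumes "linear L" "bij L" "linear M" "bij M"
  shows "volume_factor (L \<circ> M) = volume_factor L * volume_factor M"
proof (rule volume_factor_eqI)
  have "M ` cball 0 1 \<in> sets borel" using assms by (intro sets_borel_linear_image) auto
  then show "emeasure lborel ((L \<circ> M) ` cball 0 1)
      = ennreal (volume_factor L * volume_factor M) * emeasure lborel (cball (0::'a) 1)"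
    using assms
    by (simp only: image_comp[symmetric] emeasure_lborel_linear_image)
       (simp add: emeasure_lborel_linear_image ennreal_mult volume_factor_pos less_imp_le mult.assoc)
qed (use assms in \<open>auto intro!: linear_compose bij_comp simp: volume_factor_pos less_imp_le\<close>)

lemma isometry_bij:
  fixes Q :: "'a::euclidean_space \<Rightarrow> 'a"
  assumes "linear Q" "\<And>v. norm (Q v) = norm v"
  shows "bij Q"
  using assms by (metis orthogonal_transformation orthogonal_transformation_bij)

lemma volume_factor_isometry:
  fixes Q :: "'a::euclidean_space \<Rightarrow> 'a"
  assumes Q: "linear Q" "\<And>v. norm (Q v) = norm v"
  shows "volume_factor Q = 1"
proof (rule volume_factor_eqI[OF Q(1) isometry_bij[OF Q]])
  have "Q ` cball 0 1 = cball 0 1"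
    using Q image_orthogonal_transformation_cball[of Q 0 1] linear_0[OF Q(1)]
    by (simp add: orthogonal_transformation)
  then show "emeasure lborel (Q ` cball 0 1) = ennreal 1 * emeasure lborel (cball (0::'a) 1)" by simp
qed auto

text \<open>Reflection in the hyperplane \<open>f\<^sup>\<bottom>\<close> conjugates the shear into its inverse.\<close>
lemma volume_factor_shear:
  fixes f e :: "'a::euclidean_space"
  assumes f: "norm f = 1" and e: "e \<bullet> f = 0"
  shows "bij (\<lambda>v. v + (v \<bullet> f) *\<^sub>R e)" "volume_factor (\<lambda>v. v + (v \<bullet> f) *\<^sub>R e) = 1"
proof -
  define N where "N = (\<lambda>v. v + (v \<bullet> f) *\<^sub>R e)"
  define N' where "N' = (\<lambda>v. v - (v \<bullet> f) *\<^sub>R e)"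
  define Q where "Q = (\<lambda>v. v - (2 * (v \<bullet> f)) *\<^sub>R f)"
  have ff: "f \<bullet> f = 1" using f by (simp add: norm_eq_1)
  have lin: "linear N" "linear N'" "linear Q"
    unfolding N_def N'_def Q_def by (auto intro!: linearI simp: algebra_simps inner_add_left)
  have inv: "N (N' v) = v" "N' (N v) = v" for v
    by (simp_all add: N_def N'_def inner_add_left inner_diff_left e algebra_simps)
  then have bij: "bij N" "bij N'" by (auto intro!: o_bij[of N' N] o_bij[of N N'])
  have "(norm (Q v))\<^sup>2 = (norm v)\<^sup>2" for v
    unfolding power2_norm_eq_inner Q_def
    by (simp add: inner_diff_left inner_diff_right ff inner_commute algebra_simps)
  then have Qn: "norm (Q v) = norm v" for v by (simp add: power2_eq_iff_nonneg)
  note Q = isometry_bij[OF lin(3) Qn] volume_factor_isometry[OF lin(3) Qn]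
  have "Q \<circ> (N \<circ> Q) = N'"
    by (rule ext) (simp add: Q_def N_def N'_def inner_add_left inner_diff_left e ff algebra_simps)
  then have "volume_factor N' = volume_factor N"
    using Q lin bij volume_factor_compose[of Q "N \<circ> Q"] volume_factor_compose[of N Q]
    by (simp add: linear_compose bij_comp)
  moreover have "N \<circ> N' = id" by (auto simp: inv)
  then have "volume_factor N * volume_factor N' = 1"
    using volume_factor_compose[of N N'] lin bij volume_factor_isometry[of "id :: 'a \<Rightarrow> 'a"]
    by (simp add: linear_id)
  moreover have "volume_factor N > 0" using volume_factor_pos lin bij by blast
  ultimately have "volume_factor N = 1"
    by (metis less_eq_real_def power2_eq_1_iff power2_eq_square not_less neg_less_0_iff_less zero_less_one)
  then show "bij (\<lambda>v. v + (v \<bullet> f) *\<^sub>R e)" "volume_factor (\<lambda>v. v + (v \<bullet> f) *\<^sub>R e) = 1"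
    using bij by (simp_all add: N_def)
qed

text \<open>Unless the vectors coincide, the reflection in the hyperplane orthogonal to
  \<open>a - b\<close> exchanges them.\<close>

lemma exists_isometry_unit:
  fixes a b :: "'a::euclidean_space"
  assumes "norm a = 1" "norm b = 1"
  obtains Q :: "'a \<Rightarrow> 'a" where "linear Q" "\<And>v. norm (Q v) = norm v" "Q a = b"
proof (cases "a = b")
  case True
  then show ?thesis using that[of id] by (simp add: linear_id)
next
  case False
  define u where "u = a - b"
  define Q where "Q = (\<lambda>v. v - (2 * (v \<bullet> u) / (u \<bullet> u)) *\<^sub>R u)"
  have uu: "u \<bullet> u \<noteq> 0" using False by (simp add: u_def)
  have "linear Q"
    unfolding Q_def by (auto intro!: linearI simp: algebra_simps inner_add_left add_divide_distrib)
  moreover have "norm (Q v) = norm v" for v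
  proof -
    have "(norm (Q v))\<^sup>2 = (norm v)\<^sup>2"
      unfolding power2_norm_eq_inner Q_def using uu
      by (simp add: inner_diff_left inner_diff_right inner_commute field_simps)
    then show ?thesis by (simp add: power2_eq_iff_nonneg)
  qed
  moreover have "2 * (a \<bullet> u) = u \<bullet> u"
    using assms by (simp add: u_def inner_diff_left inner_diff_right inner_commute norm_eq_1)
  then have "Q a = b" using uu by (simp add: Q_def u_def)
  ultimately show ?thesis using that by blast
qed

text \<open>Along a vector of the standard basis this is a diagonal map, for which the scaling of
  Lebesgue measure is known. An isometry conjugates the general direction to that case.\<close>

lemma volume_factor_stretch:
  fixes f :: "'a::euclidean_space"
  assumes f: "norm f = 1" and \<alpha>: "\<alpha> \<noteq> 0"
  shows "bij (\<lambda>v. v + ((\<alpha> - 1) * (v \<bullet> f)) *\<^sub>R f)"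
    "volume_factor (\<lambda>v. v + ((\<alpha> - 1) * (v \<bullet> f)) *\<^sub>R f) = \<bar>\<alpha>\<bar>"
proof -
  define N where "N = (\<lambda>f v. v + ((\<alpha> - 1) * (v \<bullet> f)) *\<^sub>R (f::'a))"
  have lin: "linear (N g)" for g
    unfolding N_def by (auto intro!: linearI simp: algebra_simps inner_add_left)
  have bij: "bij (N g)" if "norm g = 1" for g
  proof -
    have "g \<bullet> g = 1" using that by (simp add: norm_eq_1)
    define \<beta> where "\<beta> = inverse \<alpha>"
    have "\<beta> - 1 + (\<alpha> - 1) * \<beta> = 0" "\<alpha> - 1 + (\<beta> - 1) * \<alpha> = 0"
      using \<alpha> by (simp_all add: \<beta>_def algebra_simps)
    moreover have "N g (v + ((\<beta> - 1) * (v \<bullet> g)) *\<^sub>R g) = v + ((\<beta> - 1 + (\<alpha> - 1) * \<beta>) * (v \<bullet> g)) *\<^sub>R g"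
      and "N g v + ((\<beta> - 1) * (N g v \<bullet> g)) *\<^sub>R g = v + ((\<alpha> - 1 + (\<beta> - 1) * \<alpha>) * (v \<bullet> g)) *\<^sub>R g" for v
      using \<open>g \<bullet> g = 1\<close> by (simp_all add: N_def inner_add_left algebra_simps)
    ultimately show ?thesis
      by (intro o_bij[of "\<lambda>v. v + ((\<beta> - 1) * (v \<bullet> g)) *\<^sub>R g"] ext) simp_all
  qed
  obtain b :: 'a where b: "b \<in> Basis" using nonempty_Basis by blast
  have nb: "norm b = 1" using b by simp
  define c where "c = (\<lambda>j. if j = b then \<alpha> else 1)"
  have Nb: "N b v = 0 + (\<Sum>j\<in>Basis. (c j * (v \<bullet> j)) *\<^sub>R j)" for v
  proof -
    have "(\<Sum>j\<in>Basis. (c j * (v \<bullet> j)) *\<^sub>R j)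
        = (\<Sum>j\<in>Basis. (v \<bullet> j) *\<^sub>R j + (if j = b then ((\<alpha> - 1) * (v \<bullet> b)) *\<^sub>R b else 0))"
      by (rule sum.cong) (auto simp: c_def algebra_simps)
    then show ?thesis using b by (simp add: N_def sum.distrib euclidean_representation)
  qed
  have dens: "lborel = density (distr lborel borel (N b)) (\<lambda>_. \<Prod>j\<in>Basis. \<bar>c j\<bar>)"
    using lborel_affine_euclidean[of c 0] \<alpha> by (simp add: c_def Nb[abs_def, simplified])
  have pr: "(\<Prod>j\<in>(Basis::'a set). \<bar>c j\<bar>) = \<bar>\<alpha>\<bar>"
    using b by (simp add: c_def prod.remove[of _ b])
  have Nm: "N b \<in> borel_measurable borel"
    by (rule borel_measurable_linear[OF lin])
  have S: "N b ` cball 0 1 \<in> sets borel" by (intro sets_borel_linear_image lin bij nb) auto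
  have "emeasure lborel (N b ` cball 0 1)
      = ennreal \<bar>\<alpha>\<bar> * emeasure (distr lborel borel (N b)) (N b ` cball 0 1)"
    by (subst dens) (use S pr in \<open>simp add: emeasure_density_const\<close>)
  also have "\<dots> = ennreal \<bar>\<alpha>\<bar> * emeasure lborel (cball (0::'a) 1)"
    using S Nm bij[OF nb] by (simp add: emeasure_distr inj_vimage_image_eq bij_is_inj)
  finally have vb: "volume_factor (N b) = \<bar>\<alpha>\<bar>"
    by (intro volume_factor_eqI lin bij nb) auto
  obtain Q where Q: "linear Q" "\<And>v. norm (Q v) = norm v" "Q b = f"
    using exists_isometry_unit[OF nb f] by metis
  have Qi: "Q v \<bullet> Q w = v \<bullet> w" for v w
    using Q by (meson orthogonal_transformation orthogonal_transformation_def)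
  have "N f \<circ> Q = Q \<circ> N b"
    by (rule ext) (simp add: N_def Q(3)[symmetric] Qi linear_add[OF Q(1)] linear_scale[OF Q(1)])
  then have "volume_factor (N f) = \<bar>\<alpha>\<bar>"
    using volume_factor_compose[of "N f" Q] volume_factor_compose[of Q "N b"] vb
      lin bij[OF f] bij[OF nb] isometry_bij[OF Q(1,2)] volume_factor_isometry[OF Q(1,2)] Q(1) by simp
  then show "bij (\<lambda>v. v + ((\<alpha> - 1) * (v \<bullet> f)) *\<^sub>R f)"
    "volume_factor (\<lambda>v. v + ((\<alpha> - 1) * (v \<bullet> f)) *\<^sub>R f) = \<bar>\<alpha>\<bar>"
    using bij[OF f] by (simp_all add: N_def)
qed


subsection \<open>Lebesgue measure on subspaces and determinants of restrictions\<close>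

definition orthonormal :: "'a::euclidean_space set \<Rightarrow> bool" where
  "orthonormal B \<longleftrightarrow> finite B \<and> (\<forall>b\<in>B. \<forall>c\<in>B. b \<bullet> c = (if b = c then 1 else 0))"

lemma orthonormal_eq:
  "orthonormal B \<longleftrightarrow> pairwise orthogonal B \<and> (\<forall>b\<in>B. norm b = 1)"
  for B :: "'a::euclidean_space set"
proof
  assume *: "pairwise orthogonal B \<and> (\<forall>b\<in>B. norm b = 1)"
  then have "finite B" by (metis pairwise_orthogonal_imp_finite)
  then show "orthonormal B" using *
    by (auto simp: orthonormal_def pairwise_def orthogonal_def norm_eq_1)
qed (auto simp: orthonormal_def pairwise_def orthogonal_def norm_eq_1)

lemma orthonormal_basis_of:
  fixes S :: "'a::euclidean_space set"
  assumes "subspace S"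
  shows "orthonormal (orthonormal_basis_of S)" "span (orthonormal_basis_of S) = S"
proof -
  have "\<exists>B. B \<subseteq> S \<and> pairwise orthogonal B \<and> (\<forall>b\<in>B. norm b = 1) \<and> span B = S"
    using orthonormal_basis_subspace[OF assms] by metis
  from someI_ex[OF this] show "orthonormal (orthonormal_basis_of S)" "span (orthonormal_basis_of S) = S"
    unfolding orthonormal_basis_of_def[symmetric] orthonormal_eq by auto
qed

lemma orthonormal_independent: "orthonormal B \<Longrightarrow> independent B"
  unfolding orthonormal_eq using pairwise_orthogonal_independent[of B] by fastforce

lemma orthonormal_inner_sum:
  assumes "orthonormal B" "b \<in> B"
  shows "(\<Sum>c\<in>B. f c *\<^sub>R c) \<bullet> b = f b"
proof -
  have "(\<Sum>c\<in>B. f c *\<^sub>R c) \<bullet> b = (\<Sum>c\<in>B. if c = b then f c else 0)"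
    unfolding inner_sum_left using assms by (intro sum.cong) (auto simp: orthonormal_def)
  then show ?thesis using assms by (simp add: orthonormal_def)
qed

lemma orthonormal_Un:
  fixes B C :: "'a::euclidean_space set"
  assumes "orthonormal B" "orthonormal C" "span C = (span B)\<^sup>\<bottom>"
  shows "orthonormal (B \<union> C)" "B \<inter> C = {}" "span (B \<union> C) = UNIV"
proof -
  have o: "b \<bullet> c = 0" "c \<bullet> b = 0" if "b \<in> B" "c \<in> C" for b c
  proof -
    have "c \<in> (span B)\<^sup>\<bottom>" "b \<in> span B" using that assms(3) span_base by blast+
    then show "b \<bullet> c = 0" "c \<bullet> b = 0" by (auto simp: mem_orthogonal_comp inner_commute)
  qed
  show i: "B \<inter> C = {}" using o assms(1) unfolding orthonormal_def by fastforce
  then show "orthonormal (B \<union> C)" using assms(1,2) o unfolding orthonormal_def by auto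
  have "v \<in> span (B \<union> C)" for v
  proof -
    have "closest_point (span B) v \<in> span B" by (simp add: closest_point_in_subspace)
    moreover have "v - closest_point (span B) v \<in> span C"
      using diff_closest_point_orth[of "span B" v] assms(3) by simp
    ultimately have "closest_point (span B) v + (v - closest_point (span B) v) \<in> span (B \<union> C)"
      by (intro span_add) (use span_mono[of B "B \<union> C"] span_mono[of C "B \<union> C"] in blast)+
    then show ?thesis by simp
  qed
  then show "span (B \<union> C) = UNIV" by auto
qed

interpretation lborel_prod: product_sigma_finite "\<lambda>_. lborel :: real measure" ..

text \<open>For the standard basis, indexed by \<open>p\<close>, this is checked on boxes. The
  isometry \<open>Q\<close> carrying each \<open>p d\<close> to \<open>d\<close> preserves Lebesgue
  measure and transports the formula to \<open>D\<close>.\<close>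

lemma lborel_orthonormal_coordinates:
  fixes D :: "'a::euclidean_space set"
  assumes D: "orthonormal D" "span D = UNIV"
  shows "lborel = distr (\<Pi>\<^sub>M d\<in>D. lborel) borel (\<lambda>f. \<Sum>d\<in>D. f d *\<^sub>R d)"
proof -
  have fD: "finite D" using D by (simp add: orthonormal_def)
  have "card D = DIM('a)"
    using orthonormal_independent[OF D(1)] D(2) by (metis dim_UNIV dim_span dim_eq_card_independent)
  then obtain p where p: "bij_betw p D (Basis :: 'a set)"
    using finite_same_card_bij[OF fD finite_Basis] by auto
  have pB: "p d \<in> Basis" if "d \<in> D" for d using p that bij_betwE by blast
  have pi: "p c \<bullet> p d = (if c = d then 1 else 0)" if "c \<in> D" "d \<in> D" for c d
    using p that by (auto simp: inner_Basis pB bij_betw_def inj_on_def)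
  define Q where "Q = (\<lambda>v. \<Sum>d\<in>D. (v \<bullet> p d) *\<^sub>R d)"
  have linQ: "linear Q" unfolding Q_def
    by (auto intro!: linearI simp: inner_add_left algebra_simps sum.distrib scaleR_sum_right)
  have nQ: "norm (Q v) = norm v" for v
  proof -
    have "(norm (Q v))\<^sup>2 = (\<Sum>d\<in>D. (v \<bullet> p d) * (Q v \<bullet> d))"
      unfolding power2_norm_eq_inner by (subst (2) Q_def) (simp add: inner_sum_right inner_commute)
    also have "\<dots> = (\<Sum>d\<in>D. (v \<bullet> p d)\<^sup>2)"
      using D by (simp add: Q_def orthonormal_inner_sum power2_eq_square)
    also have "\<dots> = (\<Sum>b\<in>Basis. (v \<bullet> b)\<^sup>2)" by (rule sum.reindex_bij_betw[OF p])
    also have "\<dots> = (norm v)\<^sup>2"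
      unfolding power2_norm_eq_inner by (subst (2) euclidean_inner) (simp add: power2_eq_square)
    finally show ?thesis by (simp add: power2_eq_iff_nonneg)
  qed
  have bQ: "bij Q" by (rule isometry_bij[OF linQ nQ])
  have Qm: "Q \<in> borel_measurable borel"
    by (rule borel_measurable_linear[OF linQ])
  have [measurable]: "(\<lambda>f. \<Sum>d\<in>D. f d *\<^sub>R g d) \<in> borel_measurable (\<Pi>\<^sub>M d\<in>D. lborel)" for g :: "'a \<Rightarrow> 'a"
    by measurable
  have "lborel = distr (\<Pi>\<^sub>M d\<in>D. lborel) borel (\<lambda>f. \<Sum>d\<in>D. f d *\<^sub>R p d)"
  proof (rule lborel_eqI)
    fix l u :: 'a assume lu: "\<And>b. b \<in> Basis \<Longrightarrow> l \<bullet> b \<le> u \<bullet> b"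
    have mem: "(\<Sum>d\<in>D. f d *\<^sub>R p d) \<in> box l u \<longleftrightarrow> (\<forall>d\<in>D. l \<bullet> p d < f d \<and> f d < u \<bullet> p d)" for f
    proof -
      have "(\<Sum>d\<in>D. f d *\<^sub>R p d) \<bullet> p c = f c" if "c \<in> D" for c
      proof -
        have "(\<Sum>d\<in>D. f d *\<^sub>R p d) \<bullet> p c = (\<Sum>d\<in>D. if d = c then f d else 0)"
          using that by (auto simp: inner_sum_left pi intro!: sum.cong)
        then show ?thesis using fD that by simp
      qed
      moreover have "(\<forall>b\<in>Basis. R b) \<longleftrightarrow> (\<forall>d\<in>D. R (p d))" for R
        using p pB by (metis bij_betw_imp_surj_on imageE)
      ultimately show ?thesis by (simp add: mem_box)
    qed
    have "emeasure (distr (\<Pi>\<^sub>M d\<in>D. lborel) borel (\<lambda>f. \<Sum>d\<in>D. f d *\<^sub>R p d)) (box l u)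
        = emeasure (\<Pi>\<^sub>M d\<in>D. lborel) (\<Pi>\<^sub>E d\<in>D. {l \<bullet> p d <..< u \<bullet> p d})"
      by (subst emeasure_distr)
         (auto simp: mem space_PiM PiE_iff intro!: arg_cong[where f="emeasure _"])
    also have "\<dots> = (\<Prod>d\<in>D. ennreal ((u - l) \<bullet> p d))"
      using lu pB by (subst lborel_prod.emeasure_PiM[OF fD]) (simp_all add: inner_diff_left)
    also have "\<dots> = (\<Prod>b\<in>Basis. ennreal ((u - l) \<bullet> b))" by (rule prod.reindex_bij_betw[OF p])
    also have "\<dots> = ennreal (\<Prod>b\<in>Basis. (u - l) \<bullet> b)"
      using lu by (intro prod_ennreal) (simp add: inner_diff_left)
    finally show "emeasure (distr (\<Pi>\<^sub>M d\<in>D. lborel) borel (\<lambda>f. \<Sum>d\<in>D. f d *\<^sub>R p d)) (box l u)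
        = ennreal (\<Prod>b\<in>Basis. (u - l) \<bullet> b)" .
  qed simp
  then have "distr lborel borel Q
      = distr (distr (\<Pi>\<^sub>M d\<in>D. lborel) borel (\<lambda>f. \<Sum>d\<in>D. f d *\<^sub>R p d)) borel Q"
    by (rule arg_cong)
  also have "\<dots> = distr (\<Pi>\<^sub>M d\<in>D. lborel) borel (Q \<circ> (\<lambda>f. \<Sum>d\<in>D. f d *\<^sub>R p d))"
    by (intro distr_distr) (simp_all add: Qm)
  also have "Q \<circ> (\<lambda>f. \<Sum>d\<in>D. f d *\<^sub>R p d) = (\<lambda>f. \<Sum>d\<in>D. f d *\<^sub>R d)"
  proof (rule ext)
    fix f :: "'a \<Rightarrow> real"
    have "Q (p d) = d" if "d \<in> D" for d
    proof -
      have "Q (p d) = (\<Sum>c\<in>D. if c = d then c else 0)"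
        unfolding Q_def using that by (intro sum.cong) (auto simp: pi)
      then show ?thesis using that fD by simp
    qed
    then show "(Q \<circ> (\<lambda>f. \<Sum>d\<in>D. f d *\<^sub>R p d)) f = (\<Sum>d\<in>D. f d *\<^sub>R d)"
      by (simp add: linear_sum[OF linQ] linear_scale[OF linQ])
  qed
  also have "distr lborel borel Q = lborel"
  proof (rule measure_eqI)
    fix X assume "X \<in> sets (distr lborel borel Q)"
    then have X: "X \<in> sets borel" by simp
    then have v: "Q -` X \<in> sets borel" using Qm by (rule measurable_sets_borel[rotated])
    have "emeasure (distr lborel borel Q) X = emeasure lborel (Q -` X)"
      using X Qm by (simp add: emeasure_distr)
    also have "\<dots> = emeasure lborel (Q ` (Q -` X))"
      using emeasure_lborel_linear_image(2)[OF linQ bQ v] volume_factor_isometry[OF linQ nQ] by simp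
    also have "Q ` (Q -` X) = X" using bQ by (simp add: bij_is_surj surj_image_vimage_eq)
    finally show "emeasure (distr lborel borel Q) X = emeasure lborel X" .
  qed simp
  finally show ?thesis .
qed

text \<open>Thickening by a unit cube of the orthogonal complement turns Lebesgue measure on a subspace
  into Lebesgue measure on the whole space.\<close>
definition slab :: "'a::euclidean_space set \<Rightarrow> 'a set \<Rightarrow> 'a set \<Rightarrow> 'a set" where
  "slab S C X = {v. closest_point S v \<in> X \<and> (\<forall>c\<in>C. 0 \<le> v \<bullet> c \<and> v \<bullet> c \<le> 1)}"

lemma slab_borel:
  assumes "subspace S" "finite C" "X \<in> sets borel"
  shows "slab S C X \<in> sets borel"
proof -
  have "closest_point S \<in> borel_measurable borel"
    by (rule borel_measurable_linear[OF linear_closest_point[OF assms(1)]])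
  from measurable_sets_borel[OF this assms(3)]
  have "closest_point S -` X \<inter> (\<Inter>c\<in>C. {v. 0 \<le> v \<bullet> c} \<inter> {v. v \<bullet> c \<le> 1}) \<in> sets borel"
    using assms(2)
    by (cases "C = {}") (auto intro!: sets.Int sets.finite_INT borel_closed closed_Collect_le continuous_intros)
  also have "closest_point S -` X \<inter> (\<Inter>c\<in>C. {v. 0 \<le> v \<bullet> c} \<inter> {v. v \<bullet> c \<le> 1}) = slab S C X"
    by (auto simp: slab_def)
  finally show ?thesis .
qed

text \<open>In coordinates from an orthonormal basis of \<open>S\<close> together with
  \<open>C\<close> the slab is a product whose second factor is a unit cube, of measure 1. The
  right-hand side lives in the whole space, where \<open>emeasure_lborel_linear_image\<close>
  applies.\<close>

lemma emeasure_lborel_subspace: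
  fixes S :: "'a::euclidean_space set"
  assumes S: "subspace S" and C: "orthonormal C" "span C = S\<^sup>\<bottom>" and X: "X \<in> sets borel"
  shows "emeasure (lborel_subspace S) X = emeasure lborel (slab S C X)"
proof -
  define B where "B = orthonormal_basis_of S"
  have B: "orthonormal B" "span B = S" using orthonormal_basis_of[OF S] by (simp_all add: B_def)
  have D: "orthonormal (B \<union> C)" "B \<inter> C = {}" "span (B \<union> C) = UNIV"
    using orthonormal_Un[OF B(1) C(1)] B(2) C(2) by auto
  have fin: "finite B" "finite C" using B C by (auto simp: orthonormal_def)
  let ?s = "\<lambda>D f. \<Sum>d\<in>D. f d *\<^sub>R (d::'a)"
  let ?P = "\<lambda>D. \<Pi>\<^sub>M d\<in>(D::'a set). (lborel :: real measure)"
  have sm: "?s D \<in> borel_measurable (?P D)" for D by measurable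
  have Y: "slab S C X \<in> sets borel" by (rule slab_borel[OF S fin(2) X])
  interpret BC: pair_sigma_finite "?P B" "?P C"
    using lborel_prod.sigma_finite[OF fin(1)] lborel_prod.sigma_finite[OF fin(2)]
    by (rule pair_sigma_finite.intro)
  have mem: "?s (B \<union> C) (merge B C (f, g)) \<in> slab S C X \<longleftrightarrow> ?s B f \<in> X \<and> (\<forall>c\<in>C. 0 \<le> g c \<and> g c \<le> 1)"
    for f g
  proof -
    have e: "?s (B \<union> C) (merge B C (f, g)) = ?s B f + ?s C g"
      using fin D(2) by (simp add: sum.union_disjoint merge_def)
        (auto intro!: arg_cong2[where f="(+)"] sum.cong)
    have sB: "?s B f \<in> S" unfolding B(2)[symmetric] by (intro span_sum span_scale span_base)
    have sC: "?s C g \<in> S\<^sup>\<bottom>" unfolding C(2)[symmetric] by (intro span_sum span_scale span_base)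
    have "closest_point S (?s B f + ?s C g) = ?s B f"
      by (rule closest_point_subspace_eqI[OF S sB]) (use sC in \<open>simp add: mem_orthogonal_comp\<close>)
    moreover have "(?s B f + ?s C g) \<bullet> c = g c" if "c \<in> C" for c
    proof -
      have "c \<in> S\<^sup>\<bottom>" using that C(2) span_base by blast
      then have "?s B f \<bullet> c = 0" using sB by (rule orthogonal_compD)
      then show ?thesis using orthonormal_inner_sum[OF C(1) that] by (simp add: inner_add_left)
    qed
    ultimately show ?thesis unfolding e slab_def by simp
  qed
  have "emeasure lborel (slab S C X) = emeasure (distr (?P (B \<union> C)) borel (?s (B \<union> C))) (slab S C X)"
    using lborel_orthonormal_coordinates[OF D(1,3)] by simp
  also have "\<dots> = emeasure (?P (B \<union> C)) (?s (B \<union> C) -` slab S C X \<inter> space (?P (B \<union> C)))"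
    by (rule emeasure_distr[OF sm Y])
  also have "\<dots> = emeasure (distr (?P B \<Otimes>\<^sub>M ?P C) (?P (B \<union> C)) (merge B C))
      (?s (B \<union> C) -` slab S C X \<inter> space (?P (B \<union> C)))"
    by (simp add: lborel_prod.distr_merge[OF D(2) fin])
  also have "\<dots> = emeasure (?P B \<Otimes>\<^sub>M ?P C)
      (merge B C -` (?s (B \<union> C) -` slab S C X \<inter> space (?P (B \<union> C))) \<inter> space (?P B \<Otimes>\<^sub>M ?P C))"
    by (intro emeasure_distr measurable_merge measurable_sets[OF sm Y])
  also have "merge B C -` (?s (B \<union> C) -` slab S C X \<inter> space (?P (B \<union> C))) \<inter> space (?P B \<Otimes>\<^sub>M ?P C)
      = (?s B -` X \<inter> space (?P B)) \<times> (\<Pi>\<^sub>E c\<in>C. {0..1})"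
  proof -
    have "merge B C (f, g) \<in> space (?P (B \<union> C))" if "f \<in> space (?P B)" "g \<in> space (?P C)" for f g
      using that by (auto simp: space_PiM merge_def PiE_iff extensional_def)
    then show ?thesis
      by (auto simp: space_pair_measure mem space_PiM PiE_iff)
  qed
  also have "emeasure (?P B \<Otimes>\<^sub>M ?P C) \<dots>
      = emeasure (?P B) (?s B -` X \<inter> space (?P B)) * emeasure (?P C) (\<Pi>\<^sub>E c\<in>C. {0..1})"
    by (rule BC.M2.emeasure_pair_measure_Times)
       (auto intro!: measurable_sets[OF sm X] sets_PiM_I_finite fin)
  also have "emeasure (?P C) (\<Pi>\<^sub>E c\<in>C. {0..1}) = 1"
    by (subst lborel_prod.emeasure_PiM[OF fin(2)]) simp_all
  also have "emeasure (?P B) (?s B -` X \<inter> space (?P B)) = emeasure (lborel_subspace S) X"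
    unfolding lborel_subspace_def B_def[symmetric] by (rule emeasure_distr[symmetric, OF sm X])
  finally show ?thesis by simp
qed

text \<open>A test set of positive finite measure is what makes the constant in the definition of
  \<open>abs_det_on\<close> unique.\<close>

lemma lborel_subspace_unit:
  fixes S :: "'a::euclidean_space set"
  assumes S: "subspace S"
  obtains X where "X \<in> sets borel" "X \<subseteq> S" "emeasure (lborel_subspace S) X = 1"
proof -
  define B where "B = orthonormal_basis_of S"
  have B: "orthonormal B" "span B = S" using orthonormal_basis_of[OF S] by (simp_all add: B_def)
  have fin: "finite B" using B by (auto simp: orthonormal_def)
  define X where "X = S \<inter> (\<Inter>b\<in>B. {v. 0 \<le> v \<bullet> b} \<inter> {v. v \<bullet> b \<le> 1})"
  let ?s = "\<lambda>f. \<Sum>d\<in>B. f d *\<^sub>R (d::'a)"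
  let ?P = "\<Pi>\<^sub>M d\<in>B. (lborel :: real measure)"
  have "closed X" unfolding X_def
    by (auto intro!: closed_Int closed_INT closed_Collect_le continuous_intros closed_subspace[OF S])
  then have X: "X \<in> sets borel" by (rule borel_closed)
  have mem: "?s f \<in> X \<longleftrightarrow> (\<forall>b\<in>B. f b \<in> {0..1})" for f
  proof -
    have "?s f \<in> S" unfolding B(2)[symmetric] by (intro span_sum span_scale span_base)
    then show ?thesis by (simp add: X_def orthonormal_inner_sum[OF B(1)])
  qed
  have "emeasure (lborel_subspace S) X = emeasure ?P (?s -` X \<inter> space ?P)"
    unfolding lborel_subspace_def B_def[symmetric] by (intro emeasure_distr X) measurable
  also have "?s -` X \<inter> space ?P = (\<Pi>\<^sub>E b\<in>B. {0..1})"
    by (auto simp: mem space_PiM PiE_iff)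
  also have "emeasure ?P \<dots> = 1" by (subst lborel_prod.emeasure_PiM[OF fin]) simp_all
  finally show ?thesis using that X by (auto simp: X_def)
qed

section \<open>Determinants of restrictions via extensions to the whole space\<close>

text \<open>A linear extension of \<open>A\<close> from \<open>S\<close> to the whole space which does not change volumes
  transversally to \<open>S\<close>.\<close>
definition isometric_extension :: "'a::euclidean_space set \<Rightarrow> ('a \<Rightarrow> 'a) \<Rightarrow> ('a \<Rightarrow> 'a) \<Rightarrow> bool" where
  "isometric_extension S A L \<longleftrightarrow> linear L \<and> bij L \<and> (\<forall>v\<in>S. L v = A v) \<and>
     (\<forall>v\<in>S\<^sup>\<bottom>. norm (L v) = norm v \<and> (\<forall>u\<in>S. L v \<bullet> A u = 0))"

lemma isometric_extension_image:
  assumes S: "subspace S" and L: "isometric_extension S A L"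
  shows "L ` (S\<^sup>\<bottom>) = (A ` S)\<^sup>\<bottom>" "subspace (A ` S)"
proof -
  have lL: "linear L" "bij L" "\<And>v. v \<in> S \<Longrightarrow> L v = A v" using L by (auto simp: isometric_extension_def)
  have AS: "A ` S = L ` S" using lL by simp
  then show sAS: "subspace (A ` S)" using linear_subspace_image[OF lL(1) S] by simp
  have inj: "inj_on L (span X)" for X using lL(2) by (metis bij_is_inj inj_on_subset subset_UNIV)
  have "L ` (S\<^sup>\<bottom>) \<subseteq> (A ` S)\<^sup>\<bottom>"
    using L by (auto simp: isometric_extension_def mem_orthogonal_comp[of _ "A ` S"])
  moreover have "dim (L ` (S\<^sup>\<bottom>)) = dim ((A ` S)\<^sup>\<bottom>)"
    using dim_image_eq[OF lL(1) inj, of "S\<^sup>\<bottom>"] dim_image_eq[OF lL(1) inj, of S]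
      dim_orthogonal_comp[OF S] dim_orthogonal_comp[OF sAS] AS by simp
  ultimately show "L ` (S\<^sup>\<bottom>) = (A ` S)\<^sup>\<bottom>"
    by (intro subspace_dim_equal linear_subspace_image lL subspace_orthogonal_comp) auto
qed

text \<open>The slab over \<open>X\<close> built with \<open>C\<close> is carried by
  \<open>L\<close> exactly onto the slab over the image of \<open>X\<close> built with the image of
  \<open>C\<close>, again an orthonormal basis of the complement. Both subspace volumes are thus
  ambient volumes related by \<open>L\<close>.\<close>

lemma abs_det_on_eq:
  fixes S :: "'a::euclidean_space set"
  assumes S: "subspace S" and L: "isometric_extension S A L"
  shows "abs_det_on S A = volume_factor L"
proof -
  have lL: "linear L" "bij L" "\<And>v. v \<in> S \<Longrightarrow> L v = A v" using L by (auto simp: isometric_extension_def)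
  note sAS = isometric_extension_image(2)[OF S L] and im = isometric_extension_image(1)[OF S L]
  obtain C where C: "orthonormal C" "span C = S\<^sup>\<bottom>"
    using orthonormal_basis_of[OF subspace_orthogonal_comp] by metis
  have Linner: "L u \<bullet> L v = u \<bullet> v" if "u \<in> S\<^sup>\<bottom>" "v \<in> S\<^sup>\<bottom>" for u v
  proof -
    have "norm (L (u + v)) = norm (u + v)" "norm (L u) = norm u" "norm (L v) = norm v"
      using that L subspace_add[OF subspace_orthogonal_comp] unfolding isometric_extension_def by blast+
    then show ?thesis by (simp add: dot_norm linear_add[OF lL(1)])
  qed
  have CS: "c \<in> S\<^sup>\<bottom>" if "c \<in> C" for c using that C(2) span_base by blast
  have injL: "inj L" using lL bij_is_inj by blast
  have LC: "orthonormal (L ` C)" "span (L ` C) = (A ` S)\<^sup>\<bottom>"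
    using C CS Linner im by (auto simp: orthonormal_def inj_eq[OF injL] linear_span_image[OF lL(1)])
  have sc: "emeasure (lborel_subspace (A ` S)) (A ` X) = ennreal (volume_factor L) * emeasure (lborel_subspace S) X"
    if X: "X \<in> sets borel" "X \<subseteq> S" for X
  proof -
    have AX: "A ` X = L ` X" using lL X by force
    have LX: "L ` X \<in> sets borel" by (rule sets_borel_linear_image[OF lL(1,2) X(1)])
    have cp: "closest_point (A ` S) (L v) = L (closest_point S v)" for v
    proof (rule closest_point_subspace_eqI[OF sAS])
      show "L (closest_point S v) \<in> A ` S"
        using lL closest_point_in_subspace[OF S] by auto
      fix s assume "s \<in> A ` S"
      then show "(L v - L (closest_point S v)) \<bullet> s = 0"
        using L diff_closest_point_orth[OF S, of v]
        by (auto simp: isometric_extension_def linear_diff[OF lL(1), symmetric])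
    qed
    \<comment> \<open>The transversal coordinates that define the slab are preserved: the component
      of \<open>v\<close> in \<open>S\<close> contributes nothing on either side, and on the
      complement \<open>L\<close> preserves inner products.\<close>
    have ic: "L v \<bullet> L c = v \<bullet> c" if "c \<in> C" for v c
    proof -
      let ?p = "closest_point S v"
      have p: "?p \<in> S" by (rule closest_point_in_subspace[OF S])
      have "L ?p \<bullet> L c = 0" "?p \<bullet> c = 0"
        using L p CS[OF that] lL(3)[OF p] unfolding isometric_extension_def
        by (metis inner_commute, metis orthogonal_compD(2))
      then show ?thesis
        using Linner[OF diff_closest_point_orth[OF S] CS[OF that], of v]
        by (simp add: linear_diff[OF lL(1)] inner_diff_left)
    qed
    have "slab (A ` S) (L ` C) (L ` X) = L ` slab S C X"
    proof (intro set_eqI)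
      fix w
      obtain v where w: "w = L v" using lL(2) by (metis bij_pointE)
      show "w \<in> slab (A ` S) (L ` C) (L ` X) \<longleftrightarrow> w \<in> L ` slab S C X"
        unfolding w by (auto simp: slab_def cp ic inj_image_mem_iff[OF injL])
    qed
    then show ?thesis
      unfolding AX emeasure_lborel_subspace[OF S C X(1)] emeasure_lborel_subspace[OF sAS LC LX]
      by (simp add: emeasure_lborel_linear_image[OF lL(1,2)] slab_borel S X C(1)[unfolded orthonormal_def])
  qed
  show ?thesis unfolding abs_det_on_def
  proof (rule the_equality)
    show "0 \<le> volume_factor L \<and> (\<forall>B\<in>sets borel. B \<subseteq> S \<longrightarrow>
       emeasure (lborel_subspace (A ` S)) (A ` B) = ennreal (volume_factor L) * emeasure (lborel_subspace S) B)"
      using sc volume_factor_pos[OF lL(1,2)] by (simp add: less_imp_le)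
  next
    fix c assume c: "0 \<le> c \<and> (\<forall>B\<in>sets borel. B \<subseteq> S \<longrightarrow>
       emeasure (lborel_subspace (A ` S)) (A ` B) = ennreal c * emeasure (lborel_subspace S) B)"
    obtain X where "X \<in> sets borel" "X \<subseteq> S" "emeasure (lborel_subspace S) X = 1"
      by (rule lborel_subspace_unit[OF S])
    then have "ennreal c = ennreal (volume_factor L)" using c sc by (metis mult.right_neutral)
    then show "c = volume_factor L" using c volume_factor_pos[OF lL(1,2)] by simp
  qed
qed

text \<open>Injectivity on \<open>S\<close> makes the complements of \<open>S\<close> and of its
  image equal in dimension, so an isometry between them exists and can be glued to
  \<open>A\<close>.\<close>

lemma exists_isometric_extension:
  fixes S :: "'a::euclidean_space set"
    and A :: "'a \<Rightarrow> 'a"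
  assumes S: "subspace S" and A: "linear A" "inj_on A S"
  shows "\<exists>L. isometric_extension S A L"
proof -
  let ?P = "closest_point S"
  have sAS: "subspace (A ` S)" by (rule linear_subspace_image[OF A(1) S])
  have "inj_on A (span S)" using A(2) S by (metis span_eq_iff)
  then have "dim (A ` S) = dim S" by (rule dim_image_eq[OF A(1)])
  then have d: "dim (S\<^sup>\<bottom>) = dim ((A ` S)\<^sup>\<bottom>)"
    using dim_orthogonal_comp[OF S] dim_orthogonal_comp[OF sAS] by simp
  obtain f where f: "linear f" "f ` (S\<^sup>\<bottom>) = (A ` S)\<^sup>\<bottom>" "\<And>x. x \<in> S\<^sup>\<bottom> \<Longrightarrow> norm (f x) = norm x"
    using isometry_subspaces[OF subspace_orthogonal_comp subspace_orthogonal_comp d] by metis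
  define L where "L = (\<lambda>v. A (?P v) + f (v - ?P v))"
  have P: "linear ?P" by (rule linear_closest_point[OF S])
  have lin: "linear L"
    unfolding L_def
    by (intro linearI) (simp_all add: linear_add[OF P] linear_scale[OF P] linear_add[OF A(1)]
        linear_scale[OF A(1)] linear_diff[OF f(1)] linear_add[OF f(1)] linear_scale[OF f(1)] algebra_simps)
  have LS: "L v = A v" if "v \<in> S" for v
    using that closest_point_subspace_self[OF S] linear_0[OF f(1)] by (simp add: L_def)
  have LT: "L v = f v" if "v \<in> S\<^sup>\<bottom>" for v
    using that closest_point_orthogonal_comp_0[OF S] linear_0[OF A(1)] by (simp add: L_def)
  have fo: "f v \<bullet> A u = 0" if "v \<in> S\<^sup>\<bottom>" "u \<in> S" for u v
    using that f(2) orthogonal_compD(1)[of "f v" "A ` S" "A u"] by blast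
  have "v = 0" if "L v = 0" for v
  proof -
    let ?q = "v - ?P v"
    have q: "?q \<in> S\<^sup>\<bottom>" and p: "?P v \<in> S"
      by (simp_all add: diff_closest_point_orth closest_point_in_subspace S)
    have "(norm (L v))\<^sup>2 = (norm (A (?P v)))\<^sup>2 + (norm (f ?q))\<^sup>2"
      unfolding L_def using fo[OF q p] by (intro norm_add_orth_sq) (simp add: inner_commute)
    then have "A (?P v) = 0" "f ?q = 0" using that by (auto simp: sum_power2_eq_zero_iff)
    then have "?P v = 0" "?q = 0"
      using f(3)[OF q] inj_onD[OF A(2), of "?P v" 0] p subspace_0[OF S] linear_0[OF A(1)] by auto
    then show ?thesis by simp
  qed
  then have "inj L" using linear_injective_0[OF lin] by blast
  then have "bij L" using linear_injective_imp_surjective[OF lin] by (simp add: bij_def)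
  then show ?thesis
    using lin LS LT f(3) fo unfolding isometric_extension_def by (intro exI[of _ L]) auto
qed

lemma abs_det_on_pos:
  fixes S :: "'a::euclidean_space set"
    and A :: "'a \<Rightarrow> 'a"
  assumes "subspace S" "linear A" "inj_on A S"
  shows "abs_det_on S A > 0"
  using exists_isometric_extension[OF assms] abs_det_on_eq[OF assms(1)] volume_factor_pos
  by (metis isometric_extension_def)

lemma abs_det_on_cong:
  fixes S :: "'a::euclidean_space set"
    and A B :: "'a \<Rightarrow> 'a"
  assumes "subspace S" "linear A" "inj_on A S" "\<And>v. v \<in> S \<Longrightarrow> B v = A v"
  shows "abs_det_on S B = abs_det_on S A"
proof -
  obtain L where L: "isometric_extension S A L" using exists_isometric_extension[OF assms(1-3)] ..
  then have "isometric_extension S B L" using assms(4) by (simp add: isometric_extension_def)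
  then show ?thesis using L abs_det_on_eq[OF assms(1)] by metis
qed

lemma abs_det_on_trivial:
  fixes A :: "'a::euclidean_space \<Rightarrow> 'a"
  assumes "linear A" shows "abs_det_on {0} A = 1"
proof -
  have "isometric_extension {0} A id"
    using assms by (simp add: isometric_extension_def linear_id linear_0)
  then show ?thesis
    using abs_det_on_eq[of "{0}" A id] volume_factor_isometry[of "id :: 'a \<Rightarrow> 'a"] by (simp add: linear_id)
qed

text \<open>Isometric extensions compose to an isometric extension, which reduces the claim to
  \<open>volume_factor_compose\<close>.\<close>

lemma abs_det_on_compose:
  fixes S :: "'a::euclidean_space set"
    and A B :: "'a \<Rightarrow> 'a"
  assumes S: "subspace S" and A: "linear A" "inj_on A S" and B: "linear B" "inj_on B (A ` S)"
  shows "abs_det_on S (\<lambda>v. B (A v)) = abs_det_on (A ` S) B * abs_det_on S A"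
proof -
  obtain L where L: "isometric_extension S A L" using exists_isometric_extension[OF S A] ..
  note AS = isometric_extension_image[OF S L]
  obtain M where M: "isometric_extension (A ` S) B M" using exists_isometric_extension[OF AS(2) B] ..
  have "isometric_extension S (\<lambda>v. B (A v)) (M \<circ> L)"
    unfolding isometric_extension_def
  proof (intro conjI ballI)
    fix v assume v: "v \<in> S\<^sup>\<bottom>"
    then have Lv: "L v \<in> (A ` S)\<^sup>\<bottom>" using AS(1) by blast
    show "norm ((M \<circ> L) v) = norm v" using L M v Lv by (simp add: isometric_extension_def)
    fix u assume "u \<in> S"
    then show "(M \<circ> L) v \<bullet> B (A u) = 0" using M Lv by (simp add: isometric_extension_def)
  qed (use L M in \<open>auto simp: isometric_extension_def intro!: linear_compose bij_comp\<close>)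
  then have "abs_det_on S (\<lambda>v. B (A v)) = volume_factor (M \<circ> L)" by (rule abs_det_on_eq[OF S])
  also have "\<dots> = volume_factor M * volume_factor L"
    using L M by (simp add: volume_factor_compose isometric_extension_def)
  finally show ?thesis using abs_det_on_eq[OF AS(2) M] abs_det_on_eq[OF S L] by simp
qed

text \<open>Base times height: \<open>A e\<close> is the foot of the perpendicular from
  \<open>A f\<close> to the image of \<open>S\<close>. An isometric extension \<open>L\<close> from
  the larger space factors as \<open>L0\<close> after \<open>N\<close>, where \<open>L0\<close>
  isometrically extends \<open>A\<close> from \<open>S\<close> alone and \<open>N\<close> has
  determinant equal to the height.\<close>

lemma abs_det_on_insert:
  fixes S :: "'a::euclidean_space set"
    and A :: "'a \<Rightarrow> 'a"
  assumes S: "subspace S" and f: "f \<in> S\<^sup>\<bottom>" "norm f = 1"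
    and A: "linear A" "inj_on A (span (insert f S))"
  obtains e where "e \<in> S" "abs_det_on (span (insert f S)) A = abs_det_on S A * norm (A f - A e)"
    "\<And>u. u \<in> S \<Longrightarrow> (A f - A e) \<bullet> A u = 0"
proof -
  let ?T = "span (insert f S)"
  have ff: "f \<bullet> f = 1" using f by (simp add: norm_eq_1)
  obtain L where L: "isometric_extension ?T A L"
    using exists_isometric_extension[OF subspace_span A] ..
  have lL: "linear L" "bij L" and LT: "\<And>v. v \<in> ?T \<Longrightarrow> L v = A v"
    using L by (auto simp: isometric_extension_def)
  have fT: "f \<in> ?T" and ST: "S \<subseteq> ?T" by (auto simp: span_base)
  have sAS: "subspace (A ` S)" by (rule linear_subspace_image[OF A(1) S])
  obtain e where e: "e \<in> S" "closest_point (A ` S) (A f) = A e"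
    using closest_point_in_subspace[OF sAS, of "A f"] by auto
  define q where "q = A f - A e"
  define \<alpha> where "\<alpha> = norm q"
  define g where "g = q /\<^sub>R \<alpha>"
  have qo: "q \<bullet> A u = 0" if "u \<in> S" for u
    using closest_point_subspace_orth[OF sAS, of "A u" "A f"] that e by (simp add: q_def)
  have fS: "f \<notin> S" using f ff orthogonal_compD(1)[OF f(1)] by auto
  have "q \<noteq> 0" using inj_onD[OF A(2), of f e] e fT ST fS by (auto simp: q_def)
  then have \<alpha>: "\<alpha> > 0" by (simp add: \<alpha>_def)
  then have gn: "norm g = 1" and q: "q = \<alpha> *\<^sub>R g" by (simp_all add: g_def \<alpha>_def)
  have ef: "e \<bullet> f = 0" using orthogonal_compD[OF f(1) e(1)] by simp
  have gT: "g = A ((f - e) /\<^sub>R \<alpha>)" "(f - e) /\<^sub>R \<alpha> \<in> ?T"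
    using e fT ST by (auto simp: g_def q_def linear_diff[OF A(1)] linear_scale[OF A(1)] intro!: span_scale span_diff)
  \<comment> \<open>\<open>L0\<close> sends \<open>f\<close> to the unit normal \<open>g\<close> and
    agrees with \<open>L\<close> on the orthogonal complement of \<open>f\<close>.\<close>
  define L0 where "L0 = (\<lambda>v. L (v - (v \<bullet> f) *\<^sub>R f) + (v \<bullet> f) *\<^sub>R g)"
  \<comment> \<open>A stretch of \<open>f\<close> by \<open>\<alpha>\<close> followed by a shear, so
    that \<open>N f = \<alpha> *\<^sub>R f + e\<close>; then \<open>L0\<close> takes this to
    \<open>\<alpha> *\<^sub>R g + A e\<close>, which is \<open>A f\<close>.\<close>
  define N where "N = (\<lambda>v. v + (v \<bullet> f) *\<^sub>R (e /\<^sub>R \<alpha>)) \<circ> (\<lambda>v. v + ((\<alpha> - 1) * (v \<bullet> f)) *\<^sub>R f)"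
  have linS: "linear (\<lambda>v. v + (v \<bullet> f) *\<^sub>R (e /\<^sub>R \<alpha>))" "linear (\<lambda>v. v + ((\<alpha> - 1) * (v \<bullet> f)) *\<^sub>R f)"
    by (auto intro!: linearI simp: algebra_simps inner_add_left)
  have eaf: "(e /\<^sub>R \<alpha>) \<bullet> f = 0" using ef by simp
  have N: "linear N" "bij N" "volume_factor N = \<alpha>"
    unfolding N_def
    using linS volume_factor_shear[OF f(2) eaf] volume_factor_stretch[OF f(2), of \<alpha>] \<alpha>
    by (simp_all add: linear_compose bij_comp volume_factor_compose)
  have Nv: "N v = v + (v \<bullet> f) *\<^sub>R (e + (\<alpha> - 1) *\<^sub>R f)" for v
    using \<alpha> ff by (simp add: N_def inner_add_left algebra_simps)
  have lin0: "linear L0"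
    unfolding L0_def by (auto intro!: linearI simp: inner_add_left linear_add[OF lL(1)]
      linear_diff[OF lL(1)] linear_scale[OF lL(1)] algebra_simps)
  have LL: "L = L0 \<circ> N"
  proof
    fix v
    have Nf: "N v \<bullet> f = \<alpha> * (v \<bullet> f)" by (simp add: Nv inner_add_left ef ff algebra_simps)
    have "N v - (N v \<bullet> f) *\<^sub>R f = v - (v \<bullet> f) *\<^sub>R f + (v \<bullet> f) *\<^sub>R e"
      unfolding Nf by (simp add: Nv algebra_simps)
    then have "L0 (N v) = L v - (v \<bullet> f) *\<^sub>R L f + (v \<bullet> f) *\<^sub>R L e + (v \<bullet> f) *\<^sub>R (\<alpha> *\<^sub>R g)"
      unfolding L0_def Nf
      by (simp add: linear_add[OF lL(1)] linear_diff[OF lL(1)] linear_scale[OF lL(1)] mult.commute)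
    also have "\<dots> = L v"
      using LT[OF fT] LT[of e] e ST by (simp add: q[symmetric] q_def algebra_simps subset_iff)
    finally show "L v = (L0 \<circ> N) v" by simp
  qed
  then have "surj L0" using lL(2) by (metis bij_is_surj comp_apply surj_def)
  then have b0: "bij L0" using linear_surjective_imp_injective[OF lin0] by (simp add: bij_def)
  have "isometric_extension S A L0"
    unfolding isometric_extension_def
  proof (intro conjI ballI lin0 b0)
    fix v assume "v \<in> S"
    then show "L0 v = A v"
      using orthogonal_compD(2)[OF f(1)] LT ST by (auto simp: L0_def)
  next
    fix v assume v: "v \<in> S\<^sup>\<bottom>"
    define w where "w = v - (v \<bullet> f) *\<^sub>R f"
    have "w \<in> ?T\<^sup>\<bottom>"
      unfolding mem_orthogonal_comp
    proof
      fix s assume "s \<in> ?T"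
      then show "w \<bullet> s = 0"
      proof (induction rule: span_induct_alt)
        case (step c x y)
        have "w \<bullet> x = 0" using step(1) ff orthogonal_compD[OF v] orthogonal_compD[OF f(1)]
          by (auto simp: w_def inner_diff_left)
        then show ?case using step by (simp add: inner_add_right)
      qed simp
    qed
    then have w: "norm (L w) = norm w" "\<And>u. u \<in> ?T \<Longrightarrow> L w \<bullet> A u = 0"
      using L by (auto simp: isometric_extension_def)
    have L0v: "L0 v = L w + (v \<bullet> f) *\<^sub>R g" by (simp add: L0_def w_def)
    have "(norm (L0 v))\<^sup>2 = (norm w)\<^sup>2 + (v \<bullet> f)\<^sup>2"
      unfolding L0v using w gT gn by (subst norm_add_orth_sq) (simp_all add: power_mult_distrib)
    also have "\<dots> = (norm (w + (v \<bullet> f) *\<^sub>R f))\<^sup>2"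
      using f ff by (subst norm_add_orth_sq) (simp_all add: w_def inner_diff_left power_mult_distrib)
    also have "\<dots> = (norm v)\<^sup>2" by (simp add: w_def)
    finally show "norm (L0 v) = norm v" by (simp add: power2_eq_iff_nonneg)
    fix u assume u: "u \<in> S"
    show "L0 v \<bullet> A u = 0" using w(2)[of u] ST u qo[OF u] by (auto simp: L0v g_def inner_add_left)
  qed
  then have "abs_det_on ?T A = abs_det_on S A * norm (A f - A e)"
    using abs_det_on_eq[OF subspace_span L] abs_det_on_eq[OF S] LL volume_factor_compose[OF lin0 b0 N(1,2)] N(3)
    by (simp add: \<alpha>_def q_def)
  then show ?thesis using that e(1) qo by (simp add: q_def)
qed

section \<open>Determinants along growing chains of subspaces\<close>

text \<open>Each step adds one unit vector orthogonal to the space reached so far, which is the form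
  in which \<open>abs_det_on_insert\<close> can be applied.\<close>

lemma subspace_extend_induct [consumes 3, case_names base step]:
  fixes S1 S2 :: "'a::euclidean_space set"
  assumes S: "subspace S1" "subspace S2" "S1 \<subseteq> S2"
    and base: "P S1"
    and step: "\<And>S f. subspace S \<Longrightarrow> S1 \<subseteq> S \<Longrightarrow> S \<subseteq> S2 \<Longrightarrow> f \<in> S2 \<Longrightarrow> f \<in> S\<^sup>\<bottom> \<Longrightarrow> norm f = 1 \<Longrightarrow>
      dim (span (insert f S)) = Suc (dim S) \<Longrightarrow> span (insert f S) \<subseteq> S2 \<Longrightarrow> P S \<Longrightarrow> P (span (insert f S))"
  shows "P S2"
proof -
  have "P S \<longrightarrow> P S2" if "subspace S" "S1 \<subseteq> S" "S \<subseteq> S2" for S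
    using that
  proof (induction "dim S2 - dim S" arbitrary: S)
    case 0
    then have "S = S2" using subspace_dim_equal[OF 0(2) S(2) 0(4)] by simp
    then show ?case by simp
  next
    case (Suc n)
    then have "dim {y \<in> S2. \<forall>x\<in>S. orthogonal x y} \<noteq> 0"
      using dim_subspace_orthogonal_to_vectors[OF Suc(3) S(2) Suc(5)] by linarith
    then obtain g where g: "g \<in> S2" "g \<in> S\<^sup>\<bottom>" "g \<noteq> 0"
      by (auto simp: dim_eq_0 orthogonal_comp_def)
    define f where "f = g /\<^sub>R norm g"
    have f: "f \<in> S2" "f \<in> S\<^sup>\<bottom>" "norm f = 1"
      using g subspace_scale[OF S(2)] subspace_scale[OF subspace_orthogonal_comp[of S]] by (auto simp: f_def)
    have "f \<notin> span S"
      using f orthogonal_compD(1)[OF f(2), of f] Suc(3) by (auto simp: span_eq_iff[THEN iffD2])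
    then have d: "dim (span (insert f S)) = Suc (dim S)" by (simp add: dim_insert)
    have sub: "span (insert f S) \<subseteq> S2" using f Suc(5) S(2) by (simp add: span_minimal)
    have S1: "S1 \<subseteq> span (insert f S)" using Suc(4) span_superset[of "insert f S"] by blast
    have "P (span (insert f S)) \<longrightarrow> P S2"
      using Suc(2) d by (intro Suc(1) subspace_span S1 sub) simp
    then show ?case using step[OF Suc(3-5) f d sub] by blast
  qed
  then show ?thesis using S base by blast
qed

text \<open>Every new height is at most \<open>norm (A f)\<close>, and every new direction
  \<open>f\<close> is orthogonal to \<open>S1\<close>; so the bound \<open>M\<close> matters only on
  the complement of \<open>S1\<close>.\<close>

lemma abs_det_on_extend_le:
  fixes S1 S2 :: "'a::euclidean_space set"
    and A :: "'a \<Rightarrow> 'a"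
  assumes S: "subspace S1" "subspace S2" "S1 \<subseteq> S2" and A: "linear A" "inj_on A S2"
    and M: "\<And>v. v \<in> S2 \<Longrightarrow> v \<in> S1\<^sup>\<bottom> \<Longrightarrow> norm (A v) \<le> M * norm v" "M \<ge> 0"
  shows "abs_det_on S2 A \<le> M ^ (dim S2 - dim S1) * abs_det_on S1 A"
  using S
proof (induction rule: subspace_extend_induct)
  case (step S f)
  have inj: "inj_on A (span (insert f S))" using A(2) step(8) inj_on_subset by blast
  obtain e where e: "e \<in> S" "abs_det_on (span (insert f S)) A = abs_det_on S A * norm (A f - A e)"
    "\<And>u. u \<in> S \<Longrightarrow> (A f - A e) \<bullet> A u = 0"
    using abs_det_on_insert[OF step(1,5,6) A(1) inj] by metis
  have "norm (A f - A e) \<le> norm (A f)"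
    using norm_le_norm_add_orth[OF e(3)[OF e(1)]] by simp
  also have "\<dots> \<le> M" using M(1)[of f] step by (auto simp: orthogonal_comp_anti_mono[THEN subsetD])
  finally have n: "norm (A f - A e) \<le> M" .
  have "dim S1 \<le> dim S" using step(2) by (rule dim_subset)
  then have d: "dim (span (insert f S)) - dim S1 = Suc (dim S - dim S1)" using step(7) by simp
  have "0 \<le> abs_det_on S A"
    using abs_det_on_pos[OF step(1) A(1)] inj_on_subset[OF A(2) step(3)] by fastforce
  then have "abs_det_on S A * norm (A f - A e) \<le> (M ^ (dim S - dim S1) * abs_det_on S1 A) * M"
    using step(9) n M(2) by (intro mult_mono) auto
  then show ?case unfolding e(2) d by (simp add: mult_ac)
qed simp

text \<open>The new height is the norm of \<open>A (f - e)\<close>, and \<open>f - e\<close> has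
  norm at least 1 because \<open>e\<close> is orthogonal to the unit vector
  \<open>f\<close>.\<close>

lemma abs_det_on_extend_ge:
  fixes S1 S2 :: "'a::euclidean_space set"
    and A :: "'a \<Rightarrow> 'a"
  assumes S: "subspace S1" "subspace S2" "S1 \<subseteq> S2" and A: "linear A"
    and m: "\<And>v. v \<in> S2 \<Longrightarrow> m * norm v \<le> norm (A v)" "m > 0"
  shows "m ^ (dim S2 - dim S1) * abs_det_on S1 A \<le> abs_det_on S2 A"
  using S
proof (induction rule: subspace_extend_induct)
  case (step S f)
  have "v = 0" if "v \<in> S2" "A v = 0" for v
    using m(1)[OF that(1)] m(2) that(2) by (simp add: mult_le_0_iff)
  then have injS2: "inj_on A S2"
    using linear_injective_on_subspace_0[OF A(1) S(2)] by blast
  then have inj: "inj_on A (span (insert f S))" using step(8) inj_on_subset by blast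
  obtain e where e: "e \<in> S" "abs_det_on (span (insert f S)) A = abs_det_on S A * norm (A f - A e)"
    using abs_det_on_insert[OF step(1,5,6) A(1) inj] by metis
  have "1 \<le> norm (f - e)"
    using norm_le_norm_add_orth[of f "- e"] orthogonal_compD[OF step(5) e(1)] step(6) by simp
  then have "m * 1 \<le> m * norm (f - e)" using m(2) by (intro mult_left_mono) auto
  also have "\<dots> \<le> norm (A f - A e)"
    using m(1)[of "f - e"] step e S(2) by (simp add: linear_diff[OF A(1)] subspace_diff subset_iff)
  finally have n: "m \<le> norm (A f - A e)" by simp
  have "dim S1 \<le> dim S" using step(2) by (rule dim_subset)
  then have d: "dim (span (insert f S)) - dim S1 = Suc (dim S - dim S1)" using step(7) by simp
  have "0 \<le> abs_det_on S A"
    using abs_det_on_pos[OF step(1) A(1)] inj_on_subset[OF injS2 step(3)] by fastforce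
  then have "(m ^ (dim S - dim S1) * abs_det_on S1 A) * m \<le> abs_det_on S A * norm (A f - A e)"
    using step(9) n m(2) by (intro mult_mono) auto
  then show ?case unfolding e(2) d by (simp add: mult_ac)
qed simp

lemma abs_det_on_le:
  fixes S :: "'a::euclidean_space set"
    and A :: "'a \<Rightarrow> 'a"
  assumes "subspace S" "linear A" "inj_on A S" "\<And>v. v \<in> S \<Longrightarrow> norm (A v) \<le> M * norm v" "M \<ge> 0"
  shows "abs_det_on S A \<le> M ^ dim S"
  using abs_det_on_extend_le[of "{0}" S A M] assms abs_det_on_trivial[of A] subspace_0[OF assms(1)]
  by (simp add: subspace_single_0)

lemma abs_det_on_ge:
  fixes S :: "'a::euclidean_space set"
    and A :: "'a \<Rightarrow> 'a"
  assumes "subspace S" "linear A" "\<And>v. v \<in> S \<Longrightarrow> m * norm v \<le> norm (A v)" "m > 0"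
  shows "m ^ dim S \<le> abs_det_on S A"
  using abs_det_on_extend_ge[of "{0}" S A m] assms abs_det_on_trivial[of A] subspace_0[OF assms(1)]
  by (simp add: subspace_single_0)

lemma bij_linear_bounded_below:
  fixes A :: "'a::euclidean_space \<Rightarrow> 'a"
  assumes "linear A" "\<And>v. m * norm v \<le> norm (A v)" "m > 0"
  shows "bij A"
proof -
  have "v = 0" if "A v = 0" for v
    using assms(2)[of v] assms(3) that by (simp add: mult_le_0_iff)
  then have "inj A" using linear_injective_0[OF assms(1)] by blast
  then show ?thesis using linear_injective_imp_surjective[OF assms(1)] by (simp add: bij_def)
qed

lemma dim_image_bij: "linear A \<Longrightarrow> bij A \<Longrightarrow> dim (A ` S) = dim S"
  for A :: "'a::euclidean_space \<Rightarrow> 'a"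
  by (rule dim_image_eq) (auto intro: inj_on_subset dest: bij_is_inj)

lemma inj_on_bij: "bij A \<Longrightarrow> inj_on A S"
  by (metis bij_is_inj inj_on_subset subset_UNIV)

text \<open>On \<open>E\<close>, \<open>A\<close> equals \<open>\<Psi>\<close> after
  \<open>A\<close> after the projection P onto \<open>E'\<close>. The projection does not increase
  volume, and \<open>\<Psi>\<close> only moves \<open>A (P v)\<close> to \<open>A v\<close>: a
  displacement of at most M \<delta> |v|, relative to a vector of length at least m (1 - \<delta>)
  |v|.\<close>

lemma abs_det_on_near:
  fixes E E' :: "'a::euclidean_space set"
    and A :: "'a \<Rightarrow> 'a"
  assumes E: "subspace E" "subspace E'" "dim E = dim E'" and n: "near \<delta> E E'" and \<delta>: "0 \<le> \<delta>" "\<delta> < 1"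
    and A: "linear A" "\<And>v. m * norm v \<le> norm (A v)" "\<And>v. norm (A v) \<le> M * norm v" "m > 0" "M \<ge> 0"
  shows "abs_det_on E A \<le> (1 + M / m * \<delta> / (1 - \<delta>)) ^ dim E * abs_det_on E' A"
proof -
  let ?P = "closest_point E'"
  have linP: "linear ?P" by (rule linear_closest_point[OF E(2)])
  have bA: "bij A" by (rule bij_linear_bounded_below[OF A(1,2,4)])
  have injP: "inj_on ?P E" by (rule near_inj[OF E(1,2) n \<delta>(2)])
  have "inj_on ?P (span E)" using injP E(1) by (metis span_eq_iff)
  then have "dim (?P ` E) = dim E'"
    using dim_image_eq[OF linP] E(3) by metis
  then have PE: "?P ` E = E'"
    by (intro subspace_dim_equal linear_subspace_image linP E) (auto simp: closest_point_in_subspace[OF E(2)])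
  obtain Q where Q: "linear Q" "\<And>v. v \<in> E \<Longrightarrow> Q (?P v) = v"
    using linear_exists_left_inverse_on[OF linP E(1) injP] by auto
  define \<Psi> where "\<Psi> = (\<lambda>v. A (Q (inv A v)))"
  have lin\<Psi>: "linear \<Psi>"
    using linear_compose[OF linear_compose[OF linear_bij_inv[OF A(1) bA] Q(1)] A(1)]
    by (simp add: \<Psi>_def comp_def)
  have \<Psi>: "\<Psi> (A (?P v)) = A v" if "v \<in> E" for v
    using bA that by (simp add: \<Psi>_def bij_is_inj Q)
  have AP: "linear (\<lambda>v. A (?P v))" "inj_on (\<lambda>v. A (?P v)) E"
    using linear_compose[OF linP A(1)] comp_inj_on[OF injP inj_on_bij[OF bA]] by (simp_all add: comp_def)
  have APE: "(\<lambda>v. A (?P v)) ` E = A ` E'" by (metis PE image_image)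
  have inj\<Psi>: "inj_on \<Psi> (A ` E')"
  proof (rule inj_onI)
    fix x y assume xy: "x \<in> A ` E'" "y \<in> A ` E'" "\<Psi> x = \<Psi> y"
    then obtain u v where uv: "u \<in> E" "x = A (?P u)" "v \<in> E" "y = A (?P v)"
      unfolding APE[symmetric] by auto
    then have "A u = A v" using xy(3) \<Psi> by simp
    then have "u = v" using bA by (metis bij_is_inj injD)
    then show "x = y" using uv by simp
  qed
  have b\<Psi>: "norm (\<Psi> w) \<le> (1 + M / m * \<delta> / (1 - \<delta>)) * norm w" if "w \<in> A ` E'" for w
  proof -
    obtain v where v: "v \<in> E" "w = A (?P v)" using \<open>w \<in> A ` E'\<close> unfolding APE[symmetric] by auto
    have near: "norm (v - ?P v) \<le> \<delta> * norm v" using n v by (simp add: near_def)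
    then have "(1 - \<delta>) * norm v \<le> norm (?P v)" using norm_triangle_sub[of v "?P v"] by (simp add: algebra_simps)
    then have "m * ((1 - \<delta>) * norm v) \<le> norm w"
      using A(2)[of "?P v"] A(4) v by (meson less_imp_le mult_left_mono order_trans)
    then have nv: "norm v \<le> norm w / (m * (1 - \<delta>))" using A(4) \<delta> by (simp add: field_simps)
    have "\<Psi> w = w + A (v - ?P v)" using v \<Psi> by (simp add: linear_diff[OF A(1)])
    then have "norm (\<Psi> w) \<le> norm w + M * norm (v - ?P v)"
      using A(3)[of "v - ?P v"] norm_triangle_ineq[of w "A (v - ?P v)"] by simp
    also have "\<dots> \<le> norm w + M * (\<delta> * norm v)" using near A(5) by (intro add_left_mono mult_left_mono) auto
    also have "\<dots> \<le> norm w + M * (\<delta> * (norm w / (m * (1 - \<delta>))))"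
      using nv A(5) \<delta> by (intro add_left_mono mult_left_mono) auto
    finally show ?thesis by (simp add: field_simps)
  qed
  let ?c = "1 + M / m * \<delta> / (1 - \<delta>)"
  have c: "?c \<ge> 0" using A \<delta> by (intro add_nonneg_nonneg divide_nonneg_nonneg mult_nonneg_nonneg) auto
  have sAE': "subspace (A ` E')" by (rule linear_subspace_image[OF A(1) E(2)])
  have "abs_det_on E A = abs_det_on E (\<lambda>v. \<Psi> (A (?P v)))"
    by (rule abs_det_on_cong[symmetric, OF E(1) A(1) inj_on_bij[OF bA]]) (simp add: \<Psi>)
  also have "\<dots> = abs_det_on (A ` E') \<Psi> * abs_det_on E (\<lambda>v. A (?P v))"
    using abs_det_on_compose[OF E(1) AP lin\<Psi>] inj\<Psi> APE by simp
  also have "abs_det_on E (\<lambda>v. A (?P v)) = abs_det_on E' A * abs_det_on E ?P"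
    using abs_det_on_compose[OF E(1) linP injP A(1) inj_on_bij[OF bA]] PE by simp
  also have "abs_det_on (A ` E') \<Psi> * (abs_det_on E' A * abs_det_on E ?P)
      \<le> ?c ^ dim (A ` E') * (abs_det_on E' A * 1 ^ dim E)"
    using abs_det_on_pos[OF E(2) A(1) inj_on_bij[OF bA]] abs_det_on_pos[OF E(1) linP injP] c
    by (intro mult_mono abs_det_on_le sAE' lin\<Psi> inj\<Psi> b\<Psi> E linP injP)
       (auto simp: norm_closest_point_le E)
  finally show ?thesis using dim_image_bij[OF A(1) bA, of E'] E(3) by simp
qed

section \<open>Determinants compared with singular values\<close>

text \<open>Quantitative content of a singular value decomposition at index \<open>dim W\<close>: \<open>W\<close> and its
  complement are spanned by right singular vectors, those of \<open>W\<close> belonging to the larger singular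
  values; \<open>s\<close> is the smallest singular value on \<open>W\<close>.\<close>
definition singular_split :: "('a::euclidean_space \<Rightarrow> 'a) \<Rightarrow> 'a set \<Rightarrow> real \<Rightarrow> real \<Rightarrow> bool" where
  "singular_split A W s t \<longleftrightarrow> subspace W \<and> (\<forall>w\<in>W. s * norm w \<le> norm (A w)) \<and>
     (\<forall>v\<in>W\<^sup>\<bottom>. norm (A v) \<le> t * norm v) \<and> (\<forall>w\<in>W. \<forall>v\<in>W\<^sup>\<bottom>. A w \<bullet> A v = 0) \<and>
     (\<exists>w\<in>W. w \<noteq> 0 \<and> (\<forall>v. A w \<bullet> A v = s\<^sup>2 * (w \<bullet> v)))"

text \<open>The operator D of the overview is \<open>S\<close> here, and \<open>A\<close> factors as
  \<open>L\<close> after \<open>S\<close>. The first bound uses that \<open>L\<close> expands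
  everything by at least \<open>s\<close>, so \<open>norm (S e)\<close> is at most
  \<open>norm (A e) / s\<close>; the second computes \<open>norm (S e)\<close> by Pythagoras along
  \<open>W\<close> and its complement.\<close>

lemma abs_det_on_split_bound:
  fixes A :: "'a::euclidean_space \<Rightarrow> 'a"
  assumes A: "linear A" "bij A" and sp: "singular_split A W s t" and st: "0 < s" "t \<le> s" "0 \<le> t"
    and E: "subspace E" "dim E = dim W" "e \<in> E" "norm e = 1"
  shows "abs_det_on E A \<le> abs_det_on W A * (norm (A e) / s)"
    "(abs_det_on E A)\<^sup>2 \<le> (abs_det_on W A)\<^sup>2 * ((norm (closest_point W e))\<^sup>2 + (t / s)\<^sup>2)"
proof -
  have W: "subspace W" and Ws: "\<And>w. w \<in> W \<Longrightarrow> s * norm w \<le> norm (A w)"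
    and Wt: "\<And>v. v \<in> W\<^sup>\<bottom> \<Longrightarrow> norm (A v) \<le> t * norm v"
    and Wo: "\<And>w v. w \<in> W \<Longrightarrow> v \<in> W\<^sup>\<bottom> \<Longrightarrow> A w \<bullet> A v = 0"
    using sp by (auto simp: singular_split_def)
  let ?P = "closest_point W"
  have linP: "linear ?P" by (rule linear_closest_point[OF W])
  have PW: "?P v \<in> W" "v - ?P v \<in> W\<^sup>\<bottom>" for v
    by (simp_all add: W closest_point_in_subspace diff_closest_point_orth)
  obtain L0 where L0: "isometric_extension W A L0"
    using exists_isometric_extension[OF W A(1) inj_on_bij[OF A(2)]] ..
  have l0: "linear L0" and n0: "\<And>v. v \<in> W\<^sup>\<bottom> \<Longrightarrow> norm (L0 v) = norm v"
    and o0: "\<And>v u. v \<in> W\<^sup>\<bottom> \<Longrightarrow> u \<in> W \<Longrightarrow> L0 v \<bullet> A u = 0"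
    using L0 by (auto simp: isometric_extension_def)
  \<comment> \<open>\<open>L\<close> agrees with \<open>A\<close> on \<open>W\<close> but acts on
    the complement as \<open>s\<close> times an isometry, so that the singular values beyond
    \<open>W\<close> are raised to \<open>s\<close> and the contraction is left to
    \<open>S\<close>.\<close>
  define L where "L = (\<lambda>v. A (?P v) + s *\<^sub>R L0 (v - ?P v))"
  have linL: "linear L"
    unfolding L_def
    by (intro linearI) (simp_all add: linear_add[OF linP] linear_scale[OF linP] linear_add[OF A(1)]
        linear_scale[OF A(1)] linear_diff[OF l0] linear_add[OF l0] linear_scale[OF l0] algebra_simps)
  have Lsq: "(norm (L v))\<^sup>2 = (norm (A (?P v)))\<^sup>2 + (s * norm (v - ?P v))\<^sup>2" for v
    unfolding L_def using o0[OF PW(2) PW(1), of v v] st n0[OF PW(2), of v]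
    by (subst norm_add_orth_sq) (simp_all add: inner_commute power_mult_distrib)
  have Ls: "s * norm v \<le> norm (L v)" for v
  proof (rule power2_le_imp_le)
    have "(s * norm v)\<^sup>2 = (s * norm (?P v))\<^sup>2 + (s * norm (v - ?P v))\<^sup>2"
      using norm_closest_point_pythagoras[OF W, of v] by (simp add: power_mult_distrib distrib_left)
    also have "\<dots> \<le> (norm (L v))\<^sup>2" unfolding Lsq
      using Ws[OF PW(1), of v] st by (intro add_right_mono power_mono) auto
    finally show "(s * norm v)\<^sup>2 \<le> (norm (L v))\<^sup>2" .
  qed simp
  have bL: "bij L" by (rule bij_linear_bounded_below[OF linL Ls st(1)])
  define S where "S = (\<lambda>v. inv L (A v))"
  have LS: "L (S v) = A v" for v using bL by (simp add: S_def bij_is_surj surj_f_inv_f)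
  have linS: "linear S"
    using linear_compose[OF A(1) linear_bij_inv[OF linL bL]] by (simp add: S_def comp_def)
  have bS: "bij S"
    using bij_comp[OF A(2) bij_imp_bij_inv[OF bL]] by (simp add: S_def comp_def)
  have SW: "S w = w" if "w \<in> W" for w
  proof -
    have "L w = A w" using that closest_point_subspace_self[OF W that] linear_0[OF l0] by (simp add: L_def)
    then show ?thesis using bL by (metis LS bij_is_inj injD)
  qed
  have SW': "S v \<in> W\<^sup>\<bottom>" "norm (S v) \<le> t / s * norm v" if v: "v \<in> W\<^sup>\<bottom>" for v
  proof -
    have "A v \<in> (A ` W)\<^sup>\<bottom>" using Wo v by (auto simp: mem_orthogonal_comp[of _ "A ` W"] inner_commute)
    then obtain u where u: "u \<in> W\<^sup>\<bottom>" "A v = L0 u"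
      using isometric_extension_image(1)[OF W L0] by blast
    have u': "u /\<^sub>R s \<in> W\<^sup>\<bottom>" by (rule subspace_scale[OF subspace_orthogonal_comp u(1)])
    have "L (u /\<^sub>R s) = A v"
      using u st closest_point_orthogonal_comp_0[OF W u'] linear_0[OF A(1)]
      by (simp add: L_def linear_scale[OF l0])
    then have e: "S v = u /\<^sub>R s" using bL by (metis LS bij_is_inj injD)
    show "S v \<in> W\<^sup>\<bottom>" using e u' by simp
    show "norm (S v) \<le> t / s * norm v"
      using Wt[OF v] n0[OF u(1)] u(2) st by (simp add: e field_simps)
  qed
  have Ssq: "(norm (S v))\<^sup>2 \<le> (norm (?P v))\<^sup>2 + (t / s)\<^sup>2 * (norm (v - ?P v))\<^sup>2" for v
  proof -
    have "S v = ?P v + S (v - ?P v)"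
      using SW[OF PW(1)[of v]] by (simp add: linear_diff[OF linS])
    then have "(norm (S v))\<^sup>2 = (norm (?P v))\<^sup>2 + (norm (S (v - ?P v)))\<^sup>2"
      using norm_add_orth_sq[of "?P v" "S (v - ?P v)"] orthogonal_compD(2)[OF SW'(1)[OF PW(2)] PW(1)] by metis
    moreover have "(norm (S (v - ?P v)))\<^sup>2 \<le> (t / s * norm (v - ?P v))\<^sup>2"
      by (intro power_mono SW' PW) simp
    ultimately show ?thesis by (simp only: power_mult_distrib)
  qed
  have ts: "(t / s)\<^sup>2 \<le> 1" using st by (intro power_le_one) auto
  have S1: "norm (S v) \<le> 1 * norm v" for v
  proof -
    have "(norm (S v))\<^sup>2 \<le> (norm (?P v))\<^sup>2 + 1 * (norm (v - ?P v))\<^sup>2"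
      using Ssq[of v] mult_right_mono[OF ts, of "(norm (v - ?P v))\<^sup>2"] by simp
    then have "(norm (S v))\<^sup>2 \<le> (norm v)\<^sup>2" using norm_closest_point_pythagoras[OF W, of v] by simp
    then show ?thesis by (simp add: power2_le_iff_abs_le)
  qed
  \<comment> \<open>\<open>S\<close> is a contraction, so building \<open>E\<close> up from the line
    through \<open>e\<close> costs no factor above 1; the line itself contributes
    \<open>norm (S e)\<close>.\<close>
  have detS: "abs_det_on E S \<le> norm (S e)"
  proof -
    have se: "subspace {0::'a}" "e \<in> {0}\<^sup>\<bottom>" "inj_on S (span (insert e {0}))"
      by (auto simp: subspace_single_0 inj_on_bij[OF bS])
    obtain z where "z \<in> {0::'a}" "abs_det_on (span (insert e {0})) S = abs_det_on {0} S * norm (S e - S z)"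
      using abs_det_on_insert[OF se(1,2) E(4) linS se(3)] by metis
    then have "abs_det_on (span (insert e {0})) S = norm (S e)"
      using abs_det_on_trivial[OF linS] linear_0[OF linS] by simp
    moreover have "span (insert e {0}) \<subseteq> E" using E subspace_0 by (intro span_minimal) auto
    ultimately show ?thesis
      using abs_det_on_extend_le[OF subspace_span E(1) _ linS inj_on_bij[OF bS], of "insert e {0}" 1] S1 by simp
  qed
  \<comment> \<open>Both determinants are compared with that of \<open>L\<close> on the whole space:
    leaving the image of \<open>E\<close> gains at least \<open>s\<close> in each further dimension,
    leaving \<open>W\<close> gains at most \<open>s\<close>, and the number of further dimensions is
    the same.\<close>
  have detL: "abs_det_on (S ` E) L \<le> abs_det_on W A"
  proof -
    have sSE: "subspace (S ` E)" by (rule linear_subspace_image[OF linS E(1)])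
    have "dim (S ` E) = dim W" using dim_image_bij[OF linS bS] E(2) by simp
    then have "s ^ (DIM('a) - dim W) * abs_det_on (S ` E) L \<le> abs_det_on UNIV L"
      using abs_det_on_extend_ge[OF sSE subspace_UNIV _ linL Ls st(1)] by simp
    also have "\<dots> \<le> s ^ (DIM('a) - dim W) * abs_det_on W L"
    proof -
      have "norm (L v) \<le> s * norm v" if "v \<in> W\<^sup>\<bottom>" for v
        using that closest_point_orthogonal_comp_0[OF W that] linear_0[OF A(1)] n0[OF that] st by (simp add: L_def)
      then show ?thesis
        using abs_det_on_extend_le[OF W subspace_UNIV _ linL inj_on_bij[OF bL], of s] st by simp
    qed
    also have "abs_det_on W L = abs_det_on W A"
      by (rule abs_det_on_cong[OF W A(1) inj_on_bij[OF A(2)]]) (metis LS SW)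
    finally show ?thesis using st by simp
  qed
  have dE: "abs_det_on E A \<le> abs_det_on W A * norm (S e)"
  proof -
    have "abs_det_on E A = abs_det_on (S ` E) L * abs_det_on E S"
      using abs_det_on_compose[OF E(1) linS inj_on_bij[OF bS] linL inj_on_bij[OF bL]] LS by simp
    also have "\<dots> \<le> abs_det_on W A * norm (S e)"
      using detS detL abs_det_on_pos[OF E(1) linS inj_on_bij[OF bS]] abs_det_on_pos[OF W A(1) inj_on_bij[OF A(2)]]
      by (intro mult_mono) auto
    finally show ?thesis .
  qed
  have W0: "0 < abs_det_on W A" by (rule abs_det_on_pos[OF W A(1) inj_on_bij[OF A(2)]])
  have E0: "0 < abs_det_on E A" by (rule abs_det_on_pos[OF E(1) A(1) inj_on_bij[OF A(2)]])
  have "norm (S e) \<le> norm (A e) / s" using Ls[of "S e"] LS st by (simp add: field_simps)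
  then show "abs_det_on E A \<le> abs_det_on W A * (norm (A e) / s)"
    using dE W0 by (meson less_imp_le mult_left_mono order_trans)
  have "(norm (S e))\<^sup>2 \<le> (norm (?P e))\<^sup>2 + (t / s)\<^sup>2"
    using Ssq[of e] norm_diff_closest_point_le[OF W, of e] E(4)
      mult_left_mono[of "(norm (e - ?P e))\<^sup>2" 1 "(t / s)\<^sup>2"] by (simp add: power_le_one)
  then have "(abs_det_on W A)\<^sup>2 * (norm (S e))\<^sup>2 \<le> (abs_det_on W A)\<^sup>2 * ((norm (?P e))\<^sup>2 + (t / s)\<^sup>2)"
    by (intro mult_left_mono) auto
  moreover have "(abs_det_on E A)\<^sup>2 \<le> (abs_det_on W A * norm (S e))\<^sup>2"
    using dE E0 by (intro power_mono) auto
  ultimately show "(abs_det_on E A)\<^sup>2 \<le> (abs_det_on W A)\<^sup>2 * ((norm (?P e))\<^sup>2 + (t / s)\<^sup>2)"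
    by (simp add: power_mult_distrib)
qed

text \<open>The normalised component \<open>g\<close> of \<open>f\<close> orthogonal to
  \<open>E\<close> spans the same space with \<open>E\<close> as \<open>f\<close> does. Its height
  over the image of \<open>E\<close> is that of \<open>f\<close> divided by \<open>r\<close>, and
  \<open>r\<close> is at most \<open>norm f\<close>.\<close>

lemma abs_det_on_insert_ge:
  fixes A :: "'a::euclidean_space \<Rightarrow> 'a"
  assumes A: "linear A" "bij A" and E: "subspace E" "f \<notin> E"
    and \<rho>: "\<rho> \<ge> 0" "\<And>e. e \<in> E \<Longrightarrow> \<rho> \<le> norm (A f - A e)"
  shows "abs_det_on E A * \<rho> \<le> norm f * abs_det_on (span (insert f E)) A"
proof -
  let ?P = "closest_point E"
  define r where "r = norm (f - ?P f)"
  define g where "g = (f - ?P f) /\<^sub>R r"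
  have PE: "?P f \<in> E" by (rule closest_point_in_subspace[OF E(1)])
  then have r: "r > 0" using E(2) by (auto simp: r_def)
  have f: "f = r *\<^sub>R g + ?P f" using r by (simp add: g_def)
  have g: "g \<in> E\<^sup>\<bottom>" "norm g = 1"
    using r subspace_scale[OF subspace_orthogonal_comp diff_closest_point_orth[OF E(1)]]
    by (simp_all add: g_def) (simp add: r_def)
  have "r *\<^sub>R g + ?P f \<in> span (insert g E)"
    using PE by (intro span_add span_scale) (auto intro: span_base)
  then have "f \<in> span (insert g E)" using f by simp
  moreover have "g \<in> span (insert f E)"
    unfolding g_def using PE by (intro span_scale span_diff) (auto intro: span_base)
  ultimately have sp: "span (insert g E) = span (insert f E)"
    by (intro span_eq[THEN iffD2]) (auto simp: span_base)
  obtain e where e: "e \<in> E" "abs_det_on (span (insert g E)) A = abs_det_on E A * norm (A g - A e)"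
    using abs_det_on_insert[OF E(1) g A(1) inj_on_bij[OF A(2)]] by metis
  have "\<rho> \<le> norm (A f - A (?P f + r *\<^sub>R e))"
    using e PE by (intro \<rho> subspace_add subspace_scale E) auto
  also have "A f - A (?P f + r *\<^sub>R e) = r *\<^sub>R (A g - A e)"
    by (subst f) (simp add: linear_add[OF A(1)] linear_scale[OF A(1)] algebra_simps)
  also have "norm \<dots> = r * norm (A g - A e)" using r by simp
  also have "\<dots> \<le> norm f * norm (A g - A e)"
    using norm_diff_closest_point_le[OF E(1), of f] by (intro mult_right_mono) (auto simp: r_def)
  finally have "abs_det_on E A * \<rho> \<le> abs_det_on E A * (norm f * norm (A g - A e))"
    using abs_det_on_pos[OF E(1) A(1) inj_on_bij[OF A(2)]] by (intro mult_left_mono) auto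
  then show ?thesis using e(2) sp by (simp add: mult_ac)
qed

subsection \<open>Singular value decomposition\<close>

text \<open>A maximiser of the Rayleigh quotient on the unit sphere of \<open>S\<close>. If the
  residual \<open>z = H v - c *\<^sub>R v\<close> were nonzero, moving \<open>v\<close> towards
  \<open>z\<close> would increase the quotient to first order.\<close>

lemma self_adjoint_eigenvector:
  fixes H :: "'a::euclidean_space \<Rightarrow> 'a"
  assumes H: "linear H" "\<And>u v. H u \<bullet> v = u \<bullet> H v"
    and S: "subspace S" "H ` S \<subseteq> S" "dim S > 0"
  obtains v c where "v \<in> S" "norm v = 1" "H v = c *\<^sub>R v"
proof -
  let ?q = "\<lambda>u. u \<bullet> H u"
  obtain w where w: "w \<in> S" "w \<noteq> 0" using S by (metis dim_eq_0 less_not_refl singletonI subsetI)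
  have "compact (sphere 0 1 \<inter> S)"
    by (intro compact_Int_closed closed_subspace S) simp
  moreover have "w /\<^sub>R norm w \<in> sphere 0 1 \<inter> S"
    using w subspace_scale[OF S(1)] by simp
  then have "sphere 0 1 \<inter> S \<noteq> {}" by blast
  moreover have "continuous_on (sphere 0 1 \<inter> S) ?q"
    using H(1) by (intro continuous_intros linear_continuous_on) (simp add: linear_conv_bounded_linear)
  ultimately obtain v where "v \<in> sphere 0 1 \<inter> S" "\<forall>u\<in>sphere 0 1 \<inter> S. ?q u \<le> ?q v"
    using continuous_attains_sup[of "sphere 0 1 \<inter> S" ?q] by blast
  then have v: "v \<in> S" "norm v = 1" and max: "\<And>u. u \<in> S \<Longrightarrow> norm u = 1 \<Longrightarrow> ?q u \<le> ?q v"
    by auto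
  define c where "c = ?q v"
  have vv: "v \<bullet> v = 1" using v by (simp add: norm_eq_1)
  have q: "?q u \<le> c * (u \<bullet> u)" if "u \<in> S" for u
  proof (cases "u = 0")
    case False
    have "?q (u /\<^sub>R norm u) \<le> c"
      unfolding c_def using False that by (intro max subspace_scale[OF S(1)]) auto
    then have "?q u / (norm u)\<^sup>2 \<le> c"
      using False by (simp add: linear_scale[OF H(1)] power2_eq_square divide_inverse mult_ac)
    then show ?thesis using False by (simp add: divide_le_eq power2_norm_eq_inner)
  qed (simp add: linear_0[OF H(1)])
  define z where "z = H v - c *\<^sub>R v"
  have zS: "z \<in> S" using S v by (auto simp: z_def intro!: subspace_diff subspace_scale)
  have zv: "z \<bullet> v = 0" using vv by (simp add: z_def inner_diff_left inner_diff_right c_def inner_commute)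
  have "z \<bullet> z \<le> 0"
  proof (rule ccontr)
    assume "\<not> z \<bullet> z \<le> 0"
    then have zz: "z \<bullet> z > 0" by (simp only: not_le)
    \<comment> \<open>\<open>b\<close> is a positive majorant of the second-order coefficient. With
      step \<open>t = (z \<bullet> z) / b\<close> the first-order gain
      \<open>2 * t * (z \<bullet> z)\<close> exceeds the second-order loss, at most
      \<open>t * (z \<bullet> z)\<close>.\<close>
    define b where "b = \<bar>c * (z \<bullet> z) - ?q z\<bar> + 1"
    have b: "b > 0" by (simp add: b_def)
    define t where "t = (z \<bullet> z) / b"
    have t: "t > 0" using zz b by (simp add: t_def)
    have vH: "v \<bullet> H z = z \<bullet> z" "z \<bullet> H v = z \<bullet> z"
      using zv H(2)[of v z] by (simp_all add: z_def inner_diff_left inner_diff_right inner_commute algebra_simps)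
    have "v + t *\<^sub>R z \<in> S" using v zS S(1) by (simp add: subspace_add subspace_scale)
    from q[OF this] have "c + 2 * t * (z \<bullet> z) + t\<^sup>2 * ?q z \<le> c + t\<^sup>2 * c * (z \<bullet> z)"
      using zv vv vH by (simp add: linear_add[OF H(1)] linear_scale[OF H(1)] inner_add_left inner_add_right
          inner_commute[of v z] c_def[symmetric] power2_eq_square algebra_simps)
    then have "2 * t * (z \<bullet> z) \<le> t\<^sup>2 * (c * (z \<bullet> z) - ?q z)" by (simp add: algebra_simps)
    also have "\<dots> \<le> t\<^sup>2 * b" by (intro mult_left_mono) (auto simp: b_def)
    also have "\<dots> = t * (z \<bullet> z)" using b by (simp add: t_def power2_eq_square)
    finally show False using t zz by simp
  qed
  then have "z = 0" by (metis inner_ge_zero inner_eq_zero_iff order_antisym)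
  then show ?thesis using that v by (simp add: z_def)
qed

lemma orthonormal_insert:
  assumes "orthonormal B" "norm v = 1" "\<And>b. b \<in> B \<Longrightarrow> v \<bullet> b = 0"
  shows "orthonormal (insert v B)" "v \<notin> B"
  using assms by (auto simp: orthonormal_def norm_eq_1 inner_commute)

text \<open>By self-adjointness the orthogonal complement within \<open>S\<close> of an eigenvector
  is again invariant, so eigenvectors can be split off one by one.\<close>

lemma self_adjoint_eigenbasis:
  fixes H :: "'a::euclidean_space \<Rightarrow> 'a"
  assumes H: "linear H" "\<And>u v. H u \<bullet> v = u \<bullet> H v"
    and S: "subspace S" "H ` S \<subseteq> S"
  obtains B where "orthonormal B" "span B = S" "\<forall>b\<in>B. \<exists>c. H b = c *\<^sub>R b"
proof -
  have "\<exists>B. orthonormal B \<and> span B = S \<and> (\<forall>b\<in>B. \<exists>c. H b = c *\<^sub>R b)"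
    using S
  proof (induction "dim S" arbitrary: S)
    case 0
    then have "S = {0}" using subspace_0 by (metis dim_eq_0 singletonD subset_antisym subset_singletonD empty_iff)
    then show ?case by (intro exI[of _ "{}"]) (simp add: orthonormal_def)
  next
    case (Suc n)
    obtain v c where v: "v \<in> S" "norm v = 1" "H v = c *\<^sub>R v"
      using self_adjoint_eigenvector[OF H Suc(3,4)] Suc(2) by (metis zero_less_Suc)
    define S' where "S' = {y \<in> S. v \<bullet> y = 0}"
    have S': "subspace S'"
      using Suc(3) by (auto simp: S'_def subspace_def inner_add_right)
    have "H y \<in> S'" if "y \<in> S'" for y
      using that Suc(4) v H(2)[of v y] by (auto simp: S'_def)
    then have HS': "H ` S' \<subseteq> S'" by blast
    have vv: "v \<bullet> v = 1" using v by (simp add: norm_eq_1)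
    have spv: "span {v} \<subseteq> S" using v Suc(3) by (simp add: span_minimal)
    have "S' = {y \<in> S. \<forall>x\<in>span {v}. orthogonal x y}"
      by (auto simp: S'_def orthogonal_def span_singleton)
    moreover have "v \<noteq> 0" using v by auto
    ultimately have "dim S' + 1 = dim S"
      using dim_subspace_orthogonal_to_vectors[OF subspace_span Suc(3) spv] by simp
    then have "n = dim S'" using Suc(2) by simp
    then obtain B where B: "orthonormal B" "span B = S'" "\<forall>b\<in>B. \<exists>c. H b = c *\<^sub>R b"
      using Suc(1) S' HS' by blast
    have "v \<bullet> b = 0" if "b \<in> B" for b
      using B(2) span_base[OF that] by (auto simp: S'_def)
    then have on: "orthonormal (insert v B)" using orthonormal_insert[OF B(1) v(2)] by blast
    have "span (insert v B) \<subseteq> S"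
      using v B(2) span_superset[of B] Suc(3) by (intro span_minimal) (auto simp: S'_def)
    moreover have "y \<in> span (insert v B)" if "y \<in> S" for y
    proof -
      have "y - (v \<bullet> y) *\<^sub>R v \<in> S'"
        using that v vv Suc(3) by (simp add: S'_def subspace_diff subspace_scale inner_diff_right)
      then have "y - (v \<bullet> y) *\<^sub>R v \<in> span (insert v B)"
        using B(2) span_mono[of B "insert v B"] by blast
      then have "y - (v \<bullet> y) *\<^sub>R v + (v \<bullet> y) *\<^sub>R v \<in> span (insert v B)"
        by (intro span_add span_scale) (auto intro: span_base)
      then show ?thesis by simp
    qed
    ultimately have "span (insert v B) = S" by blast
    then show ?case using on B(3) v(3) by (intro exI[of _ "insert v B"]) auto
  qed
  then show ?thesis using that by blast
qed

lemma linear_blinfun_apply: "linear (blinfun_apply A)"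
  by (rule bounded_linear.linear[OF blinfun.bounded_linear_right])

text \<open>The eigenvalue belonging to a unit eigenvector \<open>b\<close> of the Gram operator is
  \<open>(norm (A b))\<^sup>2\<close>. Testing the eigenvector equation against all \<open>v\<close>
  removes the adjoint from view.\<close>

lemma gram_eigenbasis:
  fixes A :: "'a::euclidean_space \<Rightarrow>\<^sub>L 'a"
  obtains B where "orthonormal B" "span B = UNIV" "\<And>b v. b \<in> B \<Longrightarrow> A b \<bullet> A v = (norm (A b))\<^sup>2 * (b \<bullet> v)"
proof -
  have lA: "linear (blinfun_apply A)" by (rule linear_blinfun_apply)
  define H where "H = (\<lambda>v. adjoint (blinfun_apply A) (A v))"
  have Hi: "H u \<bullet> v = A u \<bullet> A v" "v \<bullet> H u = A u \<bullet> A v" for u v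
    by (simp_all add: H_def adjoint_clauses[OF lA] inner_commute)
  have "linear H" using linear_compose[OF lA adjoint_linear[OF lA]] by (simp add: H_def comp_def)
  then obtain B where B: "orthonormal B" "span B = UNIV" "\<forall>b\<in>B. \<exists>c. H b = c *\<^sub>R b"
    using self_adjoint_eigenbasis[of H UNIV] by (auto simp: Hi inner_commute)
  have "A b \<bullet> A v = (norm (A b))\<^sup>2 * (b \<bullet> v)" if b: "b \<in> B" for b v
  proof -
    obtain c where c: "H b = c *\<^sub>R b" using B(3) b by blast
    have "b \<bullet> b = 1" using B(1) b by (auto simp: orthonormal_def)
    then have "c = (norm (A b))\<^sup>2" using c Hi(1)[of b b] by (simp add: power2_norm_eq_inner)
    then show ?thesis using c Hi(1)[of b v] by simp
  qed
  then show ?thesis using that B by blast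
qed

text \<open>The eigenspace for \<open>c\<close> is spanned by those \<open>b\<close> with
  \<open>(norm (A b))\<^sup>2 = c\<close>, so its dimension counts them, and this count is the
  multiplicity prescribed by the definition.\<close>

lemma singular_value_mset_eigenbasis:
  fixes A :: "'a::euclidean_space \<Rightarrow>\<^sub>L 'a"
  assumes B: "orthonormal B" "span B = UNIV" and e: "\<And>b v. b \<in> B \<Longrightarrow> A b \<bullet> A v = (norm (A b))\<^sup>2 * (b \<bullet> v)"
  shows "singular_value_mset A = image_mset (\<lambda>b. norm (A b)) (mset_set B)"
proof -
  have lA: "linear (blinfun_apply A)" by (rule linear_blinfun_apply)
  have fB: "finite B" using B by (simp add: orthonormal_def)
  have iB: "\<And>b b'. b \<in> B \<Longrightarrow> b' \<in> B \<Longrightarrow> b \<bullet> b' = (if b = b' then 1 else 0)"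
    using B by (simp add: orthonormal_def)
  define C where "C = (\<lambda>c. {b\<in>B. (norm (A b))\<^sup>2 = c})"
  have CB: "C c \<subseteq> B" for c by (auto simp: C_def)
  have indC: "independent (C c)" for c
    using orthonormal_independent[OF B(1)] CB independent_mono by blast
  have mem: "v \<in> gram_eigenspace A c \<longleftrightarrow> (\<forall>w. A v \<bullet> A w = c * (v \<bullet> w))" for v c
  proof -
    have "v \<in> gram_eigenspace A c \<longleftrightarrow> (\<forall>w. adjoint (blinfun_apply A) (A v) \<bullet> w = (c *\<^sub>R v) \<bullet> w)"
      unfolding gram_eigenspace_def by (auto intro: vector_eq_rdot[THEN iffD1])
    then show ?thesis by (simp add: adjoint_clauses[OF lA])
  qed
  have eig: "gram_eigenspace A c = span (C c)" for c
  proof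
    show "span (C c) \<subseteq> gram_eigenspace A c"
    proof (rule span_minimal)
      show "C c \<subseteq> gram_eigenspace A c" using e by (auto simp: mem C_def)
      show "subspace (gram_eigenspace A c)"
        by (auto simp: subspace_def mem blinfun.zero_right blinfun.add_right blinfun.scaleR_right
            inner_add_left algebra_simps)
    qed
    show "gram_eigenspace A c \<subseteq> span (C c)"
    proof
      fix v assume v: "v \<in> gram_eigenspace A c"
      have "v \<bullet> b = 0" if "b \<in> B" "b \<notin> C c" for b
      proof -
        have "c * (v \<bullet> b) = (norm (A b))\<^sup>2 * (v \<bullet> b)"
          using v e[OF that(1), of v] unfolding mem by (metis inner_commute)
        then show ?thesis using that by (auto simp: C_def)
      qed
      then have "(\<Sum>b\<in>B. (v \<bullet> b) *\<^sub>R b) = (\<Sum>b\<in>C c. (v \<bullet> b) *\<^sub>R b)"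
        using fB CB by (intro sum.mono_neutral_right) auto
      moreover have "(\<Sum>b\<in>B. (v \<bullet> b) *\<^sub>R b) = v"
        using B fB by (intro orthonormal_basis_expand) (auto simp: orthonormal_eq)
      ultimately show "v \<in> span (C c)" by (metis (mono_tags, lifting) span_sum span_scale span_base)
    qed
  qed
  have dimC: "dim (gram_eigenspace A c) = card (C c)" for c
    unfolding eig using indC by (simp add: dim_eq_card_independent)
  have "b \<noteq> 0" if "b \<in> B" for b using iB[OF that that] by auto
  then have ne: "gram_eigenspace A c \<noteq> {0} \<longleftrightarrow> C c \<noteq> {}" for c
    unfolding eig using CB[of c] by (metis insertI1 singletonD span_base span_empty subset_iff ex_in_conv)
  have E: "{c. gram_eigenspace A c \<noteq> {0}} = (\<lambda>b. (norm (A b))\<^sup>2) ` B"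
    unfolding ne by (auto simp: C_def)
  have "count (singular_value_mset A) r = count (image_mset (\<lambda>b. norm (A b)) (mset_set B)) r" for r
  proof -
    have "count (singular_value_mset A) r
        = (\<Sum>c\<in>(\<lambda>b. (norm (A b))\<^sup>2) ` B. if sqrt c = r then card (C c) else 0)"
      unfolding singular_value_mset_def E by (simp add: count_sum dimC eq_commute)
    also have "\<dots> = (\<Sum>c\<in>(\<lambda>b. (norm (A b))\<^sup>2) ` B. \<Sum>b\<in>C c. if norm (A b) = r then 1 else 0)"
      by (intro sum.cong) (auto simp: C_def intro!: sum.neutral)
    also have "\<dots> = (\<Sum>b\<in>B. if norm (A b) = r then 1 else 0)"
      unfolding C_def by (rule sum.image_gen[symmetric, OF fB])
    also have "\<dots> = card {b \<in> B. norm (A b) = r}" using fB by (simp add: sum.If_cases Int_def)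
    also have "\<dots> = count (image_mset (\<lambda>b. norm (A b)) (mset_set B)) r"
      using fB by (simp add: count_image_mset vimage_def Int_def conj_commute)
    finally show ?thesis .
  qed
  then show ?thesis by (rule multiset_eqI)
qed

text \<open>Sorting the eigenbasis itself by \<open>norm (A b)\<close> makes the reversed list of
  vectors run parallel to the list of singular values, ties included.\<close>

lemma singular_value_decomposition:
  fixes A :: "'a::euclidean_space \<Rightarrow>\<^sub>L 'a"
  obtains b :: "nat \<Rightarrow> 'a" where
    "\<And>i j. i \<in> {1..DIM('a)} \<Longrightarrow> j \<in> {1..DIM('a)} \<Longrightarrow> b i \<bullet> b j = (if i = j then 1 else 0)"
    "span (b ` {1..DIM('a)}) = UNIV"
    "\<And>i v. i \<in> {1..DIM('a)} \<Longrightarrow> A (b i) \<bullet> A v = (singular_value A i)\<^sup>2 * (b i \<bullet> v)"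
    "\<And>i. i \<in> {1..DIM('a)} \<Longrightarrow> 0 \<le> singular_value A i"
    "\<And>i j. 1 \<le> i \<Longrightarrow> i \<le> j \<Longrightarrow> j \<le> DIM('a) \<Longrightarrow> singular_value A j \<le> singular_value A i"
proof -
  obtain B where B: "orthonormal B" "span B = UNIV" "\<And>b v. b \<in> B \<Longrightarrow> A b \<bullet> A v = (norm (A b))\<^sup>2 * (b \<bullet> v)"
    using gram_eigenbasis[of A] by blast
  have fB: "finite B" using B by (simp add: orthonormal_def)
  have cB: "card B = DIM('a)"
    using orthonormal_independent[OF B(1)] B(2) by (metis dim_UNIV dim_span dim_eq_card_independent)
  obtain xs where xs: "set xs = B" "distinct xs" using finite_distinct_list[OF fB] by auto
  define ys where "ys = sort_key (\<lambda>b. norm (A b)) xs"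
  define zs where "zs = rev ys"
  have zs: "set zs = B" "distinct zs" "length zs = DIM('a)"
    using xs cB distinct_card[OF xs(2)] by (simp_all add: zs_def ys_def)
  have "mset_set B = mset ys" using xs by (metis mset_set_set mset_sort ys_def)
  then have "singular_value_mset A = mset (map (\<lambda>b. norm (A b)) ys)"
    using singular_value_mset_eigenbasis[OF B] by simp
  moreover have "sorted (map (\<lambda>b. norm (A b)) ys)" by (simp add: ys_def)
  ultimately have "sorted_list_of_multiset (singular_value_mset A) = map (\<lambda>b. norm (A b)) ys"
    by (metis sorted_list_of_multiset_mset sorted_sort_id)
  then have sv: "singular_value A i = norm (A (zs ! (i - 1)))" if "i \<in> {1..DIM('a)}" for i
    using that zs(3) unfolding singular_value_def
    by (simp add: rev_map zs_def) (metis One_nat_def Suc_le_eq Suc_pred length_rev less_eq_Suc_le nth_map zs_def)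
  define b where "b = (\<lambda>i. zs ! (i - 1))"
  have bB: "b i \<in> B" if "i \<in> {1..DIM('a)}" for i
    using that zs by (auto simp: b_def)
  have inj: "b i = b j \<longleftrightarrow> i = j" if "i \<in> {1..DIM('a)}" "j \<in> {1..DIM('a)}" for i j
    using that zs by (auto simp: b_def nth_eq_iff_index_eq)
  have "b ` {1..DIM('a)} = B"
  proof -
    have "x \<in> b ` {1..DIM('a)}" if x: "x \<in> B" for x
    proof -
      obtain i where "i < length zs" "x = zs ! i" using x zs(1) by (metis in_set_conv_nth)
      then show ?thesis using zs(3) by (intro image_eqI[of _ _ "Suc i"]) (auto simp: b_def)
    qed
    then show ?thesis using bB by blast
  qed
  moreover have "singular_value A j \<le> singular_value A i" if "1 \<le> i" "i \<le> j" "j \<le> DIM('a)" for i j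
  proof -
    have "sorted (rev (map (\<lambda>b. norm (A b)) zs))" by (simp add: rev_map zs_def ys_def)
    then show ?thesis using that sv[of i] sv[of j] zs(3)
      by (auto simp: sorted_rev_iff_nth_mono)
  qed
  moreover have "singular_value A i = norm (A (b i))" if "i \<in> {1..DIM('a)}" for i
    using sv[OF that] by (simp add: b_def)
  ultimately show ?thesis
    using that[of b] B bB inj by (auto simp: orthonormal_def)
qed

lemma singular_value_antimono:
  fixes A :: "'a::euclidean_space \<Rightarrow>\<^sub>L 'a"
  assumes "1 \<le> i" "i \<le> j" "j \<le> DIM('a)"
  shows "singular_value A j \<le> singular_value A i"
  using assms singular_value_decomposition[of A] by metis

lemma singular_value_pos:
  fixes A :: "'a::euclidean_space \<Rightarrow>\<^sub>L 'a"
  assumes "bij (blinfun_apply A)" and i: "i \<in> {1..DIM('a)}"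
  shows "0 < singular_value A i"
proof -
  obtain b :: "nat \<Rightarrow> 'a" where b:
    "\<And>i j. i \<in> {1..DIM('a)} \<Longrightarrow> j \<in> {1..DIM('a)} \<Longrightarrow> b i \<bullet> b j = (if i = j then 1 else 0)"
    "\<And>i v. i \<in> {1..DIM('a)} \<Longrightarrow> A (b i) \<bullet> A v = (singular_value A i)\<^sup>2 * (b i \<bullet> v)"
    "\<And>i. i \<in> {1..DIM('a)} \<Longrightarrow> 0 \<le> singular_value A i"
    using singular_value_decomposition[of A] by metis
  have "b i \<noteq> 0" using b(1)[OF i i] by auto
  then have "A (b i) \<noteq> 0" using assms(1) by (metis bij_is_inj blinfun.zero_right injD)
  then show ?thesis using b(1)[OF i i] b(2)[OF i, of "b i"] b(3)[OF i] by (auto simp: order_less_le)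
qed

lemma span_insert_span: "span (insert a (span X)) = span (insert a X)"
  for a :: "'a::real_vector"
proof (rule subset_antisym)
  have "span X \<subseteq> span (insert a X)" by (rule span_mono) auto
  then have "insert a (span X) \<subseteq> span (insert a X)" using span_base[of a "insert a X"] by simp
  then show "span (insert a (span X)) \<subseteq> span (insert a X)" by (rule span_minimal[OF _ subspace_span])
  show "span (insert a X) \<subseteq> span (insert a (span X))"
    by (rule span_mono) (rule insert_mono[OF span_superset])
qed

text \<open>The upper bound \<open>t\<close> is left free because \<open>k\<close> may equal the
  full dimension, where there is no next singular value; this is needed when the lemma is applied
  one index higher to bound the cocycle on F.\<close>

lemma exists_singular_split:
  fixes A :: "'a::euclidean_space \<Rightarrow>\<^sub>L 'a"
  assumes bA: "bij (blinfun_apply A)" and k: "1 \<le> k" "k \<le> DIM('a)"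
    and t: "k < DIM('a) \<Longrightarrow> singular_value A (k + 1) \<le> t" "0 \<le> t"
  obtains W where "subspace W" "dim W = k" "singular_split A W (singular_value A k) t"
    "abs_det_on W A = (\<Prod>i=1..k. singular_value A i)"
proof -
  let ?I = "{1..DIM('a)}" and ?\<sigma> = "singular_value A"
  have lA: "linear (blinfun_apply A)" by (rule linear_blinfun_apply)
  obtain b :: "nat \<Rightarrow> 'a" where
    bb: "\<And>i j. i \<in> ?I \<Longrightarrow> j \<in> ?I \<Longrightarrow> b i \<bullet> b j = (if i = j then 1 else 0)" and
    sp: "span (b ` ?I) = UNIV" and
    Ab: "\<And>i v. i \<in> ?I \<Longrightarrow> A (b i) \<bullet> A v = (?\<sigma> i)\<^sup>2 * (b i \<bullet> v)" and
    pos: "\<And>i. i \<in> ?I \<Longrightarrow> 0 \<le> ?\<sigma> i" and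
    mono: "\<And>i j. 1 \<le> i \<Longrightarrow> i \<le> j \<Longrightarrow> j \<le> DIM('a) \<Longrightarrow> ?\<sigma> j \<le> ?\<sigma> i"
    using singular_value_decomposition[of A] by blast
  have inj: "inj_on b ?I" by (rule inj_onI) (metis bb zero_neq_one)
  have expand: "v = (\<Sum>i\<in>?I. (v \<bullet> b i) *\<^sub>R b i)" for v
  proof -
    have "(\<Sum>c\<in>b ` ?I. (v \<bullet> c) *\<^sub>R c) = v"
      using bb sp by (intro orthonormal_basis_expand) (auto simp: pairwise_def orthogonal_def norm_eq_1)
    then show ?thesis unfolding sum.reindex[OF inj] o_def by (rule sym)
  qed
  have inner: "u \<bullet> v = (\<Sum>i\<in>?I. (u \<bullet> b i) * (v \<bullet> b i))" for u v
    by (subst (1) expand[of u]) (simp add: inner_sum_left inner_commute[of v])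
  have Ainner: "A u \<bullet> A v = (\<Sum>i\<in>?I. (?\<sigma> i)\<^sup>2 * ((u \<bullet> b i) * (v \<bullet> b i)))" for u v
    by (subst (1) expand[of u])
       (simp add: blinfun.sum_right blinfun.scaleR_right inner_sum_left Ab,
        simp add: inner_commute[of v] mult_ac)
  define V where "V = (\<lambda>j. span (b ` {1..j}))"
  have V: "subspace (V j)" for j by (simp add: V_def)
  have bV: "b i \<in> V j" if "1 \<le> i" "i \<le> j" for i j
    using that by (auto simp: V_def intro: span_base)
  have V0: "v \<bullet> b i = 0" if "v \<in> V j" "j < i" "i \<in> ?I" for v i j
    using that(1) unfolding V_def
  proof (induction rule: span_induct_alt)
    case (step c x y)
    then show ?case using bb that(2,3) by (auto simp: inner_add_left)
  qed simp
  have dimV: "dim (V j) = j" if "j \<le> DIM('a)" for j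
  proof -
    have s: "{1..j} \<subseteq> ?I" using that by auto
    have "orthonormal (b ` {1..j})" using s bb by (auto simp: orthonormal_def inj_on_eq_iff[OF inj] subset_iff)
    then have "dim (V j) = card (b ` {1..j})"
      using dim_eq_card_independent[OF orthonormal_independent] by (simp add: V_def)
    also have "\<dots> = j" using card_image[OF inj_on_subset[OF inj s]] by simp
    finally show ?thesis .
  qed
  define W where "W = V k"
  have Wb: "v \<bullet> b i = 0" if "v \<in> W\<^sup>\<bottom>" "1 \<le> i" "i \<le> k" for v i
    using orthogonal_compD(1)[OF that(1)] bV[OF that(2,3)] by (simp add: W_def)
  have s: "?\<sigma> k * norm w \<le> norm (A w)" if "w \<in> W" for w
  proof (rule power2_le_imp_le)
    have "(?\<sigma> k)\<^sup>2 * ((w \<bullet> b i) * (w \<bullet> b i)) \<le> (?\<sigma> i)\<^sup>2 * ((w \<bullet> b i) * (w \<bullet> b i))" if i: "i \<in> ?I" for i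
    proof (cases "i \<le> k")
      case True
      then show ?thesis using mono[of i k] pos[of k] k i by (intro mult_right_mono power_mono) auto
    next
      case False
      then show ?thesis using V0[of w k i] i \<open>w \<in> W\<close> by (simp add: W_def)
    qed
    then show "(?\<sigma> k * norm w)\<^sup>2 \<le> (norm (A w))\<^sup>2"
      unfolding power_mult_distrib power2_norm_eq_inner Ainner[of w w] inner[of w w] sum_distrib_left
      by (rule sum_mono)
  qed simp
  have tb: "norm (A v) \<le> t * norm v" if "v \<in> W\<^sup>\<bottom>" for v
  proof (rule power2_le_imp_le)
    have "(?\<sigma> i)\<^sup>2 * ((v \<bullet> b i) * (v \<bullet> b i)) \<le> t\<^sup>2 * ((v \<bullet> b i) * (v \<bullet> b i))" if i: "i \<in> ?I" for i
    proof (cases "i \<le> k")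
      case True
      then show ?thesis using Wb[OF \<open>v \<in> W\<^sup>\<bottom>\<close>] i by simp
    next
      case False
      then have "?\<sigma> i \<le> t" using mono[of "k + 1" i] t i by auto
      then show ?thesis using pos[OF i] by (intro mult_right_mono power_mono) auto
    qed
    then show "(norm (A v))\<^sup>2 \<le> (t * norm v)\<^sup>2"
      unfolding power_mult_distrib power2_norm_eq_inner Ainner[of v v] inner[of v v] sum_distrib_left
      by (rule sum_mono)
  qed (simp add: t)
  have o: "A w \<bullet> A v = 0" if "w \<in> W" "v \<in> W\<^sup>\<bottom>" for w v
    unfolding Ainner[of w v]
  proof (intro sum.neutral ballI)
    fix i assume i: "i \<in> ?I"
    show "(?\<sigma> i)\<^sup>2 * ((w \<bullet> b i) * (v \<bullet> b i)) = 0"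
      using V0[of w k i] Wb[OF that(2), of i] that(1) i by (cases "i \<le> k") (auto simp: W_def)
  qed
  have "b k \<in> W" "b k \<noteq> 0" using bV[of k k] bb[of k k] k by (auto simp: W_def)
  then have split: "singular_split A W (?\<sigma> k) t"
    unfolding singular_split_def using s tb o Ab[of k] k by (auto simp: W_def V)
  \<comment> \<open>Images of distinct right singular vectors are orthogonal, so the height added by
    \<open>b (Suc j)\<close> is its own singular value.\<close>
  have "abs_det_on (V j) A = (\<Prod>i=1..j. ?\<sigma> i)" if "j \<le> DIM('a)" for j
    using that
  proof (induction j)
    case 0
    then show ?case using abs_det_on_trivial[OF lA] by (simp add: V_def)
  next
    case (Suc j)
    have S: "Suc j \<in> ?I" using Suc by simp
    have f: "b (Suc j) \<in> (V j)\<^sup>\<bottom>" "norm (b (Suc j)) = 1"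
      using V0[of _ j "Suc j"] S bb[OF S S] by (auto simp: mem_orthogonal_comp inner_commute norm_eq_1)
    have sp: "span (insert (b (Suc j)) (V j)) = V (Suc j)"
      unfolding V_def by (simp add: atLeastAtMostSuc_conv span_insert_span)
    obtain e where e: "e \<in> V j" "abs_det_on (V (Suc j)) A = abs_det_on (V j) A * norm (A (b (Suc j)) - A e)"
      "\<And>u. u \<in> V j \<Longrightarrow> (A (b (Suc j)) - A e) \<bullet> A u = 0"
      using abs_det_on_insert[OF V f lA inj_on_bij[OF bA]] unfolding sp by metis
    have "A (b (Suc j)) \<bullet> A e = 0" using Ab[OF S, of e] orthogonal_compD(1)[OF f(1) e(1)] by simp
    then have "A e = 0" using e(3)[OF e(1)] by (simp add: inner_diff_left)
    moreover have "norm (A (b (Suc j))) = ?\<sigma> (Suc j)"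
      using Ab[OF S, of "b (Suc j)"] bb[OF S S] pos[OF S] by (simp add: norm_eq_sqrt_inner)
    ultimately show ?case using e(2) Suc by simp
  qed
  then show ?thesis using that[OF _ _ split] dimV[of k] k by (simp add: W_def V)
qed

subsection \<open>Limits of leading singular subspaces\<close>

text \<open>Courant-Fischer: the complement of \<open>W\<close> together with the singular vector
  for \<open>s\<close> has dimension one more than the codimension of \<open>W\<close>, so it meets
  every \<open>S\<close> of the dimension of \<open>W\<close>, and on it \<open>A\<close> expands by
  at most \<open>s\<close>.\<close>

lemma singular_split_minmax:
  fixes A :: "'a::euclidean_space \<Rightarrow> 'a"
  assumes A: "linear A" and sp: "singular_split A W s t" and t: "0 \<le> t" "t \<le> s"
    and S: "subspace S" "dim S = dim W"
  obtains v where "v \<in> S" "v \<noteq> 0" "norm (A v) \<le> s * norm v"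
proof -
  have W: "subspace W" and Wt: "\<And>v. v \<in> W\<^sup>\<bottom> \<Longrightarrow> norm (A v) \<le> t * norm v"
    using sp by (auto simp: singular_split_def)
  obtain w where w: "w \<in> W" "w \<noteq> 0" "\<And>v. A w \<bullet> A v = s\<^sup>2 * (w \<bullet> v)"
    using sp by (auto simp: singular_split_def)
  let ?V = "span (insert w (W\<^sup>\<bottom>))"
  have "w \<notin> W\<^sup>\<bottom>" using w orthogonal_compD(1)[of w W w] by auto
  then have "w \<notin> span (W\<^sup>\<bottom>)" by (metis span_eq_iff subspace_orthogonal_comp)
  then have "dim ?V = Suc (dim (W\<^sup>\<bottom>))" by (simp add: dim_insert)
  then have "dim S + dim ?V > DIM('a)" using S(2) dim_orthogonal_comp[OF W] by simp
  then obtain v where v: "v \<in> S" "v \<in> ?V" "v \<noteq> 0" using subspaces_meet[OF S(1) subspace_span] by metis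
  obtain c where c: "v - c *\<^sub>R w \<in> W\<^sup>\<bottom>"
    using v(2) span_breakdown_eq[of v w "W\<^sup>\<bottom>"] by (metis span_eq_iff subspace_orthogonal_comp)
  define u where "u = v - c *\<^sub>R w"
  have v': "v = c *\<^sub>R w + u" by (simp add: u_def)
  have u: "u \<in> W\<^sup>\<bottom>" using c by (simp add: u_def)
  have wu: "w \<bullet> u = 0" by (rule orthogonal_compD(2)[OF u w(1)])
  have "norm (A u) \<le> s * norm u" using Wt[OF u] t mult_right_mono[of t s "norm u"] by auto
  then have Au: "(norm (A u))\<^sup>2 \<le> s\<^sup>2 * (norm u)\<^sup>2" by (metis norm_ge_zero power_mono power_mult_distrib)
  have Aw: "(norm (A w))\<^sup>2 = s\<^sup>2 * (norm w)\<^sup>2" using w(3)[of w] by (simp add: power2_norm_eq_inner)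
  have "(norm (A v))\<^sup>2 = (norm (c *\<^sub>R A w))\<^sup>2 + (norm (A u))\<^sup>2"
    unfolding v' using w(3)[of u] wu
    by (subst norm_add_orth_sq[symmetric]) (simp_all add: linear_add[OF A] linear_scale[OF A])
  also have "\<dots> \<le> s\<^sup>2 * ((norm (c *\<^sub>R w))\<^sup>2 + (norm u)\<^sup>2)"
    using Au Aw by (simp add: power_mult_distrib distrib_left)
  also have "(norm (c *\<^sub>R w))\<^sup>2 + (norm u)\<^sup>2 = (norm v)\<^sup>2"
    unfolding v' using wu by (subst norm_add_orth_sq) simp_all
  finally have "(norm (A v))\<^sup>2 \<le> (s * norm v)\<^sup>2" by (simp add: power_mult_distrib)
  then have "norm (A v) \<le> s * norm v" by (rule power2_le_imp_le) (use t in simp)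
  then show ?thesis using that v by blast
qed

text \<open>Replacing \<open>v\<close> by its projection to \<open>W\<close> changes
  \<open>B v\<close> by at most t |v|, while \<open>B v\<close> itself has length at least c
  |v|.\<close>

lemma singular_split_image_near:
  fixes B :: "'a::euclidean_space \<Rightarrow> 'a"
  assumes B: "linear B" and sp: "singular_split B W s t" and t: "0 \<le> t" and c: "0 < c"
    and S: "\<And>v. v \<in> S \<Longrightarrow> c * norm v \<le> norm (B v)"
  shows "near (t / c) (B ` S) (B ` W)"
  unfolding near_def
proof
  fix y assume "y \<in> B ` S"
  then obtain v where v: "v \<in> S" "y = B v" by auto
  have W: "subspace W" and Wt: "\<And>v. v \<in> W\<^sup>\<bottom> \<Longrightarrow> norm (B v) \<le> t * norm v"
    using sp by (auto simp: singular_split_def)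
  have "norm (y - closest_point (B ` W) y) \<le> norm (y - B (closest_point W v))"
    by (intro norm_diff_closest_point_min linear_subspace_image B W imageI closest_point_in_subspace)
  also have "\<dots> = norm (B (v - closest_point W v))" using v by (simp add: linear_diff[OF B])
  also have "\<dots> \<le> t * norm (v - closest_point W v)" by (rule Wt[OF diff_closest_point_orth[OF W]])
  also have "\<dots> \<le> t * norm v" by (intro mult_left_mono norm_diff_closest_point_le W t)
  also have "\<dots> \<le> t * (norm y / c)" using S[OF v(1)] v(2) c t by (intro mult_left_mono) (auto simp: field_simps)
  finally show "norm (y - closest_point (B ` W) y) \<le> t / c * norm y" by simp
qed

text \<open>Left singular vectors of \<open>A\<close> are right singular vectors of the adjoint,
  with the same singular values, so domination passes to the adjoint cocycle without computing
  anything anew. The second claim lets the spaces of right singular vectors of \<open>A\<close>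
  appear as images under the adjoint.\<close>

lemma singular_split_adjoint:
  fixes A :: "'a::euclidean_space \<Rightarrow> 'a"
  assumes A: "linear A" and sp: "singular_split A W s t" and s: "0 < s" and t: "0 \<le> t"
  shows "singular_split (adjoint A) (A ` W) s t" "adjoint A ` A ` W = W"
proof -
  let ?A = "adjoint A"
  have W: "subspace W" and Ws: "\<And>w. w \<in> W \<Longrightarrow> s * norm w \<le> norm (A w)"
    and Wt: "\<And>v. v \<in> W\<^sup>\<bottom> \<Longrightarrow> norm (A v) \<le> t * norm v"
    and Wo: "\<And>w v. w \<in> W \<Longrightarrow> v \<in> W\<^sup>\<bottom> \<Longrightarrow> A w \<bullet> A v = 0"
    using sp by (auto simp: singular_split_def)
  note adj = adjoint_clauses[OF A]
  have lA: "linear ?A" by (rule adjoint_linear[OF A])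
  have 1: "s * norm (A w) \<le> norm (?A (A w))" if "w \<in> W" for w
  proof (cases "w = 0")
    case False
    have "s * norm w * norm (A w) \<le> norm (A w) * norm (A w)"
      using Ws[OF that] by (rule mult_right_mono) simp
    also have "\<dots> = ?A (A w) \<bullet> w" using adj(2)[of "A w" w] by (simp add: power2_eq_square[symmetric] power2_norm_eq_inner)
    also have "\<dots> \<le> norm (?A (A w)) * norm w" by (rule norm_cauchy_schwarz)
    finally have "(s * norm (A w)) * norm w \<le> norm (?A (A w)) * norm w" by (simp add: mult_ac)
    then show ?thesis using False by simp
  qed (simp add: linear_0[OF A] linear_0[OF lA])
  have 2: "?A v \<in> W\<^sup>\<bottom>" if "v \<in> (A ` W)\<^sup>\<bottom>" for v
    unfolding mem_orthogonal_comp using orthogonal_compD(1)[OF that] by (simp add: adj)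
  have 3: "norm (?A v) \<le> t * norm v" if "v \<in> (A ` W)\<^sup>\<bottom>" for v
  proof (cases "?A v = 0")
    case False
    have "norm (?A v) * norm (?A v) = v \<bullet> A (?A v)"
      using adj(2)[of v "?A v"] by (simp add: power2_eq_square[symmetric] power2_norm_eq_inner)
    also have "\<dots> \<le> norm v * norm (A (?A v))" by (rule norm_cauchy_schwarz)
    also have "\<dots> \<le> norm v * (t * norm (?A v))" by (intro mult_left_mono Wt 2 that) simp
    finally have "norm (?A v) * norm (?A v) \<le> (t * norm v) * norm (?A v)" by (simp add: mult_ac)
    then show ?thesis using False by simp
  next
    case True
    then show ?thesis using t by simp
  qed
  have 4: "?A (A w) \<bullet> ?A v = 0" if "w \<in> W" "v \<in> (A ` W)\<^sup>\<bottom>" for w v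
    using Wo[OF that(1) 2[OF that(2)]] by (simp only: adj(2))
  obtain w where w: "w \<in> W" "w \<noteq> 0" "\<And>v. A w \<bullet> A v = s\<^sup>2 * (w \<bullet> v)"
    using sp by (auto simp: singular_split_def)
  have "A w \<noteq> 0" using Ws[OF w(1)] w(2) s by (auto simp: mult_le_0_iff)
  moreover have "?A (A w) \<bullet> ?A v = s\<^sup>2 * (A w \<bullet> v)" for v
    using w(3)[of "?A v"] by (simp only: adj(2)) (simp only: adj(1))
  ultimately show "singular_split ?A (A ` W) s t"
    unfolding singular_split_def using linear_subspace_image[OF A W] 1 3 4 w(1) by auto
  have "?A (A w) \<in> W" if "w \<in> W" for w
  proof -
    have "?A (A w) \<in> W\<^sup>\<bottom>\<^sup>\<bottom>"
      unfolding mem_orthogonal_comp[of _ "W\<^sup>\<bottom>"] using Wo[OF that] by (simp add: adj)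
    then show ?thesis using orthogonal_comp_self[OF W] by simp
  qed
  then have sub: "?A ` A ` W \<subseteq> W" by auto
  have lAA: "linear (?A \<circ> A)" by (rule linear_compose[OF A lA])
  have "w = 0" if "w \<in> W" "(?A \<circ> A) w = 0" for w
  proof -
    have "norm (A w) \<le> 0" using that(2) 1[OF that(1)] s by (simp add: mult_le_0_iff)
    then have "s * norm w \<le> 0" using Ws[OF that(1)] by simp
    then show ?thesis using s by (simp add: mult_le_0_iff)
  qed
  then have "inj_on (?A \<circ> A) W" using linear_injective_on_subspace_0[OF lAA W] by blast
  then have "inj_on (?A \<circ> A) (span W)" using W by (metis span_eq_iff)
  then have "dim ((?A \<circ> A) ` W) = dim W" by (rule dim_image_eq[OF lAA])
  then have "dim (?A ` A ` W) = dim W" by (simp add: image_comp)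
  then show "?A ` A ` W = W"
    using subspace_dim_equal[OF linear_subspace_image[OF lA linear_subspace_image[OF A W]] W sub] by simp
qed

text \<open>The pointwise limit of the projections is linear and self-adjoint. It is also
  idempotent, as the projections are contractions, and hence it is the orthogonal projection onto
  its range.\<close>

lemma limit_of_projections:
  fixes S :: "nat \<Rightarrow> 'a::euclidean_space set"
  assumes S: "\<And>n. subspace (S n)"
    and c: "c \<longlonglongrightarrow> 0"
    and b: "\<And>n j v. N \<le> n \<Longrightarrow> n \<le> j \<Longrightarrow> norm (closest_point (S j) v - closest_point (S n) v) \<le> c n * norm v"
  obtains E where "subspace E"
    "\<And>n v. N \<le> n \<Longrightarrow> norm (closest_point (S n) v - closest_point E v) \<le> c n * norm v"
proof -
  let ?P = "\<lambda>n. closest_point (S n)"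
  have lin: "linear (?P n)" for n by (rule linear_closest_point[OF S])
  have conv: "convergent (\<lambda>n. ?P n v)" for v
  proof (rule Cauchy_convergent, rule metric_CauchyI)
    fix e :: real assume e: "0 < e"
    have "(\<lambda>n. c n * norm v) \<longlonglongrightarrow> 0" using tendsto_mult_left_zero[OF c] by simp
    then have "eventually (\<lambda>n. c n * norm v < e / 2) sequentially" using e by (intro order_tendstoD) auto
    then obtain n0 where n0: "\<And>n. n0 \<le> n \<Longrightarrow> c n * norm v < e / 2" by (auto simp: eventually_sequentially)
    let ?n = "max N n0"
    have "dist (?P i v) (?P ?n v) < e / 2" if "?n \<le> i" for i
      using b[of ?n i v] n0[of ?n] that by (simp add: dist_norm)
    then have "dist (?P i v) (?P j v) < e" if "?n \<le> i" "?n \<le> j" for i j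
      using that dist_triangle_half_l by blast
    then show "\<exists>M. \<forall>i\<ge>M. \<forall>j\<ge>M. dist (?P i v) (?P j v) < e" by blast
  qed
  define Q where "Q = (\<lambda>v. lim (\<lambda>n. ?P n v))"
  have Q: "(\<lambda>n. ?P n v) \<longlonglongrightarrow> Q v" for v using conv by (simp add: Q_def convergent_LIMSEQ_iff)
  have linQ: "linear Q"
  proof
    fix u v :: 'a and r :: real
    show "Q (u + v) = Q u + Q v"
      by (rule LIMSEQ_unique[OF Q]) (simp add: linear_add[OF lin] tendsto_add[OF Q Q])
    show "Q (r *\<^sub>R v) = r *\<^sub>R Q v"
      by (rule LIMSEQ_unique[OF Q]) (simp add: linear_scale[OF lin] tendsto_scaleR[OF tendsto_const Q])
  qed
  have sa: "Q u \<bullet> v = u \<bullet> Q v" for u v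
    by (rule LIMSEQ_unique[OF tendsto_inner[OF Q tendsto_const]])
       (simp add: closest_point_selfadjoint[OF S] tendsto_inner[OF tendsto_const Q])
  have QP: "norm (?P n v - Q v) \<le> c n * norm v" if n: "N \<le> n" for n v
  proof (rule tendsto_upperbound)
    show "(\<lambda>j. norm (?P n v - ?P j v)) \<longlonglongrightarrow> norm (?P n v - Q v)"
      by (intro tendsto_norm tendsto_diff tendsto_const Q)
    show "\<forall>\<^sub>F j in sequentially. norm (?P n v - ?P j v) \<le> c n * norm v"
      using b[OF n] by (auto simp: eventually_sequentially norm_minus_commute intro!: exI[of _ n])
  qed simp
  have idem: "Q (Q v) = Q v" for v
  proof -
    have "(\<lambda>n. ?P n (?P n v) - ?P n (Q v)) \<longlonglongrightarrow> 0"
    proof (rule Lim_null_comparison)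
      show "\<forall>\<^sub>F n in sequentially. norm (?P n (?P n v) - ?P n (Q v)) \<le> norm (?P n v - Q v)"
        by (simp add: linear_diff[OF lin, symmetric] norm_closest_point_le[OF S])
      show "(\<lambda>n. norm (?P n v - Q v)) \<longlonglongrightarrow> 0"
        using tendsto_norm[OF tendsto_diff[OF Q tendsto_const], of v "Q v"] by simp
    qed
    moreover have "(\<lambda>n. ?P n (?P n v) - ?P n (Q v)) \<longlonglongrightarrow> Q v - Q (Q v)"
      by (simp add: closest_point_subspace_self[OF S closest_point_in_subspace[OF S]])
         (intro tendsto_diff Q)
    ultimately show ?thesis using LIMSEQ_unique by fastforce
  qed
  have sub: "subspace (range Q)" by (rule linear_subspace_image[OF linQ subspace_UNIV])
  have "closest_point (range Q) v = Q v" for v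
  proof (rule closest_point_subspace_eqI[OF sub])
    fix w assume "w \<in> range Q"
    then show "(v - Q v) \<bullet> w = 0"
      by (auto simp: sa[symmetric] linear_diff[OF linQ] idem)
  qed simp
  then show ?thesis using that[OF sub] QP by simp
qed

section \<open>Limit subspaces of dominated sequences of maps\<close>

text \<open>What the constructions of E and of the complement of F share. \<open>B x n\<close> is a
  product of \<open>n\<close> factors whose target is attached to \<open>x\<close>.
  \<open>source_step\<close> adds a factor on the right at the same \<open>x\<close> and yields
  convergence; \<open>target_step\<close> adds one on the left, moves \<open>x\<close> by
  \<open>T\<close> and yields equivariance.\<close>

locale dominated_sequences =
  fixes B :: "'x::topological_space \<Rightarrow> nat \<Rightarrow> 'a::euclidean_space \<Rightarrow> 'a"
    and W :: "'x \<Rightarrow> nat \<Rightarrow> 'a set"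
    and s t :: "'x \<Rightarrow> nat \<Rightarrow> real"
    and T :: "'x \<Rightarrow> 'x"
    and G :: "'x \<Rightarrow> 'a \<Rightarrow> 'a"
    and k :: nat
    and m M K \<tau> :: real
  assumes linear_B: "linear (B x n)"
    and split: "singular_split (B x n) (W x n) (s x n) (t x n)"
    and dim_W: "dim (W x n) = k"
    and s_pos: "0 < s x n"
    and t_bounds: "0 \<le> t x n" "t x n \<le> s x n" "t x n \<le> K * \<tau> ^ n * s x n"
    and constants: "0 < m" "m \<le> M" "0 < K" "0 < \<tau>" "\<tau> < 1"
    and source_step: "\<exists>C. linear C \<and> (\<forall>v. m * norm v \<le> norm (C v) \<and> norm (C v) \<le> M * norm v) \<and>
      (\<forall>v. B x (Suc n) v = B x n (C v))"
    and linear_G: "linear (G x)"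
    and G_bounds: "m * norm v \<le> norm (G x v)" "norm (G x v) \<le> M * norm v"
    and target_step: "B (T x) (Suc n) v = G x (B x n v)"
    and continuous_B: "0 < e \<Longrightarrow> \<forall>\<^sub>F y in nhds x. \<forall>v. norm (B y n v - B x n v) \<le> e * norm v"
begin

definition U :: "'x \<Rightarrow> nat \<Rightarrow> 'a set" where "U x n = B x n ` W x n"

text \<open>Domination compares singular values at one time; comparison with the next time costs the
  condition number \<open>M / m\<close>.\<close>

definition rate :: real where "rate = M / m * K"

lemma rate_pos: "0 < rate" using constants by (simp add: rate_def)

lemma subspace_W: "subspace (W x n)"
  and W_lower: "w \<in> W x n \<Longrightarrow> s x n * norm w \<le> norm (B x n w)"
  using split[of x n] by (auto simp: singular_split_def)

lemma subspace_U: "subspace (U x n)"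
  unfolding U_def by (rule linear_subspace_image[OF linear_B subspace_W])

lemma dim_U: "dim (U x n) = k"
proof -
  have "w = 0" if "w \<in> W x n" "B x n w = 0" for w
    using W_lower[OF that(1)] that(2) s_pos[of x n] by (simp add: mult_le_0_iff)
  then have "inj_on (B x n) (span (W x n))"
    using linear_injective_on_subspace_0[OF linear_B subspace_W] subspace_W by (metis span_eq_iff)
  then show ?thesis unfolding U_def using dim_image_eq[OF linear_B] dim_W by metis
qed

text \<open>The min-max principle with the preimage of \<open>W x n\<close> under the new factor as
  trial space.\<close>

lemma s_Suc_ge: "m * s x n \<le> s x (Suc n)"
proof -
  obtain C where C: "linear C" "\<And>v. m * norm v \<le> norm (C v)" "\<And>v. B x (Suc n) v = B x n (C v)"
    using source_step by metis
  have bC: "bij C" by (rule bij_linear_bounded_below[OF C(1,2) constants(1)])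
  let ?S = "inv C ` W x n"
  have "linear (inv C)" "bij (inv C)" using linear_bij_inv[OF C(1) bC] bij_imp_bij_inv[OF bC] by auto
  then have S: "subspace ?S" "dim ?S = dim (W x (Suc n))"
    using linear_subspace_image subspace_W dim_image_bij[of "inv C" "W x n"] by (auto simp: dim_W)
  obtain v where v: "v \<in> ?S" "v \<noteq> 0" "norm (B x (Suc n) v) \<le> s x (Suc n) * norm v"
    using singular_split_minmax[OF linear_B split t_bounds(1,2) S] by metis
  have "C v \<in> W x n" using v(1) bC by (auto simp: bij_is_surj surj_f_inv_f)
  then have "s x n * norm (C v) \<le> s x (Suc n) * norm v" using W_lower[of "C v" x n] v(3) C(3) by simp
  moreover have "s x n * (m * norm v) \<le> s x n * norm (C v)"
    using s_pos[of x n] C(2) by (intro mult_left_mono) auto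
  ultimately have "(m * s x n) * norm v \<le> s x (Suc n) * norm v" by (simp add: mult_ac)
  then show ?thesis using v(2) by simp
qed

lemma U_near: "near (rate * \<tau> ^ n) (U x (Suc n)) (U x n)"
proof -
  obtain C where C: "linear C" "\<And>v. norm (C v) \<le> M * norm v" "\<And>v. B x (Suc n) v = B x n (C v)"
    using source_step by metis
  \<comment> \<open>The new factor lengthens vectors by at most \<open>M\<close>, while
    \<open>s x (Suc n)\<close> is at least \<open>m * s x n\<close>; so \<open>B x n\<close> must
    expand the image under \<open>C\<close> of \<open>W x (Suc n)\<close> by at least this
    quotient.\<close>
  let ?c = "m * s x n / M"
  have c: "0 < ?c" using constants s_pos[of x n] by simp
  have "?c * norm y \<le> norm (B x n y)" if y: "y \<in> C ` W x (Suc n)" for y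
  proof -
    obtain w where w: "w \<in> W x (Suc n)" "y = C w" using y by auto
    have "?c * norm y \<le> ?c * (M * norm w)" using C(2) c w by (intro mult_left_mono) auto
    also have "\<dots> = (m * s x n) * norm w" using constants by simp
    also have "\<dots> \<le> s x (Suc n) * norm w" by (intro mult_right_mono s_Suc_ge) simp
    also have "\<dots> \<le> norm (B x n y)" using W_lower[OF w(1)] w(2) C(3) by simp
    finally show ?thesis .
  qed
  then have "near (t x n / ?c) (B x n ` C ` W x (Suc n)) (B x n ` W x n)"
    by (rule singular_split_image_near[OF linear_B split t_bounds(1) c])
  moreover have "B x n ` C ` W x (Suc n) = U x (Suc n)" using C(3) by (auto simp: U_def)
  moreover have "t x n / ?c \<le> rate * \<tau> ^ n"
  proof -
    have "t x n / ?c = M / m * (t x n / s x n)" by simp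
    also have "\<dots> \<le> M / m * (K * \<tau> ^ n)"
      using constants t_bounds(3)[of x n] s_pos[of x n] by (intro mult_left_mono) (auto simp: field_simps)
    finally show ?thesis by (simp add: rate_def)
  qed
  ultimately show ?thesis unfolding U_def[of x n, symmetric] by (metis near_mono)
qed

text \<open>A gap below 1 is what allows \<open>near_sym\<close> to make the one-sided estimate
  two-sided.\<close>

lemma U_step:
  assumes "rate * \<tau> ^ n < 1"
  shows "norm (closest_point (U x (Suc n)) v - closest_point (U x n) v) \<le> rate * \<tau> ^ n * norm v"
  using constants rate_pos
  by (intro norm_diff_closest_points_le near_sym[OF _ _ U_near assms] U_near subspace_U) (auto simp: dim_U)

lemma rate_decreasing: "n \<le> j \<Longrightarrow> rate * \<tau> ^ n < 1 \<Longrightarrow> rate * \<tau> ^ j < 1"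
  using constants rate_pos power_decreasing[of n j \<tau>]
  by (meson less_eq_real_def mult_left_mono order_le_less_trans)

lemma U_tail:
  assumes n: "rate * \<tau> ^ n < 1" and "n \<le> j"
  shows "norm (closest_point (U x j) v - closest_point (U x n) v) \<le> rate * \<tau> ^ n / (1 - \<tau>) * norm v"
proof -
  \<comment> \<open>Tails of the geometric series: \<open>?f n - ?f j\<close> is the sum of the
    steps from \<open>n\<close> up to but excluding \<open>j\<close>.\<close>
  let ?f = "\<lambda>i. rate * \<tau> ^ i / (1 - \<tau>)"
  have "norm (closest_point (U x j) v - closest_point (U x n) v) \<le> (?f n - ?f j) * norm v"
    using assms(2)
  proof (induction j rule: dec_induct)
    case (step j)
    have "norm (closest_point (U x (Suc j)) v - closest_point (U x n) v)
        \<le> rate * \<tau> ^ j * norm v + (?f n - ?f j) * norm v"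
      using U_step[OF rate_decreasing[OF step(1) n], of x v] step(3)
        norm_triangle_ineq[of "closest_point (U x (Suc j)) v - closest_point (U x j) v"
          "closest_point (U x j) v - closest_point (U x n) v"] by simp
    also have "\<dots> = (rate * \<tau> ^ j + (?f n - ?f j)) * norm v" by (simp only: distrib_right)
    also have "rate * \<tau> ^ j + (?f n - ?f j) = ?f n - ?f (Suc j)"
    proof -
      have "rate * \<tau> ^ j = rate * \<tau> ^ j * (1 - \<tau>) / (1 - \<tau>)" using constants by simp
      also have "\<dots> = ?f j - ?f (Suc j)" by (simp add: diff_divide_distrib[symmetric] algebra_simps)
      finally show ?thesis by linarith
    qed
    finally show ?case .
  qed simp
  also have "\<dots> \<le> ?f n * norm v" using constants rate_pos by (intro mult_right_mono) auto
  finally show ?thesis .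
qed

lemma tendsto_geometric: "(\<lambda>n. c * \<tau> ^ n) \<longlonglongrightarrow> 0"
  using constants by (intro tendsto_mult_right_zero LIMSEQ_realpow_zero) auto

text \<open>The choice is tied to a convergence rate that does not depend on \<open>x\<close>;
  continuity rests on this uniformity.\<close>

definition E :: "'x \<Rightarrow> 'a set" where
  "E x = (SOME E. subspace E \<and> (\<forall>n v. rate * \<tau> ^ n < 1 \<longrightarrow>
     norm (closest_point (U x n) v - closest_point E v) \<le> rate * \<tau> ^ n / (1 - \<tau>) * norm v))"

lemma E: shows subspace_E: "subspace (E x)"
  and E_tail: "rate * \<tau> ^ n < 1 \<Longrightarrow>
    norm (closest_point (U x n) v - closest_point (E x) v) \<le> rate * \<tau> ^ n / (1 - \<tau>) * norm v"
proof -
  have "eventually (\<lambda>n. rate * \<tau> ^ n < 1) sequentially"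
    using tendsto_geometric[of rate] by (intro order_tendstoD) auto
  then have ex: "\<exists>n. rate * \<tau> ^ n < 1" by (auto simp: eventually_sequentially)
  \<comment> \<open>As the sequence decreases, the smallness condition is the same as
    \<open>N \<le> n\<close>, the form expected by \<open>limit_of_projections\<close>.\<close>
  define N where "N = (LEAST n. rate * \<tau> ^ n < 1)"
  have N: "N \<le> n \<longleftrightarrow> rate * \<tau> ^ n < 1" for n
    unfolding N_def using LeastI_ex[OF ex] rate_decreasing Least_le[of "\<lambda>n. rate * \<tau> ^ n < 1" n] by blast
  have "(\<lambda>n. rate * \<tau> ^ n / (1 - \<tau>)) \<longlonglongrightarrow> 0"
    using tendsto_geometric[of "rate / (1 - \<tau>)"] by simp
  then have "\<exists>E. subspace E \<and> (\<forall>n v. rate * \<tau> ^ n < 1 \<longrightarrow>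
     norm (closest_point (U x n) v - closest_point E v) \<le> rate * \<tau> ^ n / (1 - \<tau>) * norm v)"
    using limit_of_projections[of "U x" "\<lambda>n. rate * \<tau> ^ n / (1 - \<tau>)" N, OF subspace_U] U_tail
    unfolding N by metis
  from someI_ex[OF this]
  show "subspace (E x)" "rate * \<tau> ^ n < 1 \<Longrightarrow>
    norm (closest_point (U x n) v - closest_point (E x) v) \<le> rate * \<tau> ^ n / (1 - \<tau>) * norm v"
    unfolding E_def[symmetric] by blast+
qed

lemma exists_index:
  assumes "0 < e"
  obtains n where "rate * \<tau> ^ n < 1" "c * \<tau> ^ n < e"
proof -
  have "eventually (\<lambda>n. rate * \<tau> ^ n < 1) sequentially" "eventually (\<lambda>n. c * \<tau> ^ n < e) sequentially"
    using order_tendstoD(2)[OF tendsto_geometric, of 1 rate] order_tendstoD(2)[OF tendsto_geometric assms, of c]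
    by simp_all
  then show ?thesis using that eventually_conj eventually_happens by (metis (mono_tags, lifting) sequentially_bot)
qed

lemma near_U_E: "rate * \<tau> ^ n < 1 \<Longrightarrow> near (rate * \<tau> ^ n / (1 - \<tau>)) (U x n) (E x)"
  and near_E_U: "rate * \<tau> ^ n < 1 \<Longrightarrow> near (rate * \<tau> ^ n / (1 - \<tau>)) (E x) (U x n)"
  using E_tail[of n x] by (auto intro!: nearI subspace_U subspace_E simp: norm_minus_commute)

text \<open>Nearness with constant below 1 compares dimensions, and for large \<open>n\<close> it
  holds in both directions.\<close>

lemma dim_E: "dim (E x) = k"
proof -
  obtain n where n: "rate * \<tau> ^ n < 1" "rate / (1 - \<tau>) * \<tau> ^ n < 1"
    using exists_index[of 1 "rate / (1 - \<tau>)"] by auto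
  then have n': "rate * \<tau> ^ n / (1 - \<tau>) < 1" by simp
  from near_dim_le[OF subspace_U subspace_E near_U_E[OF n(1), of x] n']
    near_dim_le[OF subspace_E subspace_U near_E_U[OF n(1), of x] n']
  show ?thesis by (simp add: dim_U)
qed

lemma bij_G: "bij (G x)" by (rule bij_linear_bounded_below[OF linear_G G_bounds(1) constants(1)])

text \<open>The min-max principle for \<open>B x n\<close>, with the space
  \<open>W (T x) (Suc n)\<close> of the longer product as trial space.\<close>

lemma s_target: "s (T x) (Suc n) \<le> M * s x n"
proof -
  have d: "dim (W (T x) (Suc n)) = dim (W x n)" by (simp add: dim_W)
  obtain v where v: "v \<in> W (T x) (Suc n)" "v \<noteq> 0" "norm (B x n v) \<le> s x n * norm v"
    using singular_split_minmax[OF linear_B split t_bounds(1,2) subspace_W d] by metis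
  have "s (T x) (Suc n) * norm v \<le> norm (G x (B x n v))" using W_lower[OF v(1)] by (simp add: target_step)
  also have "\<dots> \<le> M * norm (B x n v)" by (rule G_bounds)
  also have "\<dots> \<le> M * (s x n * norm v)" using v(3) constants by (intro mult_left_mono) auto
  finally show ?thesis using v(2) by simp
qed

lemma near_target: "near (rate * \<tau> ^ Suc n) (G x ` U x n) (U (T x) (Suc n))"
proof -
  let ?c = "m * s x n"
  have c: "0 < ?c" using constants s_pos by simp
  have "?c * norm w \<le> norm (B (T x) (Suc n) w)" if "w \<in> W x n" for w
  proof -
    have "m * (s x n * norm w) \<le> m * norm (B x n w)"
      using W_lower[OF that] constants by (intro mult_left_mono) auto
    also have "\<dots> \<le> norm (G x (B x n w))" by (rule G_bounds)
    finally show ?thesis by (simp add: target_step mult.assoc)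
  qed
  then have "near (t (T x) (Suc n) / ?c) (B (T x) (Suc n) ` W x n) (U (T x) (Suc n))"
    unfolding U_def by (rule singular_split_image_near[OF linear_B split t_bounds(1) c])
  moreover have "B (T x) (Suc n) ` W x n = G x ` U x n" by (auto simp: U_def target_step)
  moreover have "t (T x) (Suc n) / ?c \<le> rate * \<tau> ^ Suc n"
  proof -
    have "t (T x) (Suc n) \<le> K * \<tau> ^ Suc n * (M * s x n)"
      using constants by (intro order_trans[OF t_bounds(3)] mult_left_mono s_target) auto
    then have "t (T x) (Suc n) / ?c \<le> K * \<tau> ^ Suc n * (M * s x n) / ?c"
      using c by (intro divide_right_mono) auto
    then show ?thesis using s_pos[of x n] by (simp add: rate_def mult_ac)
  qed
  ultimately show ?thesis by (metis near_mono)
qed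

text \<open>Both sides are compared through the image of \<open>U x n\<close> and through
  \<open>U (T x) (Suc n)\<close>; all gaps vanish as \<open>n\<close> grows.\<close>

lemma E_equivariant: "G x ` E x = E (T x)"
proof (rule subspace_eq_if_near)
  show "subspace (G x ` E x)" by (rule linear_subspace_image[OF linear_G subspace_E])
  show "dim (G x ` E x) = dim (E (T x))" by (simp add: dim_image_bij[OF linear_G bij_G] dim_E)
  fix e :: real assume "0 < e"
  let ?r = "rate / (1 - \<tau>)"
  \<comment> \<open>The three coefficients belong to the three gaps: \<open>E x\<close> to
    \<open>U x n\<close> distorted by \<open>G x\<close>, the step of \<open>near_target\<close>,
    and \<open>U (T x) (Suc n)\<close> to its limit.\<close>
  obtain n where n: "rate * \<tau> ^ n < 1" "(M / m * ?r + rate + ?r) * \<tau> ^ n < e"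
    using exists_index[OF \<open>0 < e\<close>] by metis
  have \<tau>: "\<tau> ^ Suc n \<le> \<tau> ^ n" using constants by (intro power_decreasing) auto
  have pos: "0 \<le> ?r" using constants rate_pos by simp
  have r: "rate * \<tau> ^ Suc n \<le> rate * \<tau> ^ n" "?r * \<tau> ^ Suc n \<le> ?r * \<tau> ^ n"
    using \<tau> pos rate_pos by (simp_all only: mult_left_mono less_imp_le)
  have n': "rate * \<tau> ^ Suc n < 1" using n r by linarith
  have "near (M / m * (?r * \<tau> ^ n)) (G x ` E x) (G x ` U x n)"
    unfolding near_def
  proof
    fix y assume "y \<in> G x ` E x"
    then obtain v where v: "v \<in> E x" "y = G x v" by auto
    let ?p = "closest_point (U x n) v"
    have "norm (y - closest_point (G x ` U x n) y) \<le> norm (y - G x ?p)"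
      by (intro norm_diff_closest_point_min linear_subspace_image linear_G subspace_U imageI
          closest_point_in_subspace)
    also have "\<dots> = norm (G x (v - ?p))" using v by (simp add: linear_diff[OF linear_G])
    also have "\<dots> \<le> M * norm (v - ?p)" by (rule G_bounds)
    also have "\<dots> \<le> M * (?r * \<tau> ^ n * norm v)"
      using near_E_U[OF n(1), of x] v constants by (intro mult_left_mono) (auto simp: near_def)
    also have "\<dots> \<le> M * (?r * \<tau> ^ n * (norm y / m))"
      using G_bounds(1)[of v x] v constants pos by (intro mult_left_mono) (auto simp: field_simps)
    finally show "norm (y - closest_point (G x ` U x n) y) \<le> M / m * (?r * \<tau> ^ n) * norm y" by (simp add: mult_ac)
  qed
  then have "near (M / m * (?r * \<tau> ^ n) + rate * \<tau> ^ Suc n) (G x ` E x) (U (T x) (Suc n))"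
    using rate_pos constants
    by (intro near_trans[OF _ _ _ near_target] linear_subspace_image linear_G subspace_U) auto
  then have "near (M / m * (?r * \<tau> ^ n) + rate * \<tau> ^ Suc n + rate * \<tau> ^ Suc n / (1 - \<tau>)) (G x ` E x) (E (T x))"
    using rate_pos constants by (intro near_trans[OF _ _ _ near_U_E[OF n']] subspace_U subspace_E) auto
  moreover have "M / m * (?r * \<tau> ^ n) + rate * \<tau> ^ Suc n + rate * \<tau> ^ Suc n / (1 - \<tau>) \<le> e"
    using r n(2) by (simp add: algebra_simps)
  ultimately show "near e (G x ` E x) (E (T x))" by (rule near_mono)
qed (rule subspace_E)

text \<open>For one fixed large \<open>n\<close>, pass from \<open>E y\<close> to
  \<open>U y n\<close>, to \<open>U x n\<close>, to \<open>E x\<close>. The middle passage does not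
  need \<open>W y n\<close> close to \<open>W x n\<close>: both images catch the dominant directions
  of nearly equal maps, up to an error of order \<open>K * \<tau> ^ n\<close>.\<close>

lemma E_continuous:
  assumes e: "0 < e"
  shows "\<forall>\<^sub>F y in nhds x. \<forall>v. norm (closest_point (E y) v - closest_point (E x) v) \<le> e * norm v"
proof -
  let ?r = "rate / (1 - \<tau>)"
  \<comment> \<open>\<open>2 * ?r\<close> accounts for the two passages to the limit and
    \<open>4 * K\<close> for the middle one. The bound 1/2 keeps the middle gap below 1 and
    \<open>\<eta>\<close> below half of \<open>s x n\<close>.\<close>
  obtain n where n: "rate * \<tau> ^ n < 1" "(2 * ?r + 4 * K) * \<tau> ^ n < min e (1/2)"
    using exists_index[of "min e (1/2)" "2 * ?r + 4 * K"] e by auto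
  have rp: "0 \<le> ?r * \<tau> ^ n" "0 < K * \<tau> ^ n" using constants rate_pos by auto
  have exp: "(2 * ?r + 4 * K) * \<tau> ^ n = 2 * (?r * \<tau> ^ n) + 4 * (K * \<tau> ^ n)"
    by (simp only: distrib_right mult.assoc)
  have K4: "4 * (K * \<tau> ^ n) < 1/2" "2 * (?r * \<tau> ^ n) + 4 * (K * \<tau> ^ n) < e"
    using n(2) rp unfolding exp by linarith+
  \<comment> \<open>The tolerated perturbation equals the domination bound for \<open>t x n\<close>,
    so perturbing the map costs no more than the contracted directions do.\<close>
  define \<eta> where "\<eta> = K * \<tau> ^ n * s x n"
  have \<eta>: "0 < \<eta>" using rp s_pos by (simp add: \<eta>_def)
  show ?thesis using continuous_B[OF \<eta>, where x = x and n = n]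
  proof (rule eventually_mono)
    fix y assume y: "\<forall>v. norm (B y n v - B x n v) \<le> \<eta> * norm v"
    \<comment> \<open>Min-max for \<open>B y n\<close> with \<open>W x n\<close> as trial space.
      This halving turns the error \<open>2 * \<eta>\<close> into the constant 4 below.\<close>
    have sy: "s x n / 2 \<le> s y n"
    proof -
      have d: "dim (W x n) = dim (W y n)" by (simp add: dim_W)
      obtain v where v: "v \<in> W x n" "v \<noteq> 0" "norm (B y n v) \<le> s y n * norm v"
        using singular_split_minmax[OF linear_B split t_bounds(1,2) subspace_W d] by metis
      have "norm (B x n v) \<le> norm (B y n v) + norm (B y n v - B x n v)"
        by (metis norm_minus_commute norm_triangle_sub)
      then have "s x n * norm v \<le> s y n * norm v + \<eta> * norm v"
        using W_lower[OF v(1)] v(3) y by (meson add_mono order_trans)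
      then have "s x n \<le> s y n + \<eta>" using v(2) by (simp add: distrib_right[symmetric])
      moreover have "\<eta> \<le> 1/2 * s x n" unfolding \<eta>_def using K4(1) s_pos[of x n] by (intro mult_right_mono) auto
      ultimately show ?thesis by simp
    qed
    have "near (4 * (K * \<tau> ^ n)) (U y n) (U x n)"
      unfolding near_def
    proof
      fix u assume "u \<in> U y n"
      then obtain w where w: "w \<in> W y n" "u = B y n w" by (auto simp: U_def)
      let ?p = "closest_point (W x n) w"
      have "norm (u - closest_point (U x n) u) \<le> norm (u - B x n ?p)"
        unfolding U_def by (intro norm_diff_closest_point_min linear_subspace_image linear_B subspace_W imageI
          closest_point_in_subspace)
      also have "\<dots> \<le> norm (B y n w - B x n w) + norm (B x n (w - ?p))"
        unfolding w(2) using norm_triangle_ineq[of "B y n w - B x n w" "B x n w - B x n ?p"]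
        by (simp add: linear_diff[OF linear_B])
      also have "\<dots> \<le> \<eta> * norm w + \<eta> * norm w"
      proof (rule add_mono)
        have "norm (B x n (w - ?p)) \<le> t x n * norm (w - ?p)"
          using split[of x n] diff_closest_point_orth[OF subspace_W] by (simp add: singular_split_def)
        also have "\<dots> \<le> \<eta> * norm w"
          unfolding \<eta>_def using t_bounds(1,3)[of x n]
          by (intro mult_mono norm_diff_closest_point_le subspace_W) auto
        finally show "norm (B x n (w - ?p)) \<le> \<eta> * norm w" .
      qed (use y in blast)
      also have "\<dots> = 4 * (K * \<tau> ^ n) * ((s x n / 2) * norm w)" by (simp add: \<eta>_def)
      also have "\<dots> \<le> 4 * (K * \<tau> ^ n) * (s y n * norm w)"
        using sy rp by (intro mult_left_mono mult_right_mono) auto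
      also have "\<dots> \<le> 4 * (K * \<tau> ^ n) * norm u"
        using W_lower[OF w(1)] w(2) rp by (intro mult_left_mono) auto
      finally show "norm (u - closest_point (U x n) u) \<le> 4 * (K * \<tau> ^ n) * norm u" .
    qed
    note nr = this
    have U: "norm (closest_point (U y n) v - closest_point (U x n) v) \<le> 4 * (K * \<tau> ^ n) * norm v" for v
      using K4(1) rp
      by (intro norm_diff_closest_points_le near_sym[OF _ _ nr] nr subspace_U) (auto simp: dim_U)
    show "\<forall>v. norm (closest_point (E y) v - closest_point (E x) v) \<le> e * norm v"
    proof
      fix v
      have "norm (closest_point (E y) v - closest_point (E x) v)
          \<le> ?r * \<tau> ^ n * norm v + 4 * (K * \<tau> ^ n) * norm v + ?r * \<tau> ^ n * norm v"
      proof -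
        have tri: "norm (a - d) \<le> norm (b - a) + norm (b - c) + norm (c - d)" for a b c d :: 'a
          using norm_triangle_ineq[of "a - b" "b - d"] norm_triangle_ineq[of "b - c" "c - d"]
          by (simp add: norm_minus_commute)
        have "?r * \<tau> ^ n = rate * \<tau> ^ n / (1 - \<tau>)" by simp
        then have EU: "norm (closest_point (U z n) v - closest_point (E z) v) \<le> ?r * \<tau> ^ n * norm v" for z
          using E_tail[OF n(1)] by metis
        show ?thesis
          by (rule order_trans[OF tri[where b = "closest_point (U y n) v" and c = "closest_point (U x n) v"]])
             (rule add_mono[OF add_mono[OF EU U] EU])
      qed
      also have "\<dots> = (2 * (?r * \<tau> ^ n) + 4 * (K * \<tau> ^ n)) * norm v" by (simp add: algebra_simps)
      also have "\<dots> \<le> e * norm v" using K4(2) by (intro mult_right_mono) auto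
      finally show "norm (closest_point (E y) v - closest_point (E x) v) \<le> e * norm v" .
    qed
  qed
qed

end

subsection \<open>The dominated splitting of a cocycle\<close>

lemma continuous_map_grassmannianI:
  fixes H :: "'x::topological_space \<Rightarrow> 'a::euclidean_space set"
  assumes H: "\<And>x. subspace (H x)"
    and c: "\<And>x e. 0 < e \<Longrightarrow>
      \<forall>\<^sub>F y in nhds x. \<forall>v. norm (closest_point (H y) v - closest_point (H x) v) \<le> e * norm v"
  shows "continuous_map euclidean grassmannian H"
  unfolding grassmannian_def
proof (rule continuous_map_pullback')
  let ?f = "(\<lambda>S. Blinfun (closest_point S)) \<circ> H"
  have bl: "bounded_linear (closest_point (H x))" for x
    using linear_closest_point[OF H] by (simp add: linear_conv_bounded_linear)
  have ap: "blinfun_apply (?f x) = closest_point (H x)" for x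
    by (simp add: bounded_linear_Blinfun_apply[OF bl])
  have "continuous_on UNIV ?f"
    unfolding continuous_on_def
  proof (intro ballI tendstoI)
    fix x and e :: real assume e: "0 < e"
    have "\<forall>\<^sub>F y in nhds x. dist (?f y) (?f x) < e"
      using c[of "e / 2" x]
    proof (rule eventually_mono)
      fix y assume "\<forall>v. norm (closest_point (H y) v - closest_point (H x) v) \<le> e / 2 * norm v"
      then have "norm (?f y - ?f x) \<le> e / 2"
        using e by (intro norm_blinfun_bound) (auto simp: blinfun.diff_left ap simp del: comp_apply)
      then show "dist (?f y) (?f x) < e" using e by (simp add: dist_norm)
    qed (use e in simp)
    then show "\<forall>\<^sub>F y in at x. dist (?f y) (?f x) < e" by (simp add: eventually_nhds_conv_at)
  qed
  then show "continuous_map euclidean euclidean ?f" by simp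
qed (auto simp: H)

lemma norm_adjoint_le:
  fixes A :: "'a::euclidean_space \<Rightarrow> 'a"
  assumes A: "linear A" "\<And>v. norm (A v) \<le> M * norm v"
  shows "norm (adjoint A v) \<le> M * norm v"
proof (cases "adjoint A v = 0")
  case False
  have "norm (adjoint A v) * norm (adjoint A v) = v \<bullet> A (adjoint A v)"
    using adjoint_clauses(2)[OF A(1), of v "adjoint A v"]
    by (simp add: power2_eq_square[symmetric] power2_norm_eq_inner)
  also have "\<dots> \<le> norm v * norm (A (adjoint A v))" by (rule norm_cauchy_schwarz)
  also have "\<dots> \<le> norm v * (M * norm (adjoint A v))" by (intro mult_left_mono A) simp
  finally show ?thesis using False by (simp add: mult_ac)
next
  case True
  then show ?thesis using A(2)[of v] by (metis norm_ge_zero norm_zero order_trans)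
qed

lemma norm_adjoint_ge:
  fixes A :: "'a::euclidean_space \<Rightarrow> 'a"
  assumes A: "linear A" "\<And>v. m * norm v \<le> norm (A v)" and m: "0 < m"
  shows "m * norm v \<le> norm (adjoint A v)"
proof (cases "v = 0")
  case False
  have "bij A" by (rule bij_linear_bounded_below[OF A m])
  then obtain u where u: "v = A u" by (metis bij_pointE)
  have "m * norm u * norm v \<le> norm v * norm v" using A(2)[of u] u by (intro mult_right_mono) auto
  also have "\<dots> = adjoint A v \<bullet> u"
    using adjoint_clauses(2)[OF A(1), of v u] u by (simp add: power2_eq_square[symmetric] power2_norm_eq_inner)
  also have "\<dots> \<le> norm (adjoint A v) * norm u" by (rule norm_cauchy_schwarz)
  finally have "(m * norm v) * norm u \<le> norm (adjoint A v) * norm u" by (simp add: mult_ac)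
  moreover have "u \<noteq> 0" using False u linear_0[OF A(1)] by auto
  ultimately show ?thesis by simp
qed simp

lemma adjoint_compose:
  fixes A B :: "'a::euclidean_space \<Rightarrow> 'a"
  assumes "linear A" "linear B"
  shows "adjoint (\<lambda>v. A (B v)) v = adjoint B (adjoint A v)"
  using adjoint_unique[of "\<lambda>v. A (B v)" "\<lambda>v. adjoint B (adjoint A v)"]
  by (simp add: adjoint_clauses assms)

lemma adjoint_diff:
  fixes A B :: "'a::euclidean_space \<Rightarrow> 'a"
  assumes "linear A" "linear B"
  shows "adjoint (\<lambda>v. A v - B v) v = adjoint A v - adjoint B v"
  using adjoint_unique[of "\<lambda>v. A v - B v" "\<lambda>v. adjoint A v - adjoint B v"]
  by (simp add: adjoint_clauses assms inner_diff_left inner_diff_right)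

text \<open>Min-max supplies a unit vector \<open>e\<close> of \<open>E\<close> with
  \<open>norm (A e)\<close> at most \<open>s\<close>, for which the extra factor of
  \<open>abs_det_on_split_bound\<close> is at most 1.\<close>

lemma abs_det_on_le_split:
  fixes A :: "'a::euclidean_space \<Rightarrow> 'a"
  assumes A: "linear A" "bij A" and sp: "singular_split A W s t" and st: "0 < s" "t \<le> s" "0 \<le> t"
    and E: "subspace E" "dim E = dim W"
  shows "abs_det_on E A \<le> abs_det_on W A"
proof -
  have W: "subspace W" using sp by (simp add: singular_split_def)
  obtain v where v: "v \<in> E" "v \<noteq> 0" "norm (A v) \<le> s * norm v"
    using singular_split_minmax[OF A(1) sp st(3,2) E] by metis
  define e where "e = v /\<^sub>R norm v"
  have e: "e \<in> E" "norm e = 1" "norm (A e) \<le> s"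
    using v subspace_scale[OF E(1)] by (simp_all add: e_def linear_scale[OF A(1)] field_simps)
  have "abs_det_on E A \<le> abs_det_on W A * (norm (A e) / s)"
    by (rule abs_det_on_split_bound(1)[OF A sp st E e(1,2)])
  also have "\<dots> \<le> abs_det_on W A * 1"
    using e(3) st abs_det_on_pos[OF W A(1) inj_on_bij[OF A(2)]] by (intro mult_left_mono) auto
  finally show ?thesis by simp
qed

section \<open>The two limit bundles of a dominated cocycle\<close>

text \<open>\<open>m\<close> and \<open>M\<close> are uniform bounds with quotient \<kappa>.
  \<open>N\<close> is a time from which the leading directions count as aligned with E; only its
  defining inequality matters until the ceiling is inserted at the end.\<close>

locale dominated_cocycle =
  fixes T S :: "'x::topological_space \<Rightarrow> 'x"
    and A :: "'x \<Rightarrow> nat \<Rightarrow> ('a::euclidean_space \<Rightarrow>\<^sub>L 'a)"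
    and k N :: nat
    and m M K \<tau> :: real
  assumes inverse: "T (S x) = x" "S (T x) = x"
    and continuous_S: "continuous_on UNIV S"
    and cocycle: "cocycle T A"
    and continuous_A: "continuous_on UNIV (\<lambda>x. A x n)"
    and bij_A: "bij (blinfun_apply (A x n))"
    and A_bounds: "m * norm v \<le> norm (A x 1 v)" "norm (A x 1 v) \<le> M * norm v"
    and k: "1 \<le> k" "k < DIM('a)"
    and const: "0 < m" "m \<le> M" "0 < K" "0 < \<tau>" "\<tau> < 1"
    and domination: "singular_value (A x n) (k + 1) \<le> K * \<tau> ^ n * singular_value (A x n) k"
    and N: "(M / m) ^ 3 * K * \<tau> ^ N / (1 - \<tau>) \<le> 1 / 3"
begin

abbreviation s where "s x n \<equiv> singular_value (A x n) k"
abbreviation t where "t x n \<equiv> singular_value (A x n) (k + 1)"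
abbreviation volume where "volume x n \<equiv> (\<Prod>i=1..k. singular_value (A x n) i)"

lemma linear_A: "linear (blinfun_apply (A x n))" by (rule linear_blinfun_apply)

lemma s_pos: "0 < s x n" and t_pos: "0 < t x n" and t_le_s: "t x n \<le> s x n"
  using k by (auto intro!: singular_value_pos bij_A singular_value_antimono)

lemma t_nonneg: "0 \<le> t x n" by (rule less_imp_le[OF t_pos])

lemma volume_pos: "0 < volume x n"
  using k by (intro prod_pos) (auto intro!: singular_value_pos bij_A)

text \<open>An arbitrary choice at each point and time, made once so that the fast and the slow
  construction speak of the same spaces.\<close>

definition W :: "'x \<Rightarrow> nat \<Rightarrow> 'a set" where
  "W x n = (SOME W. subspace W \<and> dim W = k \<and> singular_split (A x n) W (s x n) (t x n) \<and>
     abs_det_on W (A x n) = volume x n)"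

lemma W: shows subspace_W: "subspace (W x n)" and dim_W: "dim (W x n) = k"
  and split_W: "singular_split (A x n) (W x n) (s x n) (t x n)"
  and det_W: "abs_det_on (W x n) (A x n) = volume x n"
proof -
  have "\<exists>W. subspace W \<and> dim W = k \<and> singular_split (A x n) W (s x n) (t x n) \<and>
     abs_det_on W (A x n) = volume x n"
    using exists_singular_split[OF bij_A k(1) less_imp_le[OF k(2)] order_refl t_nonneg, of x n] by blast
  from someI_ex[OF this] show "subspace (W x n)" "dim (W x n) = k"
    "singular_split (A x n) (W x n) (s x n) (t x n)" "abs_det_on (W x n) (A x n) = volume x n"
    unfolding W_def[symmetric] by blast+
qed

lemma A_0: "A x 0 v = v" using cocycle by (simp add: cocycle_def)

lemma A_Suc: "A x (Suc n) v = A ((T ^^ n) x) 1 (A x n v)"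
  using cocycle unfolding cocycle_def by (metis blinfun_apply_blinfun_compose plus_1_eq_Suc)

lemma A_Suc': "A x (Suc n) v = A (T x) n (A x 1 v)"
proof -
  have "A x (n + 1) = A ((T ^^ 1) x) n o\<^sub>L A x 1" using cocycle unfolding cocycle_def by blast
  then show ?thesis by simp
qed

lemma T_S_pow: "(T ^^ n) ((S ^^ n) x) = x" "(S ^^ n) ((T ^^ n) x) = x"
  by (induction n arbitrary: x) (simp_all add: inverse funpow_swap1)

lemma continuous_S_pow: "continuous_on UNIV (S ^^ n)"
  by (induction n) (auto intro!: continuous_on_compose continuous_on_subset[OF continuous_S] simp: continuous_on_id comp_def
      intro: continuous_on_compose2[OF continuous_S])

lemma eventually_A_near:
  assumes f: "continuous_on UNIV f" and e: "0 < e"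
  shows "\<forall>\<^sub>F y in nhds x. \<forall>v. norm (A (f y) n v - A (f x) n v) \<le> e * norm v"
proof -
  have "continuous_on UNIV (\<lambda>x. A (f x) n)"
    by (rule continuous_on_compose2[OF continuous_A f]) auto
  then have "\<forall>\<^sub>F y in at x. dist (A (f y) n) (A (f x) n) < e"
    using e unfolding continuous_on_def tendsto_iff by blast
  then have "\<forall>\<^sub>F y in nhds x. dist (A (f y) n) (A (f x) n) < e"
    using e by (simp add: eventually_nhds_conv_at)
  then show ?thesis
  proof (rule eventually_mono)
    fix y assume "dist (A (f y) n) (A (f x) n) < e"
    then have "norm (A (f y) n - A (f x) n) * norm v \<le> e * norm v" for v
      by (intro mult_right_mono) (simp_all add: dist_norm)
    moreover have "norm (A (f y) n v - A (f x) n v) \<le> norm (A (f y) n - A (f x) n) * norm v" for v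
      unfolding blinfun.diff_left[symmetric] by (rule norm_blinfun)
    ultimately show "\<forall>v. norm (A (f y) n v - A (f x) n v) \<le> e * norm v" by (meson order_trans)
  qed
qed

text \<open>The product of the \<open>n\<close> steps that end at \<open>x\<close>: going further
  into the past adds a source factor, applying \<open>T\<close> adds a target factor. Goals 13, 17
  and 18 are \<open>source_step\<close>, \<open>target_step\<close> and
  \<open>continuous_B\<close>.\<close>

sublocale fast: dominated_sequences "\<lambda>x n. blinfun_apply (A ((S ^^ n) x) n)" "\<lambda>x n. W ((S ^^ n) x) n"
  "\<lambda>x n. s ((S ^^ n) x) n" "\<lambda>x n. t ((S ^^ n) x) n" T "\<lambda>x. blinfun_apply (A x 1)" k m M K \<tau>
proof (rule dominated_sequences.intro, goal_cases)
  case (13 x n)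
  show ?case
  proof (intro exI conjI allI)
    show "linear (blinfun_apply (A ((S ^^ Suc n) x) 1))" by (rule linear_A)
    fix v
    show "m * norm v \<le> norm (A ((S ^^ Suc n) x) 1 v)" "norm (A ((S ^^ Suc n) x) 1 v) \<le> M * norm v"
      by (rule A_bounds)+
    show "A ((S ^^ Suc n) x) (Suc n) v = A ((S ^^ n) x) n (A ((S ^^ Suc n) x) 1 v)"
      unfolding A_Suc' by (simp add: inverse)
  qed
next
  case (17 x n v)
  show ?case unfolding A_Suc by (simp add: funpow_swap1 inverse T_S_pow)
next
  case (18 e n x)
  show ?case by (rule eventually_A_near[OF continuous_S_pow 18])
qed (use linear_A split_W dim_W s_pos t_le_s domination const A_bounds t_nonneg in auto)

lemma adjoint_W: "adjoint (A x n) ` A x n ` W x n = W x n"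
  by (rule singular_split_adjoint(2)[OF linear_A split_W s_pos t_nonneg])

text \<open>Taking adjoints reverses the product of the \<open>n\<close> steps starting at
  \<open>x\<close>: a later step becomes a source factor, and the base point moves by
  \<open>S\<close>. By \<open>adjoint_W\<close> the spaces \<open>slow.U x n\<close> are the
  \<open>W x n\<close>.\<close>

sublocale slow: dominated_sequences "\<lambda>x n. adjoint (blinfun_apply (A x n))" "\<lambda>x n. A x n ` W x n"
  s t S "\<lambda>x. adjoint (blinfun_apply (A (S x) 1))" k m M K \<tau>
proof (rule dominated_sequences.intro, goal_cases)
  case (1 x n)
  show ?case by (rule adjoint_linear[OF linear_A])
next
  case (2 x n)
  show ?case by (rule singular_split_adjoint(1)[OF linear_A split_W s_pos t_nonneg])
next
  case (3 x n)
  show ?case by (simp add: dim_image_bij[OF linear_A bij_A] dim_W)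
next
  case (13 x n)
  show ?case
  proof (intro exI conjI allI)
    show "linear (adjoint (A ((T ^^ n) x) 1))" by (rule adjoint_linear[OF linear_A])
    fix v
    show "m * norm v \<le> norm (adjoint (A ((T ^^ n) x) 1) v)"
      by (rule norm_adjoint_ge[OF linear_A A_bounds(1) const(1)])
    show "norm (adjoint (A ((T ^^ n) x) 1) v) \<le> M * norm v"
      by (rule norm_adjoint_le[OF linear_A A_bounds(2)])
    have "blinfun_apply (A x (Suc n)) = (\<lambda>v. A ((T ^^ n) x) 1 (A x n v))" by (rule ext) (rule A_Suc)
    then show "adjoint (A x (Suc n)) v = adjoint (A x n) (adjoint (A ((T ^^ n) x) 1) v)"
      by (simp only: adjoint_compose[OF linear_A linear_A])
  qed
next
  case (14 x)
  show ?case by (rule adjoint_linear[OF linear_A])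
next
  case (15 x v)
  show ?case by (rule norm_adjoint_ge[OF linear_A A_bounds(1) const(1)])
next
  case (16 x v)
  show ?case by (rule norm_adjoint_le[OF linear_A A_bounds(2)])
next
  case (17 x n v)
  have "blinfun_apply (A (S x) (Suc n)) = (\<lambda>v. A x n (A (S x) 1 v))"
    by (rule ext) (simp add: A_Suc'[of "S x" n] inverse)
  then show ?case by (simp only: adjoint_compose[OF linear_A linear_A])
next
  case (18 e n x)
  show ?case using eventually_A_near[OF continuous_on_id 18, where x = x and n = n]
  proof (rule eventually_mono)
    fix y assume y: "\<forall>v. norm (A y n v - A x n v) \<le> e * norm v"
    have "linear (\<lambda>v. A y n v - A x n v)" by (rule linear_compose_sub[OF linear_A linear_A])
    from norm_adjoint_le[OF this] y
    show "\<forall>v. norm (adjoint (A y n) v - adjoint (A x n) v) \<le> e * norm v"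
      by (simp add: adjoint_diff[OF linear_A linear_A])
  qed
qed (use s_pos t_le_s domination const t_nonneg in auto)

definition E :: "'x \<Rightarrow> 'a set" where "E = fast.E"

definition F :: "'x \<Rightarrow> 'a set" where "F x = (slow.E x)\<^sup>\<bottom>"

lemma subspace_E: "subspace (E x)" and dim_E: "dim (E x) = k" and subspace_F: "subspace (F x)"
  by (simp_all add: E_def F_def fast.subspace_E fast.dim_E subspace_orthogonal_comp)

lemma dim_F: "dim (F x) + k = DIM('a)"
  using dim_orthogonal_comp[OF slow.subspace_E, of x] by (simp add: F_def slow.dim_E)

lemma A_E: "A x n ` E x = E ((T ^^ n) x)"
proof (induction n)
  case (Suc n)
  have "A x (Suc n) ` E x = A ((T ^^ n) x) 1 ` A x n ` E x"
    unfolding image_image by (rule image_cong[OF refl A_Suc])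
  also have "\<dots> = E ((T ^^ Suc n) x)" by (simp only: Suc) (simp only: E_def fast.E_equivariant funpow.simps o_apply)
  finally show ?case .
qed (simp add: A_0)

text \<open>By duality: the adjoint step maps \<open>slow.E\<close> at the next point into
  \<open>slow.E\<close> at the present one, so the complement is carried forward.\<close>

lemma A_F: "v \<in> F x \<Longrightarrow> A x n v \<in> F ((T ^^ n) x)"
proof (induction n)
  case (Suc n)
  let ?y = "(T ^^ n) x"
  have "A ?y 1 u \<in> F (T ?y)" if u: "u \<in> F ?y" for u
    unfolding F_def mem_orthogonal_comp
  proof
    fix w assume "w \<in> slow.E (T ?y)"
    then have "adjoint (A ?y 1) w \<in> slow.E ?y" using slow.E_equivariant[of "T ?y"] by (auto simp: inverse)
    then show "A ?y 1 u \<bullet> w = 0"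
      using orthogonal_compD(1)[OF u[unfolded F_def]] by (simp add: adjoint_clauses[OF linear_A, symmetric])
  qed
  then show ?case using Suc by (simp add: A_Suc[of x n])
qed (simp add: A_0)

lemma continuous_E: "continuous_map euclidean grassmannian E"
  unfolding E_def by (rule continuous_map_grassmannianI[OF fast.subspace_E fast.E_continuous])

lemma continuous_F: "continuous_map euclidean grassmannian F"
proof (rule continuous_map_grassmannianI[OF subspace_F])
  fix x and e :: real assume "0 < e"
  then show "\<forall>\<^sub>F y in nhds x. \<forall>v. norm (closest_point (F y) v - closest_point (F x) v) \<le> e * norm v"
    using slow.E_continuous[of e x]
    by (simp add: F_def closest_point_orthogonal_comp slow.subspace_E norm_minus_commute)
qed

lemma ratio_le:
  assumes e: "e \<in> E x" "norm e = 1"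
  shows "abs_det_on (E x) (A x n) \<le> volume x n * (norm (A x n e) / s x n)"
    "(abs_det_on (E x) (A x n))\<^sup>2 \<le> (volume x n)\<^sup>2 * ((norm (closest_point (W x n) e))\<^sup>2 + (t x n / s x n)\<^sup>2)"
  using abs_det_on_split_bound[OF linear_A bij_A split_W s_pos t_le_s t_nonneg subspace_E _ e]
  by (simp_all add: dim_E dim_W det_W)

lemma det_le_volume: "subspace V \<Longrightarrow> dim V = k \<Longrightarrow> abs_det_on V (A x n) \<le> volume x n"
  using abs_det_on_le_split[OF linear_A bij_A split_W s_pos t_le_s t_nonneg] by (simp add: dim_W det_W)

lemma det_E_pos: "0 < abs_det_on (E x) (A x n)"
  by (rule abs_det_on_pos[OF subspace_E linear_A inj_on_bij[OF bij_A]])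

lemma det_Suc: "subspace V \<Longrightarrow>
    abs_det_on V (A x (Suc n)) = abs_det_on (A x n ` V) (A ((T ^^ n) x) 1) * abs_det_on V (A x n)"
proof -
  assume V: "subspace V"
  have "blinfun_apply (A x (Suc n)) = (\<lambda>v. A ((T ^^ n) x) 1 (A x n v))" by (rule ext) (rule A_Suc)
  then show ?thesis
    using abs_det_on_compose[OF V linear_A inj_on_bij[OF bij_A] linear_A inj_on_bij[OF bij_A]] by metis
qed

section \<open>Lower bound for the volume ratio\<close>

definition \<kappa> :: real where "\<kappa> = M / m"

lemma kappa_ge_1: "1 \<le> \<kappa>" using const by (simp add: \<kappa>_def)

lemma rate_eq: "fast.rate = \<kappa> * K"
  by (simp add: fast.rate_def \<kappa>_def)

text \<open>The gap from the image to \<open>fast.U\<close> and the gap from there to its limit are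
  each at most \<open>\<kappa> * K * \<tau> ^ n / (1 - \<tau>)\<close>. The second claim includes
  the extra \<open>\<kappa>\<close> that \<open>abs_det_on_near\<close> will charge, and extracts
  \<open>\<tau> ^ N\<close> to use the assumption on \<open>N\<close>.\<close>

lemma near_image_W:
  assumes n: "N \<le> n"
  shows "near (2 * \<kappa> * K * \<tau> ^ n / (1 - \<tau>)) (A x n ` W x (Suc n)) (E ((T ^^ n) x))"
    "\<kappa> * (2 * \<kappa> * K * \<tau> ^ n / (1 - \<tau>)) \<le> 2 / 3 * \<tau> ^ (n - N)"
proof -
  let ?y = "(T ^^ n) x"
  have "\<kappa> * K * \<tau> ^ n / (1 - \<tau>) * \<kappa> ^ 2 = \<kappa> ^ 3 * K * \<tau> ^ N / (1 - \<tau>) * \<tau> ^ (n - N)"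
    using n by (simp add: power2_eq_square power3_eq_cube power_add[symmetric] mult_ac)
  also have "\<dots> \<le> 1 / 3 * \<tau> ^ (n - N)" using N const unfolding \<kappa>_def[symmetric] by (intro mult_right_mono) auto
  finally have b: "\<kappa> * K * \<tau> ^ n / (1 - \<tau>) * \<kappa> ^ 2 \<le> 1 / 3 * \<tau> ^ (n - N)" .
  have p: "0 \<le> \<kappa> * K * \<tau> ^ n / (1 - \<tau>)" using const kappa_ge_1 by simp
  have "\<kappa> * K * \<tau> ^ n / (1 - \<tau>) * \<kappa> \<le> \<kappa> * K * \<tau> ^ n / (1 - \<tau>) * \<kappa> ^ 2"
    by (intro mult_left_mono[OF _ p] self_le_power kappa_ge_1) simp
  then show "\<kappa> * (2 * \<kappa> * K * \<tau> ^ n / (1 - \<tau>)) \<le> 2 / 3 * \<tau> ^ (n - N)"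
  proof -
    assume "\<kappa> * K * \<tau> ^ n / (1 - \<tau>) * \<kappa> \<le> \<kappa> * K * \<tau> ^ n / (1 - \<tau>) * \<kappa> ^ 2"
    moreover have "\<kappa> * (2 * \<kappa> * K * \<tau> ^ n / (1 - \<tau>)) = 2 * (\<kappa> * K * \<tau> ^ n / (1 - \<tau>) * \<kappa>)" by simp
    ultimately show ?thesis using b by linarith
  qed
  have "\<tau> ^ (n - N) \<le> 1" using const by (intro power_le_one) auto
  moreover have "\<kappa> * K * \<tau> ^ n / (1 - \<tau>) * 1 \<le> \<kappa> * K * \<tau> ^ n / (1 - \<tau>) * \<kappa> ^ 2"
    by (intro mult_left_mono[OF _ p] one_le_power kappa_ge_1)
  ultimately have "\<kappa> * K * \<tau> ^ n / (1 - \<tau>) \<le> 1 / 3" using b by linarith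
  moreover have "\<kappa> * K * \<tau> ^ n \<le> \<kappa> * K * \<tau> ^ n / (1 - \<tau>)"
    using const kappa_ge_1 by (simp add: le_divide_eq mult_left_le)
  ultimately have r: "fast.rate * \<tau> ^ n < 1" "fast.rate * \<tau> ^ n \<le> fast.rate * \<tau> ^ n / (1 - \<tau>)"
    unfolding rate_eq by linarith+
  \<comment> \<open>On \<open>W x (Suc n)\<close> the longer product expands by at least
    \<open>m * s x n\<close>, and its last step accounts for at most a factor \<open>M\<close> of
    this.\<close>
  let ?c = "m * s x n / M"
  have c: "0 < ?c" using const s_pos by simp
  have "?c * norm w \<le> norm (A x n w)" if "w \<in> W x (Suc n)" for w
  proof -
    have "m * s x n * norm w \<le> s x (Suc n) * norm w" by (intro mult_right_mono slow.s_Suc_ge) simp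
    also have "\<dots> \<le> norm (A x (Suc n) w)" using split_W[of x "Suc n"] that by (simp add: singular_split_def)
    also have "\<dots> \<le> M * norm (A x n w)" unfolding A_Suc by (rule A_bounds)
    finally show ?thesis using const by (simp add: field_simps)
  qed
  from singular_split_image_near[OF linear_A split_W t_nonneg c this]
  have "near (t x n / ?c) (A x n ` W x (Suc n)) (A x n ` W x n)" .
  moreover have "t x n / ?c \<le> fast.rate * \<tau> ^ n"
  proof -
    have "t x n / ?c = \<kappa> * (t x n / s x n)" by (simp add: \<kappa>_def)
    also have "\<dots> \<le> \<kappa> * (K * \<tau> ^ n)"
      using domination[of x n] s_pos[of x n] kappa_ge_1 by (intro mult_left_mono) (auto simp: divide_le_eq)
    finally show ?thesis by (simp add: rate_eq)
  qed
  ultimately have "near (fast.rate * \<tau> ^ n) (A x n ` W x (Suc n)) (A x n ` W x n)" by (rule near_mono)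
  then have nr: "near (fast.rate * \<tau> ^ n) (A x n ` W x (Suc n)) (fast.U ?y n)" by (simp add: fast.U_def T_S_pow)
  have "0 \<le> fast.rate * \<tau> ^ n / (1 - \<tau>)" using fast.rate_pos const by simp
  then have "near (fast.rate * \<tau> ^ n + fast.rate * \<tau> ^ n / (1 - \<tau>)) (A x n ` W x (Suc n)) (E ?y)"
    unfolding E_def by (rule near_trans[OF fast.subspace_U fast.subspace_E nr fast.near_U_E[OF r(1)]])
  moreover have "fast.rate * \<tau> ^ n + fast.rate * \<tau> ^ n / (1 - \<tau>) \<le> 2 * \<kappa> * K * \<tau> ^ n / (1 - \<tau>)"
  proof -
    have "2 * \<kappa> * K * \<tau> ^ n / (1 - \<tau>) = 2 * (fast.rate * \<tau> ^ n / (1 - \<tau>))" by (simp add: rate_eq)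
    then show ?thesis
      using add_right_mono[OF r(2), of "fast.rate * \<tau> ^ n / (1 - \<tau>)"] by (simp only: mult_2)
  qed
  ultimately show "near (2 * \<kappa> * K * \<tau> ^ n / (1 - \<tau>)) (A x n ` W x (Suc n)) (E ?y)" by (rule near_mono)
qed

text \<open>\<open>W x (Suc n)\<close> realises the product of singular values at time
  \<open>Suc n\<close>, but at time \<open>n\<close> it is only one of the spaces over which that
  product is maximal.\<close>

lemma volume_Suc_le:
  "volume x (Suc n) \<le> abs_det_on (A x n ` W x (Suc n)) (A ((T ^^ n) x) 1) * volume x n"
proof -
  have "volume x (Suc n) = abs_det_on (A x n ` W x (Suc n)) (A ((T ^^ n) x) 1) * abs_det_on (W x (Suc n)) (A x n)"
    unfolding det_W[symmetric] by (rule det_Suc[OF subspace_W])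
  also have "\<dots> \<le> abs_det_on (A x n ` W x (Suc n)) (A ((T ^^ n) x) 1) * volume x n"
    by (intro mult_left_mono det_le_volume subspace_W dim_W less_imp_le abs_det_on_pos
        linear_subspace_image linear_A inj_on_bij bij_A)
  finally show ?thesis .
qed

text \<open>Before time \<open>N\<close> every step costs at most a factor \<open>\<kappa> ^ k\<close>; afterwards the leading
  singular direction has aligned with \<open>E\<close> and the losses form a geometric series.\<close>
lemma volume_le:
  "volume x n \<le> abs_det_on (E x) (A x n) * \<kappa> ^ (k * min n N) * exp (2 * real k * (1 - \<tau> ^ (n - N)) / (1 - \<tau>))"
proof (induction n)
  case 0
  have "volume x 0 = abs_det_on (W x 0) (A x 0)" by (simp add: det_W)
  also have "\<dots> \<le> 1"
    using abs_det_on_le[OF subspace_W linear_A inj_on_bij[OF bij_A], of x 0 x 0 1] by (simp add: A_0)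
  also have "1 \<le> abs_det_on (E x) (A x 0)"
    using abs_det_on_ge[OF subspace_E linear_A, of x 1 x 0] by (simp add: A_0)
  finally show ?case by simp
next
  case (Suc n)
  let ?y = "(T ^^ n) x" and ?V = "A x n ` W x (Suc n)"
  let ?dV = "abs_det_on ?V (A ?y 1)" and ?dE = "abs_det_on (E ?y) (A ?y 1)"
  let ?C = "\<lambda>n. \<kappa> ^ (k * min n N) * exp (2 * real k * (1 - \<tau> ^ (n - N)) / (1 - \<tau>))"
  have V: "subspace ?V" "dim ?V = k"
    by (simp_all add: linear_subspace_image[OF linear_A subspace_W] dim_image_bij[OF linear_A bij_A] dim_W)
  have dE: "0 < ?dE" by (rule det_E_pos)
  have step: "?dV * ?C n \<le> ?dE * ?C (Suc n)"
  proof (cases "n < N")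
    case True
    have "?dV \<le> M ^ k"
      using abs_det_on_le[OF V(1) linear_A inj_on_bij[OF bij_A] A_bounds(2)] const V(2) by simp
    also have "\<dots> = \<kappa> ^ k * m ^ k" using const by (simp add: \<kappa>_def power_divide)
    also have "\<dots> \<le> \<kappa> ^ k * ?dE"
      using abs_det_on_ge[OF subspace_E linear_A A_bounds(1) const(1), of ?y ?y] kappa_ge_1 dim_E
      by (intro mult_left_mono) auto
    finally have "?dV * ?C n \<le> \<kappa> ^ k * ?dE * ?C n"
      using kappa_ge_1 by (intro mult_right_mono) auto
    also have "\<dots> = ?dE * ?C (Suc n)"
      using True by (simp add: min_def power_add mult_ac)
    finally show ?thesis .
  next
    case False
    then have n: "N \<le> n" by simp
    let ?\<delta> = "2 * \<kappa> * K * \<tau> ^ n / (1 - \<tau>)"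
    have p1: "\<tau> ^ (n - N) \<le> 1" using const by (intro power_le_one) auto
    have \<delta>0: "0 \<le> ?\<delta>" using const kappa_ge_1 by simp
    have "1 * ?\<delta> \<le> \<kappa> * ?\<delta>" using kappa_ge_1 \<delta>0 by (intro mult_right_mono) auto
    then have \<delta>: "?\<delta> \<le> 2 / 3" using near_image_W(2)[OF n] p1 by linarith
    have \<kappa>0: "0 \<le> \<kappa>" using kappa_ge_1 by linarith
    have k\<delta>: "0 \<le> \<kappa> * ?\<delta>" by (rule mult_nonneg_nonneg[OF \<kappa>0 \<delta>0])
    have k0: "0 \<le> \<kappa> * ?\<delta> / (1 - ?\<delta>)" using \<delta> by (intro divide_nonneg_nonneg[OF k\<delta>]) linarith
    have \<delta>1: "?\<delta> < 1" using \<delta> by linarith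
    \<comment> \<open>Since \<open>?\<delta>\<close> is at most 2/3, dividing by
      \<open>1 - ?\<delta>\<close> costs at most a factor 3, which turns 2/3 into 2.\<close>
    have k1: "\<kappa> * ?\<delta> / (1 - ?\<delta>) \<le> 2 * \<tau> ^ (n - N)"
    proof -
      have "a / (1 - d) \<le> 2 * p" if "a \<le> 2 / 3 * p" "0 \<le> a" "d \<le> 2 / 3" for a d p :: real
      proof -
        have "a / (1 - d) \<le> a / (1 / 3)" using that by (intro divide_left_mono) auto
        then show ?thesis using that by simp
      qed
      then show ?thesis using near_image_W(2)[OF n] k\<delta> \<delta> by blast
    qed
    have "?dV \<le> (1 + \<kappa> * ?\<delta> / (1 - ?\<delta>)) ^ dim ?V * ?dE"
      unfolding \<kappa>_def[symmetric]
      by (rule abs_det_on_near[where m = m and M = M, folded \<kappa>_def,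
            OF V(1) subspace_E _ near_image_W(1)[OF n] \<delta>0 \<delta>1 linear_A A_bounds])
         (use const V(2) dim_E in auto)
    also have "dim ?V = k" by (rule V(2))
    also have "(1 + \<kappa> * ?\<delta> / (1 - ?\<delta>)) ^ k \<le> exp (2 * \<tau> ^ (n - N)) ^ k"
      using k0 k1 exp_ge_add_one_self[of "2 * \<tau> ^ (n - N)"] by (intro power_mono) linarith+
    also have "\<dots> = exp (real k * (2 * \<tau> ^ (n - N)))" by (simp add: exp_of_nat_mult)
    finally have "?dV \<le> exp (real k * (2 * \<tau> ^ (n - N))) * ?dE" using dE by simp
    then have "?dV * ?C n \<le> exp (real k * (2 * \<tau> ^ (n - N))) * ?dE * ?C n"
      using kappa_ge_1 by (intro mult_right_mono) auto
    also have "\<dots> = ?dE * (\<kappa> ^ (k * N) * exp (real k * (2 * \<tau> ^ (n - N)) + 2 * real k * (1 - \<tau> ^ (n - N)) / (1 - \<tau>)))"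
      using n by (simp add: exp_add mult_ac min_absorb2)
    \<comment> \<open>The closed form of \<open>2 * real k\<close> times a partial geometric sum
      absorbs its next term.\<close>
    also have "real k * (2 * \<tau> ^ (n - N)) + 2 * real k * (1 - \<tau> ^ (n - N)) / (1 - \<tau>)
        = 2 * real k * (1 - \<tau> ^ (Suc n - N)) / (1 - \<tau>)"
    proof -
      have "real k * (2 * \<tau> ^ (n - N)) = 2 * real k * (\<tau> ^ (n - N) * (1 - \<tau>)) / (1 - \<tau>)" using const by simp
      then show ?thesis
        using n by (simp only: add_divide_distrib[symmetric] Suc_diff_le power_Suc) (simp add: algebra_simps)
    qed
    finally show ?thesis using n by (simp add: min_absorb2)
  qed
  have dV: "0 < ?dV" by (rule abs_det_on_pos[OF V(1) linear_A inj_on_bij[OF bij_A]])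
  have "volume x (Suc n) \<le> ?dV * volume x n" by (rule volume_Suc_le)
  also have "\<dots> \<le> ?dV * (abs_det_on (E x) (A x n) * ?C n)"
    using Suc dV by (intro mult_left_mono) (simp_all add: mult.assoc)
  also have "\<dots> = abs_det_on (E x) (A x n) * (?dV * ?C n)" by simp
  also have "\<dots> \<le> abs_det_on (E x) (A x n) * (?dE * ?C (Suc n))"
    by (intro mult_left_mono step less_imp_le[OF det_E_pos])
  also have "\<dots> = abs_det_on (E x) (A x (Suc n)) * ?C (Suc n)"
    using det_Suc[OF subspace_E, of x x n] by (simp add: A_E)
  finally show ?case by (simp add: mult.assoc)
qed

definition R :: real where
  "R = (INF (x, n)\<in>UNIV \<times> {1..}. abs_det_on (E x) (A x n) / volume x n)"

lemma R_le: "1 \<le> n \<Longrightarrow> R \<le> abs_det_on (E x) (A x n) / volume x n"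
  unfolding R_def
  using less_imp_le[OF det_E_pos] less_imp_le[OF volume_pos]
  by (intro cINF_lower2[of _ _ "(x, n)"] bdd_belowI2[of _ 0]) auto

lemma R_ge: "exp (- (real k * real N * ln \<kappa> + 2 * real k / (1 - \<tau>))) \<le> R"
  unfolding R_def
proof (rule cINF_greatest, goal_cases)
  case (2 p)
  obtain x n where p: "p = (x, n)" by (cases p)
  have "volume x n \<le> abs_det_on (E x) (A x n) * (\<kappa> ^ (k * min n N) * exp (2 * real k * (1 - \<tau> ^ (n - N)) / (1 - \<tau>)))"
    using volume_le[of x n] by (simp add: mult.assoc)
  also have "\<dots> \<le> abs_det_on (E x) (A x n) * (\<kappa> ^ (k * N) * exp (2 * real k / (1 - \<tau>)))"
  proof (intro mult_left_mono[OF _ less_imp_le[OF det_E_pos]] mult_mono)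
    show "\<kappa> ^ (k * min n N) \<le> \<kappa> ^ (k * N)" using kappa_ge_1 by (intro power_increasing) auto
    have "2 * real k * (1 - \<tau> ^ (n - N)) \<le> 2 * real k * 1" using const by (intro mult_left_mono) auto
    then show "exp (2 * real k * (1 - \<tau> ^ (n - N)) / (1 - \<tau>)) \<le> exp (2 * real k / (1 - \<tau>))"
      using const by (simp add: divide_right_mono)
  qed (use kappa_ge_1 in auto)
  also have "\<kappa> ^ (k * N) = exp (real k * real N * ln \<kappa>)"
  proof -
    have "\<kappa> ^ (k * N) = exp (ln \<kappa>) ^ (k * N)" using kappa_ge_1 by simp
    also have "\<dots> = exp (real (k * N) * ln \<kappa>)" by (rule exp_of_nat_mult[symmetric])
    finally show ?thesis by (simp only: of_nat_mult)
  qed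
  also have "abs_det_on (E x) (A x n) * (exp (real k * real N * ln \<kappa>) * exp (2 * real k / (1 - \<tau>)))
      = abs_det_on (E x) (A x n) / exp (- (real k * real N * ln \<kappa> + 2 * real k / (1 - \<tau>)))"
    by (simp only: exp_add[symmetric] exp_minus divide_inverse inverse_inverse_eq)
  finally show ?case
    using volume_pos[of x n] by (simp add: p field_simps)
qed simp

lemma R_pos: "0 < R" by (rule less_le_trans[OF exp_gt_zero R_ge])

lemma R_le_1: "R \<le> 1"
proof -
  obtain x :: 'x where True by blast
  have "R \<le> abs_det_on (E x) (A x 1) / volume x 1" by (rule R_le) simp
  also have "\<dots> \<le> 1" using det_le_volume[OF subspace_E dim_E, of x x 1] volume_pos[of x 1] by simp
  finally show ?thesis .
qed

section \<open>Expansion, transversality and contraction from the volume ratio\<close>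

text \<open>A direction of \<open>E x\<close> expanded much less than \<open>s x n\<close> would
  depress the whole determinant, by \<open>ratio_le(1)\<close>.\<close>

lemma E_expanded:
  assumes e: "e \<in> E x" and n: "1 \<le> n"
  shows "R * s x n * norm e \<le> norm (A x n e)"
proof (cases "e = 0")
  case False
  let ?e = "e /\<^sub>R norm e"
  have e': "?e \<in> E x" "norm ?e = 1" using False e subspace_scale[OF subspace_E] by simp_all
  have "R \<le> abs_det_on (E x) (A x n) / volume x n" by (rule R_le[OF n])
  also have "\<dots> \<le> norm (A x n ?e) / s x n"
    using ratio_le(1)[OF e', of n] volume_pos[of x n] by (simp add: divide_le_eq mult.commute)
  also have "\<dots> = norm (A x n e) / norm e / s x n" by (simp add: blinfun.scaleR_right divide_inverse mult.commute)
  finally show ?thesis using False s_pos[of x n] by (simp add: field_simps)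
qed simp

lemma E_transverse:
  assumes e: "e \<in> E x"
  shows "R * norm e \<le> norm (closest_point (slow.E x) e)"
proof (cases "e = 0")
  case False
  let ?e = "e /\<^sub>R norm e" and ?P = "closest_point (slow.E x)"
  have e': "?e \<in> E x" "norm ?e = 1" using False e subspace_scale[OF subspace_E] by simp_all
  \<comment> \<open>The leading right singular spaces are the slow sequence, so their projections
    converge to the one onto \<open>slow.E x\<close>.\<close>
  have WU: "W x n = slow.U x n" for n by (simp add: slow.U_def adjoint_W)
  have "R\<^sup>2 \<le> (norm (?P ?e))\<^sup>2 + 0\<^sup>2"
  proof (rule tendsto_lowerbound)
    have "(\<lambda>n. closest_point (W x n) ?e - ?P ?e) \<longlonglongrightarrow> 0"
    proof (rule Lim_null_comparison)
      have "\<forall>\<^sub>F n in sequentially. slow.rate * \<tau> ^ n < 1"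
        by (rule order_tendstoD(2)[OF slow.tendsto_geometric]) simp
      then show "\<forall>\<^sub>F n in sequentially. norm (closest_point (W x n) ?e - ?P ?e) \<le> slow.rate / (1 - \<tau>) * \<tau> ^ n"
      proof (rule eventually_mono)
        fix n assume "slow.rate * \<tau> ^ n < 1"
        from slow.E_tail[OF this, of x ?e] e'(2)
        show "norm (closest_point (W x n) ?e - ?P ?e) \<le> slow.rate / (1 - \<tau>) * \<tau> ^ n"
          unfolding WU by simp
      qed
      show "(\<lambda>n. slow.rate / (1 - \<tau>) * \<tau> ^ n) \<longlonglongrightarrow> 0" by (rule slow.tendsto_geometric)
    qed
    then have "(\<lambda>n. closest_point (W x n) ?e) \<longlonglongrightarrow> ?P ?e" by (simp add: LIM_zero_iff)
    then show "(\<lambda>n. (norm (closest_point (W x n) ?e))\<^sup>2 + (K * \<tau> ^ n)\<^sup>2) \<longlonglongrightarrow> (norm (?P ?e))\<^sup>2 + 0\<^sup>2"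
      by (intro tendsto_intros slow.tendsto_geometric)
    show "\<forall>\<^sub>F n in sequentially. R\<^sup>2 \<le> (norm (closest_point (W x n) ?e))\<^sup>2 + (K * \<tau> ^ n)\<^sup>2"
      using eventually_ge_at_top[of 1]
    proof (rule eventually_mono)
      fix n :: nat assume n: "1 \<le> n"
      have "R\<^sup>2 \<le> (abs_det_on (E x) (A x n) / volume x n)\<^sup>2"
        using R_le[OF n, of x] R_pos by (intro power_mono) auto
      also have "\<dots> \<le> (norm (closest_point (W x n) ?e))\<^sup>2 + (t x n / s x n)\<^sup>2"
        using ratio_le(2)[OF e', of n] volume_pos[of x n] by (simp add: power_divide divide_le_eq mult.commute)
      also have "(t x n / s x n)\<^sup>2 \<le> (K * \<tau> ^ n)\<^sup>2"
        using domination[of x n] s_pos[of x n] t_pos[of x n] by (intro power_mono) (auto simp: divide_le_eq)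
      finally show "R\<^sup>2 \<le> (norm (closest_point (W x n) ?e))\<^sup>2 + (K * \<tau> ^ n)\<^sup>2" by simp
    qed
  qed simp
  then have "R\<^sup>2 \<le> (norm (?P ?e))\<^sup>2" by simp
  then have "R \<le> norm (?P ?e)" by (rule power2_le_imp_le) simp
  also have "\<dots> = norm (?P e) / norm e"
    by (simp add: linear_scale[OF linear_closest_point[OF slow.subspace_E]] divide_inverse mult.commute)
  finally show ?thesis using False by (simp add: field_simps)
qed (simp add: linear_0[OF linear_closest_point[OF slow.subspace_E]])

text \<open>A common vector is annihilated by the projection onto \<open>slow.E x\<close>, which
  \<open>E_transverse\<close> allows only for 0; the dimensions do the rest.\<close>

lemma direct_sum: "direct_sum_decomposition (E x) (F x)"
proof -
  have 0: "v = 0" if "v \<in> E x" "v \<in> F x" for v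
    using E_transverse[OF that(1)] closest_point_orthogonal_comp_0[OF slow.subspace_E] that(2) R_pos
    by (simp add: F_def mult_le_0_iff)
  then have int: "E x \<inter> F x = {0}" using subspace_0[OF subspace_E] subspace_0[OF subspace_F] by auto
  have "dim {u + w |u w. u \<in> E x \<and> w \<in> F x} + dim (E x \<inter> F x) = dim (E x) + dim (F x)"
    by (rule dim_sums_Int[OF subspace_E subspace_F])
  then have "dim {u + w |u w. u \<in> E x \<and> w \<in> F x} = DIM('a)"
    using int dim_F[of x] by (simp add: dim_E)
  moreover have "subspace {u + w |u w. u \<in> E x \<and> w \<in> F x}" by (rule subspace_sums[OF subspace_E subspace_F])
  ultimately have "{u + w |u w. u \<in> E x \<and> w \<in> F x} = UNIV"
    by (intro subspace_dim_equal subspace_UNIV subset_UNIV) simp_all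
  then show ?thesis using int by (simp add: direct_sum_decomposition_def subspace_E subspace_F)
qed

text \<open>The projection onto \<open>slow.E x\<close> has kernel \<open>F x\<close>, so it takes
  the same value on \<open>v\<close> and on its component \<open>u\<close> in \<open>E x\<close>,
  where it shrinks by at most the factor \<open>R\<close>.\<close>

lemma proj_along_bound: "onorm (proj_along (E x) (F x)) \<le> inverse R"
proof (rule onorm_bound)
  fix v
  have "v \<in> {u + w |u w. u \<in> E x \<and> w \<in> F x}" using direct_sum by (simp add: direct_sum_decomposition_def)
  then obtain u w where uw: "v = u + w" "u \<in> E x" "w \<in> F x" by blast
  have "proj_along (E x) (F x) v = u"
    unfolding proj_along_def
  proof (rule the_equality)
    fix u' assume u': "u' \<in> E x \<and> v - u' \<in> F x"
    have "u - u' \<in> E x" using u' uw subspace_diff[OF subspace_E] by blast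
    moreover have "u - u' = (v - u') - w" using uw by simp
    then have "u - u' \<in> F x" using u' uw subspace_diff[OF subspace_F] by metis
    ultimately have "u - u' \<in> E x \<inter> F x" by blast
    then have "u - u' \<in> {0}" using direct_sum[of x] by (simp only: direct_sum_decomposition_def)
    then show "u' = u" by simp
  qed (use uw in simp)
  moreover have "R * norm u \<le> norm v"
  proof -
    let ?P = "closest_point (slow.E x)"
    have "R * norm u \<le> norm (?P u)" by (rule E_transverse[OF uw(2)])
    also have "?P u = ?P v"
      using closest_point_orthogonal_comp_0[OF slow.subspace_E, of w x] uw
      by (simp add: linear_add[OF linear_closest_point[OF slow.subspace_E]] F_def)
    also have "norm (?P v) \<le> norm v" by (rule norm_closest_point_le[OF slow.subspace_E])
    finally show ?thesis .
  qed
  ultimately show "norm (proj_along (E x) (F x) v) \<le> inverse R * norm v" using R_pos by (simp add: field_simps)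
qed (use R_pos in simp)

text \<open>The angle bound seen from the other side. A vector \<open>f\<close> of
  \<open>F x\<close> meets \<open>e\<close> only through the component \<open>q\<close> of
  \<open>e\<close> in \<open>F x\<close>, whose length is at most sqrt(1 - R^2) |e|. This bounds the
  cosine, hence the sine is at least \<open>R\<close>.\<close>

lemma F_away_from_E:
  assumes e: "e \<in> E x" and f: "f \<in> F x"
  shows "R * norm f \<le> norm (f - e)"
proof -
  let ?P = "closest_point (slow.E x)"
  define q where "q = e - ?P e"
  have R2: "0 \<le> 1 - R\<^sup>2" using R_pos R_le_1 by (simp add: power_le_one)
  have "(R * norm e)\<^sup>2 \<le> (norm (?P e))\<^sup>2" using E_transverse[OF e] R_pos by (intro power_mono) auto
  then have q: "(norm q)\<^sup>2 \<le> (1 - R\<^sup>2) * (norm e)\<^sup>2"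
    using norm_closest_point_pythagoras[OF slow.subspace_E, of e x]
    by (simp add: q_def power_mult_distrib algebra_simps)
  have "f \<bullet> e = f \<bullet> q"
    using orthogonal_compD(1)[OF f[unfolded F_def] closest_point_in_subspace[OF slow.subspace_E], of e]
    by (simp add: q_def inner_diff_right)
  then have "(f \<bullet> e)\<^sup>2 \<le> (norm f)\<^sup>2 * (norm q)\<^sup>2"
    by (metis Cauchy_Schwarz_ineq power2_norm_eq_inner)
  also have "\<dots> \<le> (norm f)\<^sup>2 * ((1 - R\<^sup>2) * (norm e)\<^sup>2)" using q by (intro mult_left_mono) auto
  finally have fe: "(f \<bullet> e)\<^sup>2 \<le> (1 - R\<^sup>2) * (norm f)\<^sup>2 * (norm e)\<^sup>2" by (simp add: mult_ac)
  \<comment> \<open>With \<open>f \<bullet> e\<close> at most \<open>a * norm e\<close>, the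
    inequality 2 a |e| \<le> a^2 + |e|^2 eliminates \<open>e\<close> from the expansion of
    \<open>norm (f - e)\<close>.\<close>
  define a where "a = sqrt (1 - R\<^sup>2) * norm f"
  have "(f \<bullet> e)\<^sup>2 \<le> (a * norm e)\<^sup>2" using fe R2 by (simp add: a_def power_mult_distrib)
  moreover have "0 \<le> a * norm e" using R2 by (simp add: a_def)
  ultimately have "f \<bullet> e \<le> a * norm e" by (rule power2_le_imp_le)
  moreover have "2 * (a * norm e) \<le> a\<^sup>2 + (norm e)\<^sup>2" using sum_squares_bound[of a "norm e"] by simp
  moreover have "a\<^sup>2 = (1 - R\<^sup>2) * (norm f)\<^sup>2" using R2 by (simp add: a_def power_mult_distrib)
  moreover have "(norm (f - e))\<^sup>2 = (norm f)\<^sup>2 - 2 * (f \<bullet> e) + (norm e)\<^sup>2"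
    by (simp add: power2_norm_eq_inner inner_diff_left inner_diff_right inner_commute)
  ultimately have "(R * norm f)\<^sup>2 \<le> (norm (f - e))\<^sup>2" by (simp add: power_mult_distrib algebra_simps)
  then show ?thesis by (rule power2_le_imp_le) simp
qed

text \<open>The two powers of \<open>R\<close> have different origins: one is the volume lost on
  \<open>E x\<close>, the other the angle of E and F at the image point.\<close>

lemma F_contracted:
  assumes f: "f \<in> F x" and n: "1 \<le> n"
  shows "norm (A x n f) \<le> inverse (R\<^sup>2) * t x n * norm f"
proof (cases "f = 0")
  case False
  have fE: "f \<notin> E x" using f False direct_sum[of x] by (auto simp: direct_sum_decomposition_def)
  let ?V = "span (insert f (E x))"
  have dV: "dim ?V = k + 1" using fE dim_E[of x] subspace_E[of x] by (simp add: dim_insert span_eq_iff[THEN iffD2])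
  have k1: "1 \<le> k + 1" "k + 1 \<le> DIM('a)" using k by auto
  have t2: "singular_value (A x n) (k + 1 + 1) \<le> t x n" if "k + 1 < DIM('a)"
    using that by (intro singular_value_antimono) auto
  \<comment> \<open>At index \<open>k + 1\<close> the value \<open>t x n\<close> serves as both
    bounds: it is the least singular value on \<open>W'\<close> and dominates those beyond, if there
    are any.\<close>
  obtain W' where W': "subspace W'" "dim W' = k + 1" "singular_split (A x n) W' (t x n) (t x n)"
    "abs_det_on W' (A x n) = (\<Prod>i=1..k + 1. singular_value (A x n) i)"
    using exists_singular_split[OF bij_A k1 t2 t_nonneg] by blast
  have "R * volume x n * (R * norm (A x n f)) \<le> abs_det_on (E x) (A x n) * (R * norm (A x n f))"
    using R_le[OF n, of x] volume_pos[of x n] R_pos by (intro mult_right_mono) (auto simp: field_simps)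
  also have "\<dots> \<le> norm f * abs_det_on ?V (A x n)"
  proof (rule abs_det_on_insert_ge[OF linear_A bij_A subspace_E fE])
    fix e assume "e \<in> E x"
    then have "A x n e \<in> E ((T ^^ n) x)" using A_E by blast
    then show "R * norm (A x n f) \<le> norm (A x n f - A x n e)" by (rule F_away_from_E[OF _ A_F[OF f]])
  qed (use R_pos in simp)
  also have "\<dots> \<le> norm f * abs_det_on W' (A x n)"
    using W' dV by (intro mult_left_mono abs_det_on_le_split[OF linear_A bij_A W'(3) t_pos] t_nonneg) auto
  also have "\<dots> = volume x n * (t x n * norm f)" by (simp add: W'(4) mult_ac)
  finally have "volume x n * (R\<^sup>2 * norm (A x n f)) \<le> volume x n * (t x n * norm f)"
    by (simp add: power2_eq_square mult_ac)
  then have "R\<^sup>2 * norm (A x n f) \<le> t x n * norm f" using volume_pos by simp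
  then show ?thesis using R_pos by (simp add: field_simps)
qed simp

lemma onorm_on_inverse:
  assumes "1 \<le> n"
  shows "onorm_on (A x n ` E x) (inv_into (E x) (A x n)) \<le> inverse R * inverse (s x n)"
  unfolding onorm_on_def
proof (rule cSUP_least)
  show "A x n ` E x \<noteq> {}" using subspace_0[OF subspace_E] by blast
  fix v assume "v \<in> A x n ` E x"
  then obtain e where e: "e \<in> E x" "v = A x n e" by blast
  have "inv_into (E x) (A x n) v = e" using e by (simp add: inv_into_f_f inj_on_bij[OF bij_A])
  \<comment> \<open>For \<open>v = 0\<close> the quotient is 0 by the convention on
    division.\<close>
  then show "norm (inv_into (E x) (A x n) v) / norm v \<le> inverse R * inverse (s x n)"
    using E_expanded[OF e(1) assms] e(2) R_pos s_pos[of x n]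
    by (cases "v = 0") (auto simp: field_simps)
qed

lemma onorm_on_F:
  assumes "1 \<le> n"
  shows "onorm_on (F x) (A x n) \<le> inverse (R\<^sup>2) * t x n"
  unfolding onorm_on_def
proof (rule cSUP_least)
  show "F x \<noteq> {}" using subspace_0[OF subspace_F] by blast
  fix f assume "f \<in> F x"
  then show "norm (A x n f) / norm f \<le> inverse (R\<^sup>2) * t x n"
    using F_contracted[OF _ assms] R_pos t_pos[of x n] by (cases "f = 0") (auto simp: divide_le_eq)
qed

lemma splitting: "continuous_equivariant_splitting T A E F"
  unfolding continuous_equivariant_splitting_def
  using direct_sum continuous_E continuous_F A_E A_F by blast

end

section \<open>From the hypotheses of the theorem to the constants\<close>

text \<open>Applied to the cocycle at time 0, where it turns domination into a lower bound for
  \<open>K\<close>.\<close>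

lemma singular_value_id:
  fixes A :: "'a::euclidean_space \<Rightarrow>\<^sub>L 'a"
  assumes A: "\<And>v. A v = v" and i: "i \<in> {1..DIM('a)}"
  shows "singular_value A i = 1"
proof -
  obtain b :: "nat \<Rightarrow> 'a" where b:
    "\<And>i j. i \<in> {1..DIM('a)} \<Longrightarrow> j \<in> {1..DIM('a)} \<Longrightarrow> b i \<bullet> b j = (if i = j then 1 else 0)"
    "\<And>i v. i \<in> {1..DIM('a)} \<Longrightarrow> A (b i) \<bullet> A v = (singular_value A i)\<^sup>2 * (b i \<bullet> v)"
    "\<And>i. i \<in> {1..DIM('a)} \<Longrightarrow> 0 \<le> singular_value A i"
    using singular_value_decomposition[of A] by metis
  have "(singular_value A i)\<^sup>2 = 1" using b(1)[OF i i] b(2)[OF i, of "b i"] by (simp add: A)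
  then show ?thesis using b(3)[OF i] by (simp add: power2_eq_1_iff)
qed

text \<open>Invertibility makes both suprema positive, so a finite product leaves no room for an
  infinite factor. \<open>M\<close> is the first supremum and \<open>m\<close> the reciprocal of the
  second.\<close>

lemma bounds_of_condition_number:
  fixes L :: "'x \<Rightarrow> 'a::euclidean_space \<Rightarrow>\<^sub>L 'a"
  assumes bij: "\<And>x. bij (blinfun_apply (L x))"
    and kappa: "ereal \<kappa> = (SUP x. ereal (norm (L x))) * (SUP x. ereal (onorm (inv (blinfun_apply (L x)))))"
  obtains m M where "0 < m" "m \<le> M" "\<kappa> = M / m"
    "\<And>x v. m * norm v \<le> norm (L x v)" "\<And>x v. norm (L x v) \<le> M * norm v"
proof -
  let ?I = "\<lambda>x. inv (blinfun_apply (L x))"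
  have lin: "linear (blinfun_apply (L x))" for x by (rule linear_blinfun_apply)
  have blI: "bounded_linear (?I x)" for x
    using linear_bij_inv[OF lin bij] by (simp add: linear_conv_bounded_linear)
  obtain z :: 'a where z: "norm z = 1" using vector_choose_size[of 1] by auto
  have LI: "?I x (L x v) = v" "L x (?I x v) = v" for x v
    using bij[of x] by (simp_all add: bij_is_inj bij_is_surj surj_f_inv_f)
  have pos1: "0 < norm (L x)" for x
  proof -
    have "L x \<noteq> 0" using LI(2)[of x z] z by auto
    then show ?thesis by simp
  qed
  have pos2: "0 < onorm (?I x)" for x
  proof -
    have "norm z \<le> onorm (?I x) * norm (L x z)" using onorm[OF blI, of x "L x z"] by (simp add: LI)
    then show ?thesis using z onorm_pos_le[OF blI, of x] by (cases "onorm (?I x) = 0") auto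
  qed
  define a where "a = (SUP x. ereal (norm (L x)))"
  define b where "b = (SUP x. ereal (onorm (?I x)))"
  have a: "ereal (norm (L x)) \<le> a" and b: "ereal (onorm (?I x)) \<le> b" for x
    by (auto simp: a_def b_def intro: SUP_upper)
  have ab0: "0 < a" "0 < b"
    using less_le_trans[of 0 "ereal (norm (L undefined))" a] less_le_trans[of 0 "ereal (onorm (?I undefined))" b]
      a b pos1 pos2 by auto
  have ab: "a * b = ereal \<kappa>" using kappa by (simp add: a_def b_def)
  obtain M where M: "a = ereal M" using ab ab0 by (cases a) (auto simp: ereal_mult_eq_PInfty split: if_splits)
  obtain c where c: "b = ereal c" using ab ab0 by (cases b) (auto simp: ereal_mult_eq_PInfty split: if_splits)
  have p: "0 < M" "0 < c" using ab0 M c by auto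
  have up: "norm (L x v) \<le> M * norm v" for x v
  proof -
    have "norm (L x v) \<le> norm (L x) * norm v" by (rule norm_blinfun)
    also have "\<dots> \<le> M * norm v" using a[of x] M by (intro mult_right_mono) auto
    finally show ?thesis .
  qed
  have lo: "1 / c * norm v \<le> norm (L x v)" for x v
  proof -
    have "norm v \<le> onorm (?I x) * norm (L x v)" using onorm[OF blI, of x "L x v"] by (simp add: LI)
    also have "\<dots> \<le> c * norm (L x v)" using b[of x] c by (intro mult_right_mono) auto
    finally show ?thesis using p by (simp add: field_simps)
  qed
  have "1 / c \<le> M" using order_trans[OF lo[of z] up[of _ z]] z by simp
  moreover have "\<kappa> = M / (1 / c)" using ab M c by simp
  ultimately show ?thesis using that[of "1 / c" M] p up lo by simp
qed

theorem theorem4: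
  fixes T :: "'x::topological_space \<Rightarrow> 'x"
    and A :: "'x \<Rightarrow> nat \<Rightarrow> ((real ^ 'n) \<Rightarrow>\<^sub>L (real ^ 'n))"
    and \<kappa> K \<tau> :: real
    and k :: nat
  assumes T: "\<exists>S. homeomorphism UNIV UNIV T S"
    and A: "continuous_cocycle T A"
    and A_invertible: "\<forall>x n. bij (blinfun_apply (A x n))"
    and kappa: "ereal \<kappa> =
      (SUP x. ereal (norm (A x 1))) * (SUP x. ereal (onorm (inv (blinfun_apply (A x 1)))))"
    and k: "1 \<le> k" "k < CARD('n)"
    and K: "K > 0"
    and \<tau>: "0 < \<tau>" "\<tau> < 1"
    and domination: "\<forall>x n. singular_value (A x n) (k + 1) \<le> K * \<tau> ^ n * singular_value (A x n) k"
  shows "\<exists>(R::real) E F.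
      0 < R \<and> R \<le> 1 \<and>
      continuous_equivariant_splitting T A E F \<and>
      (\<forall>x. dim (E x) = k) \<and>
      (\<forall>x. \<forall>n\<ge>1.
         onorm_on (A x n ` E x) (inv_into (E x) (A x n))
           \<le> inverse R * inverse (singular_value (A x n) k) \<and>
         onorm_on (F x) (A x n) \<le> inverse (R\<^sup>2) * singular_value (A x n) (k + 1) \<and>
         onorm (proj_along (E x) (F x)) \<le> inverse R) \<and>
      R = (INF (x, n)\<in>UNIV \<times> {1..}.
             abs_det_on (E x) (A x n) / (\<Prod>i = 1..k. singular_value (A x n) i)) \<and>
      ln R \<ge> - (2 * real k * ln \<kappa> *
                  real_of_int \<lceil>(ln (3 * \<kappa> ^ 3 * K) - ln (1 - \<tau>)) / (- ln \<tau>)\<rceil>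
                + 36 * real k / (1 - \<tau>))"
proof -
  obtain S where S: "homeomorphism UNIV UNIV T S" using T by blast
  have TS: "T (S x) = x" "S (T x) = x" and contS: "continuous_on UNIV S" for x
    using S by (simp_all add: homeomorphism_def)
  have bij: "bij (blinfun_apply (A x n))" for x n using A_invertible by blast
  obtain m M where mM: "0 < m" "m \<le> M" "\<kappa> = M / m"
    and bounds: "\<And>x v. m * norm v \<le> norm (A x 1 v)" "\<And>x v. norm (A x 1 v) \<le> M * norm v"
    using bounds_of_condition_number[OF bij kappa] by blast
  have \<kappa>1: "1 \<le> \<kappa>" using mM by simp
  have coc: "cocycle T A" and contA: "\<And>n. continuous_on UNIV (\<lambda>x. A x n)"
    using A by (auto simp: continuous_cocycle_def)
  \<comment> \<open>At time 0 all singular values are 1, and domination there reads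
    \<open>1 \<le> K\<close>.\<close>
  have K1: "1 \<le> K"
  proof -
    have "A undefined 0 v = v" for v using coc by (simp add: cocycle_def)
    then have "singular_value (A undefined 0) i = 1" if "i \<in> {1..CARD('n)}" for i
      using singular_value_id[of "A undefined 0" i] that by simp
    then show ?thesis using spec[OF spec[OF domination, of undefined], of 0] k by simp
  qed
  \<comment> \<open>\<open>c\<close> solves
    \<open>3 * \<kappa> ^ 3 * K * \<tau> powr c = 1 - \<tau>\<close>, so every integer time from
    \<open>c\<close> on meets the requirement on \<open>N\<close>.\<close>
  define c where "c = (ln (3 * \<kappa> ^ 3 * K) - ln (1 - \<tau>)) / (- ln \<tau>)"
  have \<kappa>K: "1 \<le> 3 * \<kappa> ^ 3 * K"
    using mult_mono[of 1 "\<kappa> ^ 3" 1 K] one_le_power[OF \<kappa>1, of 3] K1 \<kappa>1 by linarith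
  have ln\<tau>: "0 < - ln \<tau>" "ln (1 - \<tau>) \<le> 0" using \<tau> by simp_all
  \<comment> \<open>Nonnegativity makes the natural number \<open>N\<close> equal to the ceiling as
    an integer.\<close>
  have c0: "0 \<le> c" unfolding c_def using ln\<tau> ln_ge_zero[OF \<kappa>K] by (intro divide_nonneg_pos) linarith+
  define N where "N = nat \<lceil>c\<rceil>"
  have N: "real N = real_of_int \<lceil>c\<rceil>" using c0 by (simp add: N_def)
  have N_bound: "(M / m) ^ 3 * K * \<tau> ^ N / (1 - \<tau>) \<le> 1 / 3"
  proof -
    have "c \<le> real N" unfolding N by (rule le_of_int_ceiling)
    then have "ln (3 * \<kappa> ^ 3 * K) - ln (1 - \<tau>) \<le> real N * (- ln \<tau>)"
      using ln\<tau>(1) unfolding c_def by (simp only: pos_divide_le_eq)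
    moreover have "ln (3 * \<kappa> ^ 3 * K * \<tau> ^ N / (1 - \<tau>)) = ln (3 * \<kappa> ^ 3 * K) + real N * ln \<tau> - ln (1 - \<tau>)"
      using \<tau> \<kappa>K \<kappa>1 K1 by (subst ln_div, simp, simp, subst ln_mult) (auto simp: ln_realpow)
    ultimately have "ln (3 * \<kappa> ^ 3 * K * \<tau> ^ N / (1 - \<tau>)) \<le> 0" by linarith
    moreover have "0 < 3 * \<kappa> ^ 3 * K * \<tau> ^ N / (1 - \<tau>)" using \<tau> \<kappa>1 K1 by simp
    ultimately have "3 * \<kappa> ^ 3 * K * \<tau> ^ N / (1 - \<tau>) \<le> 1" by (simp only: ln_le_zero_iff)
    then show ?thesis unfolding mM(3)[symmetric] by (simp add: mult_ac)
  qed
  interpret D: dominated_cocycle T S A k N m M K \<tau>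
    by (rule dominated_cocycle.intro)
       (use TS contS coc contA bij bounds k mM K \<tau> domination N_bound in auto)
  have "exp (- (real k * real N * ln \<kappa> + 2 * real k / (1 - \<tau>))) \<le> D.R"
    using D.R_ge by (simp only: D.\<kappa>_def mM(3))
  then have lnR: "- (real k * real N * ln \<kappa> + 2 * real k / (1 - \<tau>)) \<le> ln D.R"
    using D.R_pos by (simp add: ln_ge_iff)
  \<comment> \<open>The bound obtained has half of the first stated term and an eighteenth of the
    second; both terms are nonnegative.\<close>
  have "0 \<le> real k * real N * ln \<kappa>" using \<kappa>1 by simp
  moreover have "2 * real k / (1 - \<tau>) \<le> 36 * real k / (1 - \<tau>)" using \<tau> by (intro divide_right_mono) auto
  ultimately have "- (2 * real k * ln \<kappa> * real_of_int \<lceil>c\<rceil> + 36 * real k / (1 - \<tau>)) \<le> ln D.R"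
    using lnR unfolding N[symmetric] by (simp add: mult_ac)
  then show ?thesis
    using D.R_pos D.R_le_1 D.splitting D.dim_E D.onorm_on_inverse D.onorm_on_F D.proj_along_bound D.R_def
    unfolding c_def by (intro exI[of _ D.R] exI[of _ D.E] exI[of _ D.F]) auto
qed

end
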